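(* Let $m\ge 1$ be an integer, let $\mu\in\mathbb{R}$, and let $w$ be a vortex profile for $(m,\mu)$ (as defined in the context). Let $A$ be the linearized operator associated with $(m,\mu,w)$, regarded as an unbounded operator on $L^2(\mathbb{R}^2,\mathbb{C}^2)$ (as defined in the context). Then the spectrum of $A$ consists entirely of isolated eigenvalues of finite multiplicity; that is, the essential spectrum of $A$ is empty.
   Context: Polar coordinates $(r,\theta)$ are used on $\mathbb{R}^2$. Vortex profile: for an integer $m\ge 1$ and $\mu\in\mathbb{R}$, a vortex profile is a positive function $w:(0,\infty)\to\mathbb{R}$ solving $$-w_{rr}-\tfrac1r w_r+\tfrac{m^2}{r^2}w+r^2w+2|w|^2w-2\mu w=0,\qquad r>0,$$ with $w(r)$ bounded as $r\to0^+$ and $w(r)\to0$ as $r\to\infty$, and with finite energy, i.e. $\psi(r,\theta)=e^{im\theta}w(r)$ satisfies $\int_{\mathbb{R}^2}\left[\tfrac12|\nabla\psi|^2+\left(\tfrac12r^2+|\psi|^2\right)|\psi|^2\right]dx<\infty$. Linearized operator: let $J=\begin{pmatrix}0&-1\\1&0\end{pmatrix}$, $R=\begin{pmatrix}1&0\\0&-1\end{pmatrix}$, and let $I$ be the $2\times2$ identity. Let $L_c$ be the unique self-adjoint operator on $L^2$ (of $\mathbb{R}^2$, complexified to have values in $\mathbb{C}^2$) associated with the closed nonnegative quadratic form $$q(\Psi,\Psi)=\int_{\mathbb{R}^2}\left[\tfrac12|\nabla\Psi|^2+\tfrac{r^2}{2}|\Psi|^2\right]dx,$$ with form domain $\{\Psi\in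 H^1: r\Psi\in L^2\}$; thus $L_c\Psi=(-\tfrac12\Delta+\tfrac12r^2)\Psi$ in the sense of distributions for $\Psi\in D(L_c)$. Let $L_w$ be the bounded multiplication operator $L_w=2|w(r)|^2I+|w(r)|^2e^{2m\theta J}R-\mu I$. Define $A=-J(L_c+L_w)$ with domain $D(A)=D(L_c)$, regarded as an unbounded, closed, densely defined operator on $L^2(\mathbb{R}^2,\mathbb{C}^2)$. Equivalently, $$A\Phi=J\left[\tfrac12\Delta-\left(\tfrac12r^2-\mu+2|w|^2\right)-|w|^2e^{2m\theta J}R\right]\Phi .$$ The discrete spectrum of a closed operator is the set of isolated points of its spectrum that are eigenvalues of finite (algebraic) multiplicity; the essential spectrum is the rest of the spectrum. *)

theory Defs
  imports "HOL-Complex_Analysis.Complex_Analysis"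
begin

section \<open>Square-integrable functions on the plane\<close>

text \<open>Elements of \<open>L\<^sup>2(\<real>\<^sup>2, \<complex>\<^sup>2)\<close> are handled through their Borel representatives; equality
  in \<open>L\<^sup>2\<close> is equality almost everywhere. The norm on \<^typ>\<open>complex^2\<close> is the Euclidean one.\<close>

type_synonym field2 = "real^2 \<Rightarrow> complex^2"

definition L2 :: "field2 set" where
  "L2 = {f \<in> borel_measurable lborel. integrable lborel (\<lambda>x. (norm (f x))\<^sup>2)}"

definition L2_eq :: "field2 \<Rightarrow> field2 \<Rightarrow> bool" where
  "L2_eq f g \<longleftrightarrow> (AE x in lborel. f x = g x)"

definition herm :: "complex^2 \<Rightarrow> complex^2 \<Rightarrow> complex" where
  "herm a b = (\<Sum>i\<in>UNIV. a $ i * cnj (b $ i))"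

definition L2_inner :: "field2 \<Rightarrow> field2 \<Rightarrow> complex" where
  "L2_inner f g = (\<integral>x. herm (f x) (g x) \<partial>lborel)"

definition L2_norm :: "field2 \<Rightarrow> real" where
  "L2_norm f = sqrt (\<integral>x. (norm (f x))\<^sup>2 \<partial>lborel)"


section \<open>Unbounded operators and their spectra\<close>

text \<open>An unbounded operator is represented by its graph, a set of pairs of representatives
  which is saturated under almost-everywhere equality of Borel functions in both components.\<close>

type_synonym L2_operator = "(field2 \<times> field2) set"

text \<open>\<open>solves_shifted T z f u\<close> says \<open>u \<in> D(T)\<close> and \<open>(T - z) u = f\<close> in \<open>L\<^sup>2\<close>.\<close>

definition solves_shifted :: "L2_operator \<Rightarrow> complex \<Rightarrow> field2 \<Rightarrow> field2 \<Rightarrow> bool" where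
  "solves_shifted T z f u \<longleftrightarrow> (\<exists>g. (u, g) \<in> T \<and> L2_eq (\<lambda>x. g x - z *s u x) f)"

text \<open>A representative of \<open>(T - z)\<^sup>-\<^sup>1 f\<close>; meaningful only if \<open>z\<close> is in the resolvent set.\<close>

definition resolvent :: "L2_operator \<Rightarrow> complex \<Rightarrow> field2 \<Rightarrow> field2" where
  "resolvent T z f = (SOME u. solves_shifted T z f u)"

definition resolvent_set :: "L2_operator \<Rightarrow> complex set" where
  "resolvent_set T = {z.
     (\<forall>f\<in>L2. \<exists>u. solves_shifted T z f u) \<and>
     (\<forall>f\<in>L2. \<forall>u v. solves_shifted T z f u \<longrightarrow> solves_shifted T z f v \<longrightarrow> L2_eq u v) \<and>
     (\<exists>C. \<forall>f\<in>L2. L2_norm (resolvent T z f) \<le> C * L2_norm f)}"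

definition spectrum :: "L2_operator \<Rightarrow> complex set" where
  "spectrum T = - resolvent_set T"

definition eigenvalue :: "L2_operator \<Rightarrow> complex \<Rightarrow> bool" where
  "eigenvalue T z \<longleftrightarrow> (\<exists>u. solves_shifted T z (\<lambda>x. 0) u \<and> \<not> L2_eq u (\<lambda>x. 0))"

text \<open>\<open>p = P f\<close> for the Riesz projection
  \<open>P = - 1/(2 \<pi> i) \<ointegral> (T - \<zeta>)\<^sup>-\<^sup>1 d\<zeta>\<close> over the circle of radius \<open>\<epsilon>\<close> around \<open>z\<close>, the
  integral being taken weakly.\<close>

definition riesz_projection ::
  "L2_operator \<Rightarrow> complex \<Rightarrow> real \<Rightarrow> field2 \<Rightarrow> field2 \<Rightarrow> bool" where
  "riesz_projection T z \<epsilon> f p \<longleftrightarrow> p \<in> L2 \<and>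
     (\<forall>g\<in>L2. L2_inner p g =
        - (1 / (2 * of_real pi * \<i>)) *
          contour_integral (circlepath z \<epsilon>) (\<lambda>\<zeta>. L2_inner (resolvent T \<zeta> f) g))"

text \<open>The algebraic multiplicity of an isolated point of the spectrum is the rank of its Riesz
  projection (which does not depend on the radius). It is finite iff finitely many \<open>b k\<close> span
  the range. For operators that are not self-adjoint this is stronger than finiteness of the
  dimension of the (generalized) eigenspace.\<close>

definition finite_algebraic_multiplicity :: "L2_operator \<Rightarrow> complex \<Rightarrow> bool" where
  "finite_algebraic_multiplicity T z \<longleftrightarrow>
     (\<exists>\<epsilon>>0. cball z \<epsilon> \<inter> spectrum T = {z} \<and>
       (\<exists>(n::nat) b. (\<forall>k<n. b k \<in> L2) \<and>
         (\<forall>f\<in>L2. \<exists>c. riesz_projection T z \<epsilon> f (\<lambda>x. \<Sum>k<n. c k *s b k x))))"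

definition discrete_spectrum :: "L2_operator \<Rightarrow> complex set" where
  "discrete_spectrum T =
     {z. z isolated_in spectrum T \<and> eigenvalue T z \<and> finite_algebraic_multiplicity T z}"

definition essential_spectrum :: "L2_operator \<Rightarrow> complex set" where
  "essential_spectrum T = spectrum T - discrete_spectrum T"


section \<open>Weak derivatives\<close>

definition partial :: "2 \<Rightarrow> (real^2 \<Rightarrow> 'b::real_normed_vector) \<Rightarrow> real^2 \<Rightarrow> 'b" where
  "partial i f x = frechet_derivative f (at x) (axis i 1)"

fun Ck :: "nat \<Rightarrow> (real^2 \<Rightarrow> real) \<Rightarrow> bool" where
  "Ck 0 f \<longleftrightarrow> continuous_on UNIV f"
| "Ck (Suc k) f \<longleftrightarrow> (\<forall>x. f differentiable (at x)) \<and> (\<forall>i. Ck k (partial i f))"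

definition test_function :: "(real^2 \<Rightarrow> real) \<Rightarrow> bool" where
  "test_function \<phi> \<longleftrightarrow> (\<forall>k. Ck k \<phi>) \<and> compact (closure {x. \<phi> x \<noteq> 0})"

definition has_weak_partial :: "2 \<Rightarrow> field2 \<Rightarrow> field2 \<Rightarrow> bool" where
  "has_weak_partial i f g \<longleftrightarrow> g \<in> L2 \<and>
     (\<forall>\<phi>. test_function \<phi> \<longrightarrow>
        (\<integral>x. partial i \<phi> x *\<^sub>R f x \<partial>lborel) = - (\<integral>x. \<phi> x *\<^sub>R g x \<partial>lborel))"

definition H1 :: "field2 set" where
  "H1 = {f \<in> L2. \<forall>i. \<exists>g. has_weak_partial i f g}"

definition weak_partial :: "2 \<Rightarrow> field2 \<Rightarrow> field2" where
  "weak_partial i f = (SOME g. has_weak_partial i f g)"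


section \<open>The harmonic oscillator\<close>

definition form_domain :: "field2 set" where
  "form_domain = {f \<in> H1. (\<lambda>x. norm x *\<^sub>R f x) \<in> L2}"

text \<open>The sesquilinear form obtained from \<open>q(\<Psi>, \<Psi>)\<close> by polarization.\<close>

definition q_form :: "field2 \<Rightarrow> field2 \<Rightarrow> complex" where
  "q_form u v =
     (\<integral>x. (1/2) * (\<Sum>i\<in>UNIV. herm (weak_partial i u x) (weak_partial i v x))
          + of_real ((norm x)\<^sup>2 / 2) * herm (u x) (v x) \<partial>lborel)"

text \<open>The self-adjoint operator associated with a closed nonnegative form (first
  representation theorem): \<open>L\<^sub>c u = f\<close> iff \<open>u\<close> lies in the form domain and
  \<open>q(u, v) = \<langle>f, v\<rangle>\<close> for all \<open>v\<close> in the form domain.\<close>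

definition L_c :: L2_operator where
  "L_c = {(u, f). u \<in> form_domain \<and> f \<in> L2 \<and> (\<forall>v\<in>form_domain. q_form u v = L2_inner f v)}"


section \<open>Vortices and the linearized operator\<close>

definition polar_angle :: "real^2 \<Rightarrow> real" where
  "polar_angle x = Arg (Complex (x $ 1) (x $ 2))"

definition vortex :: "nat \<Rightarrow> (real \<Rightarrow> real) \<Rightarrow> real^2 \<Rightarrow> complex" where
  "vortex m w x = exp (\<i> * of_real (real m * polar_angle x)) * of_real (w (norm x))"

text \<open>In the energy the gradient is the classical one, which exists away from the origin,
  hence almost everywhere.\<close>

definition vortex_profile :: "nat \<Rightarrow> real \<Rightarrow> (real \<Rightarrow> real) \<Rightarrow> bool" where
  "vortex_profile m \<mu> w \<longleftrightarrow>
     (\<forall>r>0. w r > 0) \<and>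
     (\<forall>r>0. w field_differentiable (at r) \<and> deriv w field_differentiable (at r)) \<and>
     (\<forall>r>0. - deriv (deriv w) r - (1 / r) * deriv w r + ((real m)\<^sup>2 / r\<^sup>2) * w r + r\<^sup>2 * w r
             + 2 * \<bar>w r\<bar>\<^sup>2 * w r - 2 * \<mu> * w r = 0) \<and>
     Bfun w (at_right 0) \<and>
     (w \<longlongrightarrow> 0) at_top \<and>
     (\<integral>\<^sup>+x. ennreal ((1/2) * (\<Sum>i\<in>UNIV. (norm (partial i (vortex m w) x))\<^sup>2)
               + ((1/2) * (norm x)\<^sup>2 + (norm (vortex m w x))\<^sup>2) * (norm (vortex m w x))\<^sup>2)
        \<partial>lborel) < \<infinity>"

definition J :: "complex^2^2" where
  "J = vector [vector [0, -1], vector [1, 0]]"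

definition R :: "complex^2^2" where
  "R = vector [vector [1, 0], vector [0, -1]]"

definition matrix_exp :: "complex^2^2 \<Rightarrow> complex^2^2" where
  "matrix_exp M = (\<Sum>k. (1 / fact k) *\<^sub>R (((**) M ^^ k) (mat 1)))"

definition w_matrix :: "nat \<Rightarrow> real \<Rightarrow> (real \<Rightarrow> real) \<Rightarrow> real^2 \<Rightarrow> complex^2^2" where
  "w_matrix m \<mu> w x =
     (2 * \<bar>w (norm x)\<bar>\<^sup>2) *\<^sub>R mat 1
     + \<bar>w (norm x)\<bar>\<^sup>2 *\<^sub>R (matrix_exp ((2 * real m * polar_angle x) *\<^sub>R J) ** R)
     - \<mu> *\<^sub>R mat 1"

definition L_w :: "nat \<Rightarrow> real \<Rightarrow> (real \<Rightarrow> real) \<Rightarrow> field2 \<Rightarrow> field2" where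
  "L_w m \<mu> w u = (\<lambda>x. w_matrix m \<mu> w x *v u x)"

definition linearized_operator :: "nat \<Rightarrow> real \<Rightarrow> (real \<Rightarrow> real) \<Rightarrow> L2_operator" where
  "linearized_operator m \<mu> w =
     {(u, g). g \<in> L2 \<and> (\<exists>f. (u, f) \<in> L_c \<and> L2_eq g (\<lambda>x. - (J *v (f x + L_w m \<mu> w u x))))}"


lemma J_sq: "J ** J = - mat 1"
  by (simp add: J_def matrix_matrix_mult_def vec_eq_iff forall_2 sum_2 mat_def)

lemma matrix_exp_J: "matrix_exp (t *\<^sub>R J) = cos t *\<^sub>R mat 1 + sin t *\<^sub>R J"
proof -
  define h :: "complex \<Rightarrow> complex^2^2" where "h z = Re z *\<^sub>R mat 1 + Im z *\<^sub>R J" for z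
  have bl: "bounded_linear h"
    unfolding h_def
    by (intro bounded_linear_add bounded_linear_compose[OF bounded_linear_scaleR_left]
        bounded_linear_Re bounded_linear_Im)
  have mult: "(t *\<^sub>R J) ** h z = h (\<i> * of_real t * z)" for z
    by (simp add: h_def J_def matrix_matrix_mult_def vec_eq_iff forall_2 sum_2 mat_def
        complex_eq_iff algebra_simps)
  have pow: "((**) (t *\<^sub>R J) ^^ k) (mat 1) = h ((\<i> * of_real t) ^ k)" for k
  proof (induction k)
    case 0
    show ?case by (simp add: h_def)
  next
    case (Suc k)
    then show ?case by (simp add: mult)
  qed
  have "matrix_exp (t *\<^sub>R J) = (\<Sum>k. h ((\<i> * of_real t) ^ k /\<^sub>R fact k))"
    unfolding matrix_exp_def pow
    by (simp add: linear_scale[OF bounded_linear.linear[OF bl]] divide_inverse)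
  also have "\<dots> = h (exp (\<i> * of_real t))"
    unfolding exp_def by (rule bounded_linear.suminf[OF bl summable_exp_generic, symmetric])
  also have "\<dots> = cos t *\<^sub>R mat 1 + sin t *\<^sub>R J"
    by (simp add: h_def cis_conv_exp[symmetric])
  finally show ?thesis .
qed

end

(* Write osc_inverse for the inverse of 2 L_c + 1; it is a compact operator on L^2. Since J^2 = -1,
   the equation (A - z) u = f is equivalent to u = K(z) u + g with g = osc_inverse (2 J f) and
   K(z) = osc_inverse (1 - 2 L_w + 2 z J), an affine family of compact operators. Splitting off a
   finite-rank part F K(z) so that (1 - F) K(z) is a contraction for |z| < rho turns the equation
   into a finite linear system with a matrix holomorphic in z. Its determinant vanishes exactly at
   the eigenvalues, and not everywhere because - J L_c is skew-adjoint and L_w is bounded; hence the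
   spectrum is discrete, and Cramer's rule shows that the resolvent has finite-rank principal parts.

   The inverse comes from orthogonal projection in (L^2)^4 onto the closed subspace of jets
   (u, d_1 u, d_2 u, |x| u). It is approximated in norm by finite-rank operators because averaging
   u over the cells of a fine grid in a large square changes u little: translations satisfy
   |u(. + h) - u| <= |h_1| |d_1 u| + |h_2| |d_2 u|, and outside the square |u| <= |x| |u| / radius. *)

theory Submission
  imports Defs "Jordan_Normal_Form.Determinant"
begin

section \<open>Complex Hilbert spaces\<close>

text \<open>As A is not self-adjoint, finite multiplicity means finite rank of the Riesz projection,
  and a finite-dimensional kernel of A - z would not suffice: the whole principal part of the
  resolvent must have finite rank. Hence the reduction to a linear system keeps the holomorphic
  dependence on z, on a disc that contains both the point under study and a point known to be
  regular. The factor and shift in 2 L_c + 1 are chosen so that its form is |u|^2 + |d_1 u|^2 + |d_2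
  u|^2 + |x|^2 |u|^2, the squared norm of a jet. The one norm that defines the inverse therefore
  also controls the translation estimate and the decay at infinity. Operators are given as relations
  between representatives, whereas the argument lives on the quotient \<open>lsq\<close>. That is a
  real inner product space with an isometry \<open>imul\<close>, multiplication by i, from which
  complex scalars and the hermitian product are recovered.\<close>

class complex_hilbert = real_inner + banach +
  fixes imul :: "'a \<Rightarrow> 'a"
  assumes imul_add: "imul (x + y) = imul x + imul y"
    and imul_scaleR: "imul (r *\<^sub>R x) = r *\<^sub>R imul x"
    and imul_imul [simp]: "imul (imul x) = - x"
    and inner_imul_imul [simp]: "inner (imul x) (imul y) = inner x y"

lemma linear_imul: "linear imul"
  by (rule linearI) (simp_all add: imul_add imul_scaleR)

lemma norm_imul [simp]: "norm (imul x) = norm x"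
  by (simp add: norm_eq_sqrt_inner)

lemma imul_zero [simp]: "imul 0 = 0"
  using imul_scaleR[of 0 0] by simp

lemma imul_minus: "imul (- x) = - imul x"
  using linear_neg[OF linear_imul] .

lemma inner_imul_left: "inner (imul x) y = - inner x (imul y)"
  using inner_imul_imul[of x "imul y"] by (simp add: inner_minus_right)

lemma inner_imul_self [simp]: "inner x (imul x) = 0" "inner (imul x) x = 0"
  using inner_imul_left[of x x] by (simp_all add: inner_commute)

definition scaleC :: "complex \<Rightarrow> 'a::complex_hilbert \<Rightarrow> 'a" (infixr \<open>*\<^sub>C\<close> 75) where
  "z *\<^sub>C x = Re z *\<^sub>R x + Im z *\<^sub>R imul x"

text \<open>Linear in the first argument: the imaginary part of (x, y) is the real part of -i (x, y)
  = (x, i y).\<close>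

definition cinner :: "'a::complex_hilbert \<Rightarrow> 'a \<Rightarrow> complex" where
  "cinner x y = Complex (inner x y) (inner x (imul y))"

lemma scaleC_add_right: "z *\<^sub>C (x + y) = z *\<^sub>C x + z *\<^sub>C y"
  by (simp add: scaleC_def imul_add scaleR_add_right)

lemma scaleC_add_left: "(z + z') *\<^sub>C x = z *\<^sub>C x + z' *\<^sub>C x"
  by (simp add: scaleC_def scaleR_add_left)

lemma scaleC_diff_left: "(z - z') *\<^sub>C x = z *\<^sub>C x - z' *\<^sub>C x"
  by (simp add: scaleC_def scaleR_diff_left)

lemma scaleC_diff_right: "z *\<^sub>C (x - y) = z *\<^sub>C x - z *\<^sub>C y"
  by (simp add: scaleC_def scaleR_diff_right linear_diff[OF linear_imul])

lemma scaleC_scaleC [simp]: "z *\<^sub>C z' *\<^sub>C x = (z * z') *\<^sub>C x"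
  by (simp add: scaleC_def imul_add imul_scaleR scaleR_add_right scaleR_diff_left scaleR_add_left
      scaleR_diff_right)

lemma scaleC_0_left [simp]: "0 *\<^sub>C x = 0" and scaleC_0_right [simp]: "z *\<^sub>C 0 = 0"
  and scaleC_1 [simp]: "1 *\<^sub>C x = x"
  by (simp_all add: scaleC_def)

lemma scaleC_of_real: "of_real r *\<^sub>C x = r *\<^sub>R x"
  by (simp add: scaleC_def)

lemma imul_eq_scaleC: "imul x = \<i> *\<^sub>C x"
  by (simp add: scaleC_def)

lemma scaleC_sum_right: "z *\<^sub>C (\<Sum>k\<in>A. f k) = (\<Sum>k\<in>A. z *\<^sub>C f k)"
  by (induction A rule: infinite_finite_induct) (simp_all add: scaleC_add_right)

lemma norm_scaleC [simp]: "norm (z *\<^sub>C x) = cmod z * norm x"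
proof -
  have "(norm (z *\<^sub>C x))\<^sup>2 = (cmod z * norm x)\<^sup>2"
    unfolding power_mult_distrib cmod_power2 power2_norm_eq_inner[where 'a = 'a] scaleC_def
    by (simp add: inner_add_left inner_add_right distrib_right power2_eq_square)
  then show ?thesis
    by (simp add: power2_eq_iff_nonneg)
qed

lemma bounded_linear_scaleC: "bounded_linear (\<lambda>x. z *\<^sub>C x)"
  by (rule bounded_linear_intro[where K = "cmod z"])
    (simp_all add: scaleC_add_right mult.commute, simp add: scaleC_def imul_scaleR scaleR_add_right mult.commute)

lemma bounded_linear_scaleC_left: "bounded_linear (\<lambda>z. z *\<^sub>C x)"
  by (rule bounded_linear_intro[where K = "norm x"])
    (simp_all add: scaleC_add_left, simp add: scaleC_def scaleR_add_right)

lemma cinner_add_left: "cinner (x + y) z = cinner x z + cinner y z"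
  by (simp add: cinner_def inner_add_left complex_eq_iff)

lemma cinner_scaleC_left [simp]: "cinner (c *\<^sub>C x) y = c * cinner x y"
  by (simp add: cinner_def scaleC_def inner_add_left inner_imul_left complex_eq_iff imul_minus inner_minus_right)

lemma cinner_zero_left [simp]: "cinner 0 y = 0"
  by (simp add: cinner_def complex_eq_iff)

lemma cinner_sum_left: "cinner (\<Sum>k\<in>A. f k) y = (\<Sum>k\<in>A. cinner (f k) y)"
  by (induction A rule: infinite_finite_induct) (simp_all add: cinner_add_left)

lemma Re_cinner [simp]: "Re (cinner x y) = inner x y"
  by (simp add: cinner_def)

text \<open>Real and imaginary part are bounded separately by the real Cauchy-Schwarz inequality,
  hence the factor 2; the estimate serves to prove continuity.\<close>

lemma cmod_cinner_le: "cmod (cinner x y) \<le> 2 * norm x * norm y"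
proof -
  have "cmod (cinner x y) \<le> \<bar>inner x y\<bar> + \<bar>inner x (imul y)\<bar>"
    using cmod_le[of "cinner x y"] by (simp add: cinner_def)
  also have "\<dots> \<le> norm x * norm y + norm x * norm (imul y)"
    by (intro add_mono Cauchy_Schwarz_ineq2)
  finally show ?thesis by simp
qed

section \<open>Bounded complex-linear maps\<close>

definition bounded_clinear :: "('a::complex_hilbert \<Rightarrow> 'b::complex_hilbert) \<Rightarrow> bool" where
  "bounded_clinear f \<longleftrightarrow> bounded_linear f \<and> (\<forall>x. f (imul x) = imul (f x))"

lemma bounded_clinearD:
  assumes "bounded_clinear f"
  shows "f (x + y) = f x + f y" "f (x - y) = f x - f y" "f 0 = 0" "f (c *\<^sub>C x) = c *\<^sub>C f x"
    "f (\<Sum>k\<in>A. g k) = (\<Sum>k\<in>A. f (g k))" "bounded_linear f" "f (imul x) = imul (f x)"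
proof -
  have l: "linear f" and b: "bounded_linear f" and i: "\<And>x. f (imul x) = imul (f x)"
    using assms by (auto simp: bounded_clinear_def bounded_linear.linear)
  show "f (x + y) = f x + f y" "f (x - y) = f x - f y" "f 0 = 0"
    "f (\<Sum>k\<in>A. g k) = (\<Sum>k\<in>A. f (g k))"
    using l by (simp_all add: linear_add linear_diff linear_0 linear_sum)
  show "f (c *\<^sub>C x) = c *\<^sub>C f x"
    unfolding scaleC_def by (simp add: linear_add[OF l] linear_scale[OF l] i)
  show "bounded_linear f" by (rule b)
  show "f (imul x) = imul (f x)" by (rule i)
qed

lemma bounded_clinear_scaleC: "bounded_clinear (\<lambda>x. c *\<^sub>C x)"
  by (simp add: bounded_clinear_def bounded_linear_scaleC imul_eq_scaleC mult.commute)

lemma bounded_clinear_compose: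
  assumes "bounded_clinear f" "bounded_clinear g"
  shows "bounded_clinear (\<lambda>x. f (g x))"
  using assms by (auto simp: bounded_clinear_def intro: bounded_linear_compose)

lemma bounded_clinear_add:
  assumes "bounded_clinear f" "bounded_clinear g"
  shows "bounded_clinear (\<lambda>x. f x + g x)"
  using assms by (auto simp: bounded_clinear_def imul_add intro: bounded_linear_add)

lemma bounded_clinear_diff:
  assumes "bounded_clinear f" "bounded_clinear g"
  shows "bounded_clinear (\<lambda>x. f x - g x)"
  using assms by (auto simp: bounded_clinear_def linear_diff[OF linear_imul] intro: bounded_linear_sub)

lemma bounded_clinear_ident: "bounded_clinear (\<lambda>x. x)"
  by (simp add: bounded_clinear_def)

lemma bounded_linear_cinner_left: "bounded_linear (\<lambda>v. cinner v h)"
proof -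
  have "cinner (r *\<^sub>R x) h = r *\<^sub>R cinner x h" for r and x
    by (simp add: scaleR_conv_of_real flip: scaleC_of_real)
  then show ?thesis
    by (intro bounded_linear_intro[where K = "2 * norm h"])
      (auto simp: cinner_add_left mult_ac intro: order_trans[OF cmod_cinner_le])
qed

lemma bounded_clinear_finite_rank: "bounded_clinear (\<lambda>v. \<Sum>k<(n::nat). cinner v (a k) *\<^sub>C b k)"
proof -
  have "bounded_linear (\<lambda>v. \<Sum>k<n. cinner v (a k) *\<^sub>C b k)"
    by (intro bounded_linear_sum bounded_linear_compose[OF bounded_linear_scaleC_left] bounded_linear_cinner_left)
  then show ?thesis
    by (simp add: bounded_clinear_def imul_eq_scaleC scaleC_sum_right)
qed

text \<open>A minimising sequence for the distance to x is Cauchy by the parallelogram law, and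
  minimality of its limit gives orthogonality. The setting is real, so that the result applies to
  \<open>jet\<close> as well as to \<open>lsq\<close>.\<close>

lemma closed_subspace_projection:
  fixes W :: "'a::{real_inner, banach} set"
  assumes "closed W" "subspace W"
  shows "\<exists>p\<in>W. \<forall>v\<in>W. inner (x - p) v = 0"
proof -
  define S where "S = (\<lambda>w. (norm (x - w))\<^sup>2) ` W"
  define d where "d = Inf S"
  have "0 \<in> W" using assms(2) by (rule subspace_0)
  then have ne: "S \<noteq> {}" by (auto simp: S_def)
  have bb: "bdd_below S" by (auto simp: S_def intro!: bdd_belowI[of _ 0])
  have dle: "d \<le> (norm (x - w))\<^sup>2" if "w \<in> W" for w
    unfolding d_def by (rule cInf_lower[OF _ bb]) (use that in \<open>auto simp: S_def\<close>)
  have "\<exists>w\<in>W. (norm (x - w))\<^sup>2 < d + inverse (real (Suc n))" for n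
    using cInf_lessD[OF ne, of "d + inverse (real (Suc n))"] unfolding d_def
    by (auto simp: S_def)
  then obtain w where w: "\<And>n. w n \<in> W" "\<And>n. (norm (x - w n))\<^sup>2 < d + inverse (real (Suc n))"
    by metis
  \<comment> \<open>Parallelogram law for x - w n and x - w m: the midpoint of w n and w m lies in
    W, so its squared distance to x is at least d.\<close>
  have para: "(norm (w n - w m))\<^sup>2 \<le> 2 * inverse (real (Suc n)) + 2 * inverse (real (Suc m))" for n m
  proof -
    have "(1/2) *\<^sub>R (w n + w m) \<in> W"
      using assms(2) w(1) by (intro subspace_scale subspace_add)
    then have "d \<le> (norm (x - (1/2) *\<^sub>R (w n + w m)))\<^sup>2" by (rule dle)
    moreover have "(norm (w n - w m))\<^sup>2 = 2 * (norm (x - w n))\<^sup>2 + 2 * (norm (x - w m))\<^sup>2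
        - 4 * (norm (x - (1/2) *\<^sub>R (w n + w m)))\<^sup>2"
      by (simp add: power2_norm_eq_inner inner_diff_left inner_diff_right inner_add_left
          inner_add_right inner_commute algebra_simps)
    ultimately show ?thesis using w(2)[of n] w(2)[of m] by linarith
  qed
  have "Cauchy w"
  proof (rule metric_CauchyI)
    fix e :: real assume "e > 0"
    then obtain N where N: "inverse (real (Suc N)) < e\<^sup>2 / 4"
      using reals_Archimedean[of "e\<^sup>2/4"] by auto
    have "dist (w m) (w n) < e" if "m \<ge> N" "n \<ge> N" for m n
    proof -
      have "inverse (real (Suc m)) \<le> inverse (real (Suc N))" "inverse (real (Suc n)) \<le> inverse (real (Suc N))"
        using that by (auto intro!: le_imp_inverse_le)
      with para[of m n] N have "(norm (w m - w n))\<^sup>2 < e\<^sup>2" by linarith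
      then show ?thesis using \<open>e > 0\<close> by (auto simp: dist_norm intro: power2_less_imp_less)
    qed
    then show "\<exists>M. \<forall>m\<ge>M. \<forall>n\<ge>M. dist (w m) (w n) < e" by blast
  qed
  then obtain p where p: "w \<longlonglongrightarrow> p" using Cauchy_convergent_iff convergent_def by blast
  have pW: "p \<in> W" using closed_sequentially[OF assms(1) _ p] w(1) by blast
  have "(\<lambda>n. d + inverse (real (Suc n))) \<longlonglongrightarrow> d + 0"
    by (intro tendsto_intros LIMSEQ_inverse_real_of_nat)
  then have "(norm (x - p))\<^sup>2 \<le> d"
    using LIMSEQ_le[of "\<lambda>n. (norm (x - w n))\<^sup>2" "(norm (x - p))\<^sup>2" "\<lambda>n. d + inverse (real (Suc n))" "d + 0"]
      w(2) p by (simp add: less_imp_le tendsto_intros)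
  have "inner (x - p) v = 0" if v: "v \<in> W" for v
  proof (cases "v = 0")
    case False
    \<comment> \<open>The parameter that minimises the distance from x to p + t v along the
      line.\<close>
    define t where "t = inner (x - p) v / inner v v"
    have "p + t *\<^sub>R v \<in> W" using assms(2) pW v by (intro subspace_add subspace_scale)
    then have "(norm (x - p))\<^sup>2 \<le> (norm (x - (p + t *\<^sub>R v)))\<^sup>2"
      using dle[of "p + t *\<^sub>R v"] \<open>(norm (x - p))\<^sup>2 \<le> d\<close> by linarith
    also have "\<dots> = (norm (x - p))\<^sup>2 - 2 * t * inner (x - p) v + t * t * inner v v"
      by (simp add: power2_norm_eq_inner inner_diff_left inner_diff_right inner_add_left
          inner_add_right inner_commute algebra_simps)
    also have "\<dots> = (norm (x - p))\<^sup>2 - (inner (x - p) v)\<^sup>2 / inner v v"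
      using False by (simp add: t_def power2_eq_square)
    finally have "(inner (x - p) v)\<^sup>2 / inner v v \<le> 0" by simp
    moreover have "inner v v > 0" using False by simp
    ultimately have "(inner (x - p) v)\<^sup>2 \<le> 0" by (simp add: divide_le_0_iff)
    then show ?thesis by simp
  qed simp
  with pW show ?thesis by blast
qed

lemma contraction_unique_solution:
  fixes Q :: "'a::banach \<Rightarrow> 'a"
  assumes "linear Q" "\<And>u. norm (Q u) \<le> norm u / 2"
  shows "\<exists>!u. u = Q u + g"
proof -
  have "\<exists>!x. x \<in> UNIV \<and> Q x + g = x"
  proof (rule Banach_fix[where c = "1/2"])
    show "dist (Q x + g) (Q y + g) \<le> 1 / 2 * dist x y" for x y
      using assms(2) by (simp add: dist_norm flip: linear_diff[OF assms(1)])
  qed (auto simp: complete_UNIV)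
  then show ?thesis by (metis UNIV_I)
qed

section \<open>Adjugates\<close>

text \<open>The size \<open>n\<close> of the reduced system depends on the radius \<open>\<rho>\<close>, hence matrices are functions
  \<open>nat \<Rightarrow> nat \<Rightarrow> complex\<close> of which only the entries below \<open>n\<close> matter.\<close>

definition mdet :: "nat \<Rightarrow> (nat \<Rightarrow> nat \<Rightarrow> complex) \<Rightarrow> complex" where
  "mdet n A = det (mat n n (\<lambda>(i, j). A i j))"

definition madj :: "nat \<Rightarrow> (nat \<Rightarrow> nat \<Rightarrow> complex) \<Rightarrow> nat \<Rightarrow> nat \<Rightarrow> complex" where
  "madj n A i j = adj_mat (mat n n (\<lambda>(i, j). A i j)) $$ (i, j)"

lemma adj_mat_mult_aux:
  fixes A B :: "complex mat"
  assumes "A \<in> carrier_mat n n" "B \<in> carrier_mat n n" "A * B = c \<cdot>\<^sub>m 1\<^sub>m n" "i < n" "k < n"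
  shows "(\<Sum>j<n. A $$ (i, j) * B $$ (j, k)) = (if i = k then c else 0)"
proof -
  have "(A * B) $$ (i, k) = (\<Sum>j<n. A $$ (i, j) * B $$ (j, k))"
    using assms(1,2,4,5) by (simp add: scalar_prod_def atLeast0LessThan)
  moreover have "(A * B) $$ (i, k) = (if i = k then c else 0)"
    using assms(4,5) unfolding assms(3) by (cases "i = k") simp_all
  ultimately show ?thesis by simp
qed

lemma madj_mult:
  assumes "i < n" "k < n"
  shows "(\<Sum>j<n. madj n A i j * A j k) = (if i = k then mdet n A else 0)"
    and "(\<Sum>j<n. A i j * madj n A j k) = (if i = k then mdet n A else 0)"
proof -
  let ?A = "mat n n (\<lambda>(i, j). A i j)"
  have c: "?A \<in> carrier_mat n n" by simp
  note adj = adj_mat[OF c]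
  show "(\<Sum>j<n. madj n A i j * A j k) = (if i = k then mdet n A else 0)"
    using adj_mat_mult_aux[OF adj(1) c adj(3) assms] assms by (simp add: madj_def mdet_def)
  show "(\<Sum>j<n. A i j * madj n A j k) = (if i = k then mdet n A else 0)"
    using adj_mat_mult_aux[OF c adj(1) adj(2) assms] assms by (simp add: madj_def mdet_def)
qed

lemma mdet_eq_0_kernel:
  assumes "mdet n A = 0"
  obtains x k where "k < n" "x k \<noteq> (0::complex)" "\<And>j. j < n \<Longrightarrow> (\<Sum>k<n. A j k * x k) = 0"
proof -
  let ?A = "mat n n (\<lambda>(i, j). A i j)"
  have c: "?A \<in> carrier_mat n n" by simp
  obtain v where v: "v \<in> carrier_vec n" "v \<noteq> 0\<^sub>v n" "?A *\<^sub>v v = 0\<^sub>v n"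
    using det_0_iff_vec_prod_zero_field[OF c] assms by (auto simp: mdet_def)
  have "\<exists>k<n. vec_index v k \<noteq> 0"
    using v(1,2) by (metis carrier_vecD eq_vecI index_zero_vec(1) index_zero_vec(2))
  then obtain k where "k < n" "vec_index v k \<noteq> 0" by blast
  moreover have "(\<Sum>k<n. A j k * vec_index v k) = 0" if "j < n" for j
  proof -
    have "vec_index (?A *\<^sub>v v) j = (\<Sum>k<n. A j k * vec_index v k)"
      using that v(1) by (simp add: scalar_prod_def atLeast0LessThan)
    then show ?thesis using v(3) that by simp
  qed
  ultimately show ?thesis by (rule that)
qed

text \<open>By the Leibniz formula the determinant is a polynomial in its entries.\<close>

lemma det_holomorphic:
  fixes f :: "nat \<Rightarrow> nat \<Rightarrow> complex \<Rightarrow> complex"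
  assumes "\<And>i j. i < n \<Longrightarrow> j < n \<Longrightarrow> (f i j) holomorphic_on S"
  shows "(\<lambda>z. det (mat n n (\<lambda>(i, j). f i j z))) holomorphic_on S"
proof -
  have "(\<lambda>z. \<Sum>p\<in>{p. p permutes {0..<n}}. signof p * (\<Prod>i = 0..<n. f i (p i) z)) holomorphic_on S"
    by (intro holomorphic_intros assms) (auto dest: permutes_in_image)
  moreover have "det (mat n n (\<lambda>(i, j). f i j z))
      = (\<Sum>p\<in>{p. p permutes {0..<n}}. signof p * (\<Prod>i = 0..<n. f i (p i) z))" for z
    unfolding det_def by (auto intro!: sum.cong prod.cong dest: permutes_in_image)
  ultimately show ?thesis by simp
qed

lemma mdet_holomorphic:
  assumes "\<And>i j. i < n \<Longrightarrow> j < n \<Longrightarrow> (f i j) holomorphic_on S"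
  shows "(\<lambda>z. mdet n (\<lambda>i j. f i j z)) holomorphic_on S"
  unfolding mdet_def by (rule det_holomorphic[OF assms])

lemma madj_holomorphic:
  assumes "\<And>i j. i < n \<Longrightarrow> j < n \<Longrightarrow> (f i j) holomorphic_on S" "i < n" "j < n"
  shows "(\<lambda>z. madj n (\<lambda>i j. f i j z) i j) holomorphic_on S"
proof -
  \<comment> \<open>The adjugate is transposed: its entry (i, j) is the cofactor (j, i). Row j and
    column i are deleted, and the index shifts skip over them.\<close>
  have "(\<lambda>z. (-1) ^ (j + i) * det (mat (n - 1) (n - 1)
      (\<lambda>(i', j'). f (if i' < j then i' else Suc i') (if j' < i then j' else Suc j') z))) holomorphic_on S"
    using assms(2,3) by (intro holomorphic_intros det_holomorphic assms(1)) auto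
  moreover have "madj n (\<lambda>i j. f i j z) i j = (-1) ^ (j + i) * det (mat (n - 1) (n - 1)
      (\<lambda>(i', j'). f (if i' < j then i' else Suc i') (if j' < i then j' else Suc j') z))" for z
    using assms(2,3)
    by (auto simp: madj_def adj_mat_def cofactor_def mat_delete_def intro!: arg_cong[where f = det] eq_matI)
  ultimately show ?thesis by simp
qed

section \<open>Analytic Fredholm theory for affine pencils\<close>

text \<open>The finite-rank map acts on the output of T. An approximation of T is therefore at once
  one of u |-> T (B u + z G u), uniformly for bounded z.\<close>

locale approximable_pencil =
  fixes T B G :: "'a::complex_hilbert \<Rightarrow> 'a"
  assumes T: "bounded_clinear T" and B: "bounded_clinear B" and G: "bounded_clinear G"
    and approx: "\<And>\<epsilon>. \<epsilon> > 0 \<Longrightarrow>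
      \<exists>(n::nat) a b. \<forall>u. norm (T u - (\<Sum>k<n. cinner (T u) (a k) *\<^sub>C b k)) \<le> \<epsilon> * norm u"
begin

definition K :: "complex \<Rightarrow> 'a \<Rightarrow> 'a" where
  "K z u = T (B u + z *\<^sub>C G u)"

text \<open>The points where 1 - \<open>K z\<close> has a kernel; for the linearized operator this
  set turns out to be the spectrum.\<close>

definition singular :: "complex set" where
  "singular = {z. \<exists>u. u \<noteq> 0 \<and> u = K z u}"

lemma K_bounded_clinear: "bounded_clinear (K z)"
  unfolding K_def
  by (intro bounded_clinear_compose[OF T] bounded_clinear_add B
      bounded_clinear_compose[OF bounded_clinear_scaleC] G)

lemma solution_unique:
  assumes "z \<notin> singular" "u = K z u + g" "v = K z v + g" shows "u = v"
proof (rule ccontr)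
  assume "u \<noteq> v"
  moreover have "u - v = K z (u - v)"
    using assms(2,3) by (metis add_diff_cancel_right bounded_clinearD(2)[OF K_bounded_clinear])
  ultimately have "z \<in> singular" unfolding singular_def by force
  with assms(1) show False by simp
qed

end

section \<open>Reduction to a contraction and a finite linear system\<close>

locale reduced_pencil = approximable_pencil +
  fixes \<rho> :: real and n :: nat and a b :: "nat \<Rightarrow> 'a"
  assumes half: "\<And>z u. cmod z < \<rho> \<Longrightarrow>
    norm (K z u - (\<Sum>k<n. cinner (K z u) (a k) *\<^sub>C b k)) \<le> norm u / 2"
begin

definition F :: "'a \<Rightarrow> 'a" where
  "F v = (\<Sum>k<n. cinner v (a k) *\<^sub>C b k)"

definition Q :: "complex \<Rightarrow> 'a \<Rightarrow> 'a" where
  "Q z u = K z u - F (K z u)"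

text \<open>The derivative of \<open>Q z\<close> with respect to z, which is constant because the
  pencil is affine; this makes \<open>Q_diff\<close> an exact identity.\<close>

definition Q' :: "'a \<Rightarrow> 'a" where
  "Q' u = T (G u) - F (T (G u))"

text \<open>The inverse of 1 - \<open>Q z\<close>. The description is known to be proper only for
  \<open>cmod z < \<rho>\<close>, where \<open>Q z\<close> is a contraction.\<close>

definition E :: "complex \<Rightarrow> 'a \<Rightarrow> 'a" where
  "E z g = (THE u. u = Q z u + g)"

lemma F_bounded_clinear: "bounded_clinear F"
  unfolding F_def by (rule bounded_clinear_finite_rank)

lemma Q_bounded_clinear: "bounded_clinear (Q z)"
  unfolding Q_def by (intro bounded_clinear_diff bounded_clinear_compose[OF F_bounded_clinear] K_bounded_clinear)

lemma Q'_bounded_clinear: "bounded_clinear Q'"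
  unfolding Q'_def
  by (intro bounded_clinear_diff bounded_clinear_compose[OF F_bounded_clinear]
      bounded_clinear_compose[OF T] G)

lemma Q_diff: "Q z u - Q z' u = (z - z') *\<^sub>C Q' u"
proof -
  note [simp] = bounded_clinearD(1,2,4)[OF T] bounded_clinearD(1,2,4)[OF F_bounded_clinear]
  show ?thesis
    by (simp add: Q_def Q'_def K_def scaleC_diff_left scaleC_diff_right)
qed

context
  fixes z assumes z: "cmod z < \<rho>"
begin

lemma norm_Q: "norm (Q z u) \<le> norm u / 2"
  unfolding Q_def F_def by (rule half[OF z])

lemma E_ex1: "\<exists>!u. u = Q z u + g"
  using bounded_clinearD(6)[OF Q_bounded_clinear] norm_Q
  by (intro contraction_unique_solution) (auto simp: bounded_linear.linear)

lemma E_eq: "E z g = Q z (E z g) + g"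
  unfolding E_def by (rule theI'[OF E_ex1])

lemma E_unique: "u = Q z u + g \<Longrightarrow> u = E z g"
  using E_ex1[of g] E_eq[of g] by blast

lemma norm_E: "norm (E z g) \<le> 2 * norm g"
proof -
  have "norm (E z g) \<le> norm (Q z (E z g)) + norm g"
    by (metis E_eq norm_triangle_ineq)
  with norm_Q[of "E z g"] show ?thesis by linarith
qed

lemma E_bounded_clinear: "bounded_clinear (E z)"
proof -
  note QD = bounded_clinearD[OF Q_bounded_clinear]
  have add: "E z (x + y) = E z x + E z y" for x y
  proof (rule E_unique[symmetric])
    have "E z x + E z y = (Q z (E z x) + x) + (Q z (E z y) + y)" using E_eq by metis
    also have "\<dots> = Q z (E z x + E z y) + (x + y)" by (simp add: QD(1))
    finally show "E z x + E z y = Q z (E z x + E z y) + (x + y)" .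
  qed
  have i: "E z (imul x) = imul (E z x)" for x
    by (rule E_unique[symmetric]) (use E_eq[of x] in \<open>metis QD(7) imul_add\<close>)
  have "E z (r *\<^sub>R x) = r *\<^sub>R E z x" for r x
    by (rule E_unique[symmetric])
      (use E_eq[of x] in \<open>metis bounded_linear.linear[OF QD(6)] linear_scale scaleR_add_right\<close>)
  then have "bounded_linear (E z)"
    using add norm_E by (intro bounded_linear_intro[where K = 2]) (auto simp: mult.commute)
  with i show ?thesis by (simp add: bounded_clinear_def)
qed

lemmas ED = bounded_clinearD[OF E_bounded_clinear]

end

text \<open>The resolvent identity for E, from subtracting the two fixed-point equations.\<close>

lemma E_diff:
  assumes "cmod z < \<rho>" "cmod z' < \<rho>"
  shows "E z g - E z' g = (z - z') *\<^sub>C E z (Q' (E z' g))"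
proof -
  note QD = bounded_clinearD[OF Q_bounded_clinear]
  have "E z g - E z' g = Q z (E z g - E z' g) + (z - z') *\<^sub>C Q' (E z' g)"
  proof -
    have "E z g - E z' g = (Q z (E z g) + g) - (Q z' (E z' g) + g)"
      using E_eq[OF assms(1), of g] E_eq[OF assms(2), of g] by metis
    also have "\<dots> = Q z (E z g - E z' g) + (z - z') *\<^sub>C Q' (E z' g)"
      by (simp add: QD(2) flip: Q_diff)
    finally show ?thesis .
  qed
  then have "E z g - E z' g = E z ((z - z') *\<^sub>C Q' (E z' g))"
    by (rule E_unique[OF assms(1)])
  then show ?thesis by (simp add: ED[OF assms(1)])
qed

text \<open>By \<open>E_diff\<close> the difference quotient at z' is exactly \<phi> (E z y) with y
  = Q' (E z' g). Differentiability thus reduces to continuity of z |-> E z y, which the same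
  identity provides.\<close>

lemma E_holomorphic:
  fixes \<phi> :: "'a \<Rightarrow> complex"
  assumes \<phi>: "bounded_linear \<phi>" "\<And>c x. \<phi> (c *\<^sub>C x) = c * \<phi> x"
  shows "(\<lambda>z. \<phi> (E z g)) holomorphic_on ball 0 \<rho>"
proof (rule holomorphic_onI)
  fix z' :: complex assume "z' \<in> ball 0 \<rho>"
  then have z': "cmod z' < \<rho>" by simp
  define y where "y = Q' (E z' g)"
  obtain C where C: "\<And>x. norm (Q' x) \<le> norm x * C"
      and C0: "C > 0"
    using bounded_linear.pos_bounded[OF bounded_clinearD(6)[OF Q'_bounded_clinear]] by blast
  have ev: "\<forall>\<^sub>F z in at z'. cmod z < \<rho>"
    using z' by (intro eventually_at_in_open'[of "ball 0 \<rho>", simplified, THEN eventually_mono]) auto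
  have "((\<lambda>z. E z y) \<longlongrightarrow> E z' y) (at z')"
  proof (rule Lim_transform_bound[OF _ tendsto_mult_left_zero[of "\<lambda>z. cmod (z - z')" _ "2 * (norm (E z' y) * C)"], THEN LIM_zero_cancel])
    show "((\<lambda>z. cmod (z - z')) \<longlongrightarrow> 0) (at z')"
      by (intro tendsto_norm_zero LIM_zero tendsto_ident_at)
    show "\<forall>\<^sub>F z in at z'. norm (E z y - E z' y) \<le> norm (cmod (z - z') * (2 * (norm (E z' y) * C)))"
      using ev
    proof eventually_elim
      case (elim z)
      have "norm (E z (Q' (E z' y))) \<le> 2 * (norm (E z' y) * C)"
        using norm_E[OF elim, of "Q' (E z' y)"] C[of "E z' y"] by linarith
      then show ?case
        using C0 by (auto simp: E_diff[OF elim z'] abs_mult intro!: mult_left_mono)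
    qed
  qed
  then have lim: "((\<lambda>z. \<phi> (E z y)) \<longlongrightarrow> \<phi> (E z' y)) (at z')"
    by (rule bounded_linear.tendsto[OF \<phi>(1)])
  have "((\<lambda>z. (\<phi> (E z g) - \<phi> (E z' g)) / (z - z')) \<longlongrightarrow> \<phi> (E z' y)) (at z')"
  proof (rule Lim_transform_eventually[OF lim])
    show "\<forall>\<^sub>F z in at z'. \<phi> (E z y) = (\<phi> (E z g) - \<phi> (E z' g)) / (z - z')"
      using ev eventually_neq_at_within[of z' z' UNIV]
    proof eventually_elim
      case (elim z)
      have "\<phi> (E z g) - \<phi> (E z' g) = (z - z') * \<phi> (E z y)"
        using E_diff[OF elim(1) z', of g] \<phi>
        by (metis linear_diff bounded_linear.linear y_def)
      then show ?case using elim(2) by simp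
    qed
  qed
  then have "((\<lambda>z. \<phi> (E z g)) has_field_derivative \<phi> (E z' y)) (at z')"
    by (simp add: has_field_derivative_iff)
  then show "(\<lambda>z. \<phi> (E z g)) field_differentiable at z' within ball 0 \<rho>"
    using field_differentiable_at_within field_differentiable_def by blast
qed

lemma cinner_E_holomorphic: "(\<lambda>z. cinner (E z g) h) holomorphic_on ball 0 \<rho>"
  by (intro E_holomorphic bounded_linear_cinner_left) simp

lemma cinner_KE_holomorphic: "(\<lambda>z. cinner (K z (E z g)) h) holomorphic_on ball 0 \<rho>"
proof -
  note TD = bounded_clinearD[OF T]
  have "(\<lambda>z. cinner (T (B (E z g))) h + z * cinner (T (G (E z g))) h) holomorphic_on ball 0 \<rho>"
    using bounded_clinearD[OF bounded_clinear_compose[OF T B]]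
      bounded_clinearD[OF bounded_clinear_compose[OF T G]]
    by (intro holomorphic_intros E_holomorphic bounded_linear_compose[OF bounded_linear_cinner_left]) auto
  then show ?thesis
    by (simp add: K_def TD cinner_add_left)
qed

text \<open>With unknowns x k = \<open>cinner (K z u) (a k)\<close>, a solution of u = K z u + g is
  the sum of the x k E z (b k) plus E z g. Applying \<open>K z\<close> and pairing with a j gives
  the linear system whose matrix this is.\<close>

definition M :: "complex \<Rightarrow> nat \<Rightarrow> nat \<Rightarrow> complex" where
  "M z j k = (if j = k then 1 else 0) - cinner (K z (E z (b k))) (a j)"

definition D :: "complex \<Rightarrow> complex" where
  "D z = mdet n (M z)"

lemma M_holomorphic: "(\<lambda>z. M z j k) holomorphic_on ball 0 \<rho>"
  unfolding M_def by (intro holomorphic_intros cinner_KE_holomorphic)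

lemma D_holomorphic: "D holomorphic_on ball 0 \<rho>"
  unfolding D_def by (intro mdet_holomorphic M_holomorphic)

text \<open>Cramer's numerators: X z g k / D z solves the system with right-hand side
  \<open>cinner (K z (E z g)) (a j)\<close>, while X itself stays holomorphic across the zeros of
  D.\<close>

definition X :: "complex \<Rightarrow> 'a \<Rightarrow> nat \<Rightarrow> complex" where
  "X z g k = (\<Sum>j<n. madj n (M z) k j * cinner (K z (E z g)) (a j))"

lemma X_holomorphic: "k < n \<Longrightarrow> (\<lambda>z. X z g k) holomorphic_on ball 0 \<rho>"
  unfolding X_def by (intro holomorphic_intros madj_holomorphic M_holomorphic cinner_KE_holomorphic) auto

context
  fixes z assumes z: "cmod z < \<rho>"
begin

lemma M_mult: "j < n \<Longrightarrow> (\<Sum>k<n. M z j k * x k) = x j - (\<Sum>k<n. x k * cinner (K z (E z (b k))) (a j))"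
proof -
  assume "j < n"
  then have "(\<Sum>k<n. (if j = k then 1 else 0) * x k) = x j"
    by (simp add: if_distrib[of "\<lambda>t. t * _"] cong: if_cong)
  then show ?thesis
    by (simp add: M_def left_diff_distrib sum_subtractf) (simp add: mult.commute)
qed

text \<open>Split K z into Q z and F K z, treat the finite-rank term as part of the right-hand side,
  and invert 1 - Q z.\<close>

lemma solution_iff_E: "u = K z u + g \<longleftrightarrow> u = E z (F (K z u)) + E z g"
proof -
  have "u = K z u + g \<longleftrightarrow> u = Q z u + (F (K z u) + g)" by (simp add: Q_def)
  also have "\<dots> \<longleftrightarrow> u = E z (F (K z u) + g)" using E_unique[OF z] E_eq[OF z] by metis
  finally show ?thesis by (simp add: ED(1)[OF z])
qed

lemma E_F: "E z (F v) = (\<Sum>k<n. cinner v (a k) *\<^sub>C E z (b k))"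
  by (simp add: F_def ED[OF z])

lemma solution_coefficients:
  assumes "u = K z u + g" "j < n"
  shows "(\<Sum>k<n. M z j k * cinner (K z u) (a k)) = cinner (K z (E z g)) (a j)"
proof -
  note KD = bounded_clinearD[OF K_bounded_clinear]
  have "u = (\<Sum>k<n. cinner (K z u) (a k) *\<^sub>C E z (b k)) + E z g"
    using assms(1) solution_iff_E E_F by metis
  then have "cinner (K z u) (a j) = cinner (K z ((\<Sum>k<n. cinner (K z u) (a k) *\<^sub>C E z (b k)) + E z g)) (a j)"
    by metis
  also have "\<dots> = (\<Sum>k<n. cinner (K z u) (a k) * cinner (K z (E z (b k))) (a j)) + cinner (K z (E z g)) (a j)"
    by (simp add: KD cinner_add_left cinner_sum_left)
  finally show ?thesis using assms(2) by (simp add: M_mult)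
qed

lemma solution_from_coefficients:
  assumes "\<And>j. j < n \<Longrightarrow> (\<Sum>k<n. M z j k * x k) = cinner (K z (E z g)) (a j)"
    and u: "u = (\<Sum>k<n. x k *\<^sub>C E z (b k)) + E z g"
  shows "u = K z u + g" and "\<And>j. j < n \<Longrightarrow> cinner (K z u) (a j) = x j"
proof -
  note KD = bounded_clinearD[OF K_bounded_clinear]
  have *: "cinner (K z u) (a j) = x j" if "j < n" for j
    using assms(1)[OF that] unfolding M_mult[OF that]
    by (simp add: u KD cinner_add_left cinner_sum_left algebra_simps)
  then show "\<And>j. j < n \<Longrightarrow> cinner (K z u) (a j) = x j" .
  have "E z (F (K z u)) = (\<Sum>k<n. x k *\<^sub>C E z (b k))"
    using * by (simp add: E_F)
  then show "u = K z u + g" using solution_iff_E u by simp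
qed

lemma singular_iff: "z \<in> singular \<longleftrightarrow> D z = 0"
proof
  assume "z \<in> singular"
  then obtain u where u: "u \<noteq> 0" "u = K z u" by (auto simp: singular_def)
  define x where "x k = cinner (K z u) (a k)" for k
  have x: "(\<Sum>k<n. M z j k * x k) = 0" if "j < n" for j
    using solution_coefficients[of u 0 j] u(2) that
    by (simp add: x_def ED(3)[OF z] bounded_clinearD(3)[OF K_bounded_clinear])
  show "D z = 0"
  proof (rule ccontr)
    assume D: "D z \<noteq> 0"
    have "x i = 0" if "i < n" for i
    proof -
      \<comment> \<open>The adjugate times M z is D z times the identity, so all coefficients
        vanish; \<open>solution_iff_E\<close> then forces u = 0.\<close>
      have "D z * x i = (\<Sum>k<n. (\<Sum>j<n. madj n (M z) i j * M z j k) * x k)"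
        using that by (simp add: madj_mult D_def if_distrib[of "\<lambda>t. t * _"] cong: if_cong)
      also have "\<dots> = (\<Sum>j<n. madj n (M z) i j * (\<Sum>k<n. M z j k * x k))"
        unfolding sum_distrib_right sum_distrib_left by (subst sum.swap) (simp add: mult.assoc)
      also have "\<dots> = 0" using x by simp
      finally show ?thesis using D by simp
    qed
    then have "E z (F (K z u)) = 0" by (simp add: E_F x_def)
    with solution_iff_E[of u 0] u show False by (simp add: ED(3)[OF z])
  qed
next
  assume "D z = 0"
  \<comment> \<open>A kernel vector x of M z yields a solution whose coefficients are x again. One
    of them is nonzero and K z maps 0 to 0, so the solution is nonzero.\<close>
  then obtain x k where x: "k < n" "x k \<noteq> 0" "\<And>j. j < n \<Longrightarrow> (\<Sum>k<n. M z j k * x k) = 0"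
    unfolding D_def using mdet_eq_0_kernel[of n "M z"] by metis
  define u where "u = (\<Sum>k<n. x k *\<^sub>C E z (b k)) + E z 0"
  have *: "u = K z u + 0" "cinner (K z u) (a k) = x k"
    using solution_from_coefficients[OF _ u_def] x
    by (auto simp: ED(3)[OF z] bounded_clinearD(3)[OF K_bounded_clinear])
  then have "u \<noteq> 0" using x(2) by (auto simp: bounded_clinearD(3)[OF K_bounded_clinear])
  with *(1) show "z \<in> singular" by (auto simp: singular_def)
qed

lemma regular_solution:
  assumes "D z \<noteq> 0"
  shows "u = K z u + g \<longleftrightarrow> u = (\<Sum>k<n. (X z g k / D z) *\<^sub>C E z (b k)) + E z g"
proof -
  define v where "v = (\<Sum>k<n. (X z g k / D z) *\<^sub>C E z (b k)) + E z g"
  have "(\<Sum>k<n. M z j k * (X z g k / D z)) = cinner (K z (E z g)) (a j)" if "j < n" for j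
  proof -
    have "(\<Sum>k<n. M z j k * X z g k) = (\<Sum>i<n. (\<Sum>k<n. M z j k * madj n (M z) k i) * cinner (K z (E z g)) (a i))"
      unfolding X_def sum_distrib_right sum_distrib_left by (subst sum.swap) (simp add: mult.assoc)
    also have "\<dots> = D z * cinner (K z (E z g)) (a j)"
      using that by (simp add: madj_mult D_def if_distrib[of "\<lambda>t. t * _"] cong: if_cong)
    finally show ?thesis using assms by (simp flip: sum_divide_distrib)
  qed
  then have v: "v = K z v + g"
    by (rule solution_from_coefficients(1)[OF _ v_def])
  have "u = v" if "u = K z u + g"
    using solution_unique[OF _ that v] assms by (simp add: singular_iff)
  with v show ?thesis unfolding v_def by blast
qed

text \<open>Cramer's rule writes the solution as a finite combination of bounded linear maps of
  g.\<close>

lemma regular_bound: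
  assumes "D z \<noteq> 0"
  shows "\<exists>C. \<forall>g u. u = K z u + g \<longrightarrow> norm u \<le> C * norm g"
proof -
  define L where "L g = (\<Sum>k<n. (X z g k / D z) *\<^sub>C E z (b k)) + E z g" for g
  have "bounded_linear (\<lambda>g. cinner (K z (E z g)) h)" for h
    by (intro bounded_linear_compose[OF bounded_linear_cinner_left] bounded_clinearD(6)
        bounded_clinear_compose[OF K_bounded_clinear E_bounded_clinear[OF z]])
  then have "bounded_linear L"
    unfolding L_def X_def divide_inverse
    by (intro bounded_linear_add bounded_linear_sum bounded_linear_compose[OF bounded_linear_scaleC_left]
        bounded_linear_mult_const bounded_linear_const_mult ED(6)[OF z])
  then obtain C where "\<And>g. norm (L g) \<le> norm g * C"
    using bounded_linear.bounded by blast
  then show ?thesis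
    using regular_solution[OF assms] by (metis L_def mult.commute)
qed

end

section \<open>Principal parts at singular points\<close>

text \<open>A finite Taylor expansion at z0 from iterating \<open>E_diff\<close>. The remainder
  contains E at z, not at z0, and is therefore still holomorphic in z.\<close>

lemma E_expansion:
  assumes "cmod z0 < \<rho>" "cmod z < \<rho>"
  shows "E z y = (\<Sum>p<N. (z - z0) ^ p *\<^sub>C E z0 (((\<lambda>v. Q' (E z0 v)) ^^ p) y))
    + (z - z0) ^ N *\<^sub>C E z (((\<lambda>v. Q' (E z0 v)) ^^ N) y)"
proof (induction N)
  case (Suc N)
  let ?y = "((\<lambda>v. Q' (E z0 v)) ^^ N) y"
  have "E z ?y = E z0 ?y + (z - z0) *\<^sub>C E z (Q' (E z0 ?y))"
    using E_diff[OF assms(2,1), of ?y] by (simp add: algebra_simps)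
  then have "(z - z0) ^ N *\<^sub>C E z ?y = (z - z0) ^ N *\<^sub>C E z0 ?y + (z - z0) ^ Suc N *\<^sub>C E z (Q' (E z0 ?y))"
    by (simp add: scaleC_add_right mult.commute)
  with Suc.IH show ?case by (simp add: add.assoc)
qed simp

text \<open>Near z0 the solution is the sum of the (X \<zeta> g k / D \<zeta>) E \<zeta> (b k) plus
  E \<zeta> g. When E \<zeta> (b k) is expanded to the order N of the zero of D, the remainder
  cancels the pole and integrates to 0; what is left combines vectors e (k, p) that do not depend on
  g. The family r is arbitrary because the resolvent will be a chosen representative of which only
  the equation is known.\<close>

lemma residue_finite_rank:
  assumes z0: "cmod z0 < \<rho>" "D z0 = 0" and z1: "cmod z1 < \<rho>" "D z1 \<noteq> 0"
  shows "\<exists>\<epsilon>>0. cball z0 \<epsilon> \<inter> singular = {z0} \<and>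
    (\<exists>(I :: (nat \<times> nat) set) e. finite I \<and> (\<forall>g. \<exists>c. \<forall>r. (\<forall>\<zeta>\<in>sphere z0 \<epsilon>. r \<zeta> = K \<zeta> (r \<zeta>) + g) \<longrightarrow>
      (\<forall>h. contour_integral (circlepath z0 \<epsilon>) (\<lambda>\<zeta>. cinner (r \<zeta>) h) = cinner (\<Sum>i\<in>I. c i *\<^sub>C e i) h)))"
proof -
  \<comment> \<open>D vanishes at z0 but not at z1, and both lie in the connected disc of radius
    \<rho>.\<close>
  have nc: "\<not> D constant_on ball 0 \<rho>"
    using z0 z1 unfolding constant_on_def by (metis mem_ball_0)
  obtain H r N where "0 < N" and r: "0 < r" "ball z0 r \<subseteq> ball 0 \<rho>" and H: "H holomorphic_on ball z0 r"
    and DH: "\<And>w. w \<in> ball z0 r \<Longrightarrow> D w = (w - z0) ^ N * H w" "\<And>w. w \<in> ball z0 r \<Longrightarrow> H w \<noteq> 0"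
    using holomorphic_factor_zero_nonconstant[OF D_holomorphic open_ball connected_ball _ z0(2) nc] z0(1)
    by (metis mem_ball_0)
  \<comment> \<open>Half the radius keeps the closed disc inside the region where H has no
    zero.\<close>
  define \<epsilon> where "\<epsilon> = r / 2"
  have \<epsilon>: "0 < \<epsilon>" "cball z0 \<epsilon> \<subseteq> ball z0 r" "sphere z0 \<epsilon> \<subseteq> ball z0 r" using r(1) by (auto simp: \<epsilon>_def)
  have inball: "cmod z < \<rho>" if "z \<in> ball z0 r" for z
    using r(2) that by auto
  have sing: "cball z0 \<epsilon> \<inter> singular = {z0}"
    using \<epsilon> inball DH z0 by (force simp: singular_iff)
  define e where "e = (\<lambda>(k, p). E z0 (((\<lambda>v. Q' (E z0 v)) ^^ p) (b k)))"
  define f where "f k = ((\<lambda>v. Q' (E z0 v)) ^^ N) (b k)" for k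
  define I where "I = {..<n} \<times> {..<N}"
  define x where "x g k \<zeta> = X \<zeta> g k / D \<zeta>" for g k \<zeta>
  define c where "c g = (\<lambda>(k, p). contour_integral (circlepath z0 \<epsilon>) (\<lambda>\<zeta>. x g k \<zeta> * (\<zeta> - z0) ^ p))" for g
  have hol: "f holomorphic_on ball z0 r" if "f holomorphic_on ball 0 \<rho>" for f
    using that r(2) by (rule holomorphic_on_subset)
  have D_nz: "D \<zeta> \<noteq> 0" if "\<zeta> \<in> sphere z0 \<epsilon>" for \<zeta>
    using that \<epsilon> DH by force
  have int: "(\<lambda>\<zeta>. x g k \<zeta> * (\<zeta> - z0) ^ p) contour_integrable_on circlepath z0 \<epsilon>" if "k < n" for g k p
    unfolding x_def using D_nz \<epsilon> r(2) abs_of_pos[OF \<epsilon>(1)]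
    by (intro contour_integrable_continuous_circlepath continuous_intros
        holomorphic_on_imp_continuous_on[OF holomorphic_on_subset[OF X_holomorphic[OF that]]]
        holomorphic_on_imp_continuous_on[OF holomorphic_on_subset[OF D_holomorphic]]) (auto simp: \<epsilon>(1))
  have "contour_integral (circlepath z0 \<epsilon>) (\<lambda>\<zeta>. cinner (R \<zeta>) h) = cinner (\<Sum>i\<in>I. c g i *\<^sub>C e i) h"
    if R: "\<forall>\<zeta>\<in>sphere z0 \<epsilon>. R \<zeta> = K \<zeta> (R \<zeta>) + g" for g R h
  proof -
    \<comment> \<open>The regular part: the expansion remainders, whose factor (\<zeta> - z0)^N has
      been cancelled against that of D, plus the term from E \<zeta> g.\<close>
    define A where "A \<zeta> = (\<Sum>k<n. (X \<zeta> g k / H \<zeta>) * cinner (E \<zeta> (f k)) h) + cinner (E \<zeta> g) h" for \<zeta>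
    have "A holomorphic_on ball z0 r"
      unfolding A_def using DH(2)
      by (intro holomorphic_intros hol X_holomorphic cinner_E_holomorphic H) auto
    then have A: "(A has_contour_integral 0) (circlepath z0 \<epsilon>)"
      using \<epsilon> by (intro Cauchy_theorem_disc_simple[of _ z0 r]) auto
    have eq: "cinner (R \<zeta>) h = (\<Sum>(k, p)\<in>I. x g k \<zeta> * (\<zeta> - z0) ^ p * cinner (e (k, p)) h) + A \<zeta>"
      if \<zeta>: "\<zeta> \<in> sphere z0 \<epsilon>" for \<zeta>
    proof -
      have b: "\<zeta> \<in> ball z0 r" and nz: "\<zeta> \<noteq> z0" using \<zeta> \<epsilon> by auto
      have "R \<zeta> = (\<Sum>k<n. x g k \<zeta> *\<^sub>C E \<zeta> (b k)) + E \<zeta> g"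
        using regular_solution[OF inball[OF b] D_nz[OF \<zeta>]] R \<zeta> unfolding x_def by blast
      then have "cinner (R \<zeta>) h = (\<Sum>k<n. x g k \<zeta> * cinner (E \<zeta> (b k)) h) + cinner (E \<zeta> g) h"
        by (simp add: cinner_add_left cinner_sum_left)
      also have "(\<Sum>k<n. x g k \<zeta> * cinner (E \<zeta> (b k)) h) =
          (\<Sum>k<n. (\<Sum>p<N. x g k \<zeta> * (\<zeta> - z0) ^ p * cinner (e (k, p)) h) + X \<zeta> g k / H \<zeta> * cinner (E \<zeta> (f k)) h)"
      proof (rule sum.cong[OF refl])
        fix k
        have "cinner (E \<zeta> (b k)) h = (\<Sum>p<N. (\<zeta> - z0) ^ p * cinner (e (k, p)) h) + (\<zeta> - z0) ^ N * cinner (E \<zeta> (f k)) h"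
          by (subst E_expansion[OF z0(1) inball[OF b], of _ N])
            (simp add: cinner_add_left cinner_sum_left e_def f_def)
        moreover have "x g k \<zeta> * (\<zeta> - z0) ^ N = X \<zeta> g k / H \<zeta>"
          using nz DH[OF b] by (simp add: x_def)
        ultimately show "x g k \<zeta> * cinner (E \<zeta> (b k)) h =
          (\<Sum>p<N. x g k \<zeta> * (\<zeta> - z0) ^ p * cinner (e (k, p)) h) + X \<zeta> g k / H \<zeta> * cinner (E \<zeta> (f k)) h"
          by (simp add: distrib_left sum_distrib_left mult.assoc[symmetric])
      qed
      finally show ?thesis
        by (simp add: A_def sum.distrib I_def sum.cartesian_product add.assoc)
    qed
    have "((\<lambda>\<zeta>. (\<Sum>(k, p)\<in>I. x g k \<zeta> * (\<zeta> - z0) ^ p * cinner (e (k, p)) h) + A \<zeta>)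
        has_contour_integral ((\<Sum>i\<in>I. c g i * cinner (e i) h) + 0)) (circlepath z0 \<epsilon>)"
    proof (rule has_contour_integral_add[OF has_contour_integral_sum A])
      show "finite I" by (simp add: I_def)
      fix i assume "i \<in> I"
      then obtain k p where i: "i = (k, p)" "k < n" by (auto simp: I_def)
      have "((\<lambda>\<zeta>. x g k \<zeta> * (\<zeta> - z0) ^ p * cinner (e (k, p)) h) has_contour_integral
          contour_integral (circlepath z0 \<epsilon>) (\<lambda>\<zeta>. x g k \<zeta> * (\<zeta> - z0) ^ p) * cinner (e (k, p)) h) (circlepath z0 \<epsilon>)"
        by (intro has_contour_integral_rmul has_contour_integral_integral int i)
      then show "((\<lambda>\<zeta>. case i of (k, p) \<Rightarrow> x g k \<zeta> * (\<zeta> - z0) ^ p * cinner (e (k, p)) h) has_contour_integral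
          c g i * cinner (e i) h) (circlepath z0 \<epsilon>)"
        by (simp add: i c_def)
    qed
    then have "((\<lambda>\<zeta>. cinner (R \<zeta>) h) has_contour_integral (\<Sum>i\<in>I. c g i * cinner (e i) h)) (circlepath z0 \<epsilon>)"
      unfolding add_0_right by (rule has_contour_integral_eq) (use eq \<epsilon>(1) in auto)
    then show ?thesis
      by (simp add: contour_integral_unique cinner_sum_left)
  qed
  moreover have "finite I" by (simp add: I_def)
  ultimately show ?thesis using \<epsilon>(1) sing by blast
qed

end

context approximable_pencil
begin

lemma reduced_pencil_exists: "\<exists>n a b. reduced_pencil T B G \<rho> n a b"
proof -
  obtain CB where CB: "\<And>x. norm (B x) \<le> norm x * CB" "CB > 0"
    using bounded_linear.pos_bounded[OF bounded_clinearD(6)[OF B]] by blast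
  obtain CG where CG: "\<And>x. norm (G x) \<le> norm x * CG" "CG > 0"
    using bounded_linear.pos_bounded[OF bounded_clinearD(6)[OF G]] by blast
  \<comment> \<open>C bounds u |-> B u + z G u for all z with \<open>cmod z < \<rho>\<close>, so
    accuracy 1 / (2 C) in \<open>approx\<close> gives the factor 1/2.\<close>
  define C where "C = CB + \<bar>\<rho>\<bar> * CG"
  have C: "C > 0" using CB(2) CG(2) by (simp add: C_def add_pos_nonneg)
  have "\<exists>(n::nat) a b. \<forall>u. norm (T u - (\<Sum>k<n. cinner (T u) (a k) *\<^sub>C b k)) \<le> (1 / (2 * C)) * norm u"
    using C by (intro approx) simp
  then obtain n :: nat and a b
    where nab: "\<And>u. norm (T u - (\<Sum>k<n. cinner (T u) (a k) *\<^sub>C b k)) \<le> (1 / (2 * C)) * norm u"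
    by blast
  have "norm (K z u - (\<Sum>k<n. cinner (K z u) (a k) *\<^sub>C b k)) \<le> norm u / 2" if z: "cmod z < \<rho>" for z u
  proof -
    have "norm (B u + z *\<^sub>C G u) \<le> norm (B u) + cmod z * norm (G u)"
      using norm_triangle_ineq[of "B u" "z *\<^sub>C G u"] by simp
    also have "\<dots> \<le> norm u * CB + \<bar>\<rho>\<bar> * (norm u * CG)"
      using z CB CG by (intro add_mono mult_mono) auto
    finally have "norm (B u + z *\<^sub>C G u) \<le> C * norm u" by (simp add: C_def algebra_simps)
    then have "(1 / (2 * C)) * norm (B u + z *\<^sub>C G u) \<le> (1 / (2 * C)) * (C * norm u)"
      using C by (intro mult_left_mono) auto
    then show ?thesis
      unfolding K_def using nab[of "B u + z *\<^sub>C G u"] C by simp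
  qed
  then have "reduced_pencil T B G \<rho> n a b"
    by unfold_locales
  then show ?thesis by blast
qed

lemma regular_point_solution:
  assumes "z \<notin> singular"
  shows "\<exists>u. u = K z u + g" and "\<exists>C. \<forall>g u. u = K z u + g \<longrightarrow> norm u \<le> C * norm g"
proof -
  obtain n a b where "reduced_pencil T B G (cmod z + 1) n a b"
    using reduced_pencil_exists by blast
  then interpret reduced_pencil T B G "cmod z + 1" n a b .
  have z: "cmod z < cmod z + 1" by simp
  have D: "D z \<noteq> 0" using assms singular_iff[OF z] by simp
  show "\<exists>u. u = K z u + g" using regular_solution[OF z D] by blast
  show "\<exists>C. \<forall>g u. u = K z u + g \<longrightarrow> norm u \<le> C * norm g" by (rule regular_bound[OF z D])
qed

lemma singular_point_residue:
  assumes "z0 \<in> singular" "z1 \<notin> singular"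
  shows "\<exists>\<epsilon>>0. cball z0 \<epsilon> \<inter> singular = {z0} \<and>
    (\<exists>(I :: (nat \<times> nat) set) e. finite I \<and> (\<forall>g. \<exists>c. \<forall>r. (\<forall>\<zeta>\<in>sphere z0 \<epsilon>. r \<zeta> = K \<zeta> (r \<zeta>) + g) \<longrightarrow>
      (\<forall>h. contour_integral (circlepath z0 \<epsilon>) (\<lambda>\<zeta>. cinner (r \<zeta>) h) = cinner (\<Sum>i\<in>I. c i *\<^sub>C e i) h)))"
proof -
  \<comment> \<open>The disc has to contain z1 too, as z1 is what rules out that D vanishes
    identically.\<close>
  define \<rho> where "\<rho> = cmod z0 + cmod z1 + 1"
  obtain n a b where "reduced_pencil T B G \<rho> n a b"
    using reduced_pencil_exists by blast
  then interpret reduced_pencil T B G \<rho> n a b .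
  have z: "cmod z0 < \<rho>" "cmod z1 < \<rho>" by (simp_all add: \<rho>_def add_pos_nonneg add.commute add_nonneg_pos)
  show ?thesis
    using residue_finite_rank[OF z(1) _ z(2)] assms singular_iff[OF z(1)] singular_iff[OF z(2)] by blast
qed

end

section \<open>The Hilbert space of square-integrable fields\<close>

lemmas field_eq_iff = Finite_Cartesian_Product.vec_eq_iff

lemma L2_iff: "f \<in> L2 \<longleftrightarrow> f \<in> borel_measurable lborel \<and> integrable lborel (\<lambda>x. (norm (f x))\<^sup>2)"
  by (simp add: L2_def)

lemma L2_measurable: "f \<in> L2 \<Longrightarrow> f \<in> borel_measurable borel"
  by (simp add: L2_iff)

lemma L2_dominated:
  assumes "f \<in> L2" "g \<in> borel_measurable borel" "\<And>x. norm (g x) \<le> c * norm (f x)"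
  shows "g \<in> L2"
proof -
  have [measurable]: "g \<in> borel_measurable borel" by fact
  have "integrable lborel (\<lambda>x. (norm (g x))\<^sup>2)"
  proof (rule Bochner_Integration.integrable_bound)
    show "integrable lborel (\<lambda>x. c\<^sup>2 * (norm (f x))\<^sup>2)"
      using assms(1) by (simp add: L2_iff)
    show "AE x in lborel. norm ((norm (g x))\<^sup>2) \<le> norm (c\<^sup>2 * (norm (f x))\<^sup>2)"
      using assms(3) by (auto intro!: AE_I2 power_mono simp flip: power_mult_distrib)
  qed simp
  then show ?thesis using assms(2) by (simp add: L2_iff)
qed

lemma L2_add: "f \<in> L2 \<Longrightarrow> g \<in> L2 \<Longrightarrow> (\<lambda>x. f x + g x) \<in> L2"
proof -
  assume f: "f \<in> L2" and g: "g \<in> L2"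
  note [measurable] = L2_measurable[OF f] L2_measurable[OF g]
  have "integrable lborel (\<lambda>x. (norm (f x + g x))\<^sup>2)"
  proof (rule Bochner_Integration.integrable_bound)
    show "integrable lborel (\<lambda>x. 2 * (norm (f x))\<^sup>2 + 2 * (norm (g x))\<^sup>2)"
      using f g by (simp add: L2_iff)
    have "(norm (f x + g x))\<^sup>2 \<le> 2 * (norm (f x))\<^sup>2 + 2 * (norm (g x))\<^sup>2" for x
      using power_mono[OF norm_triangle_ineq[of "f x" "g x"] norm_ge_zero, of 2]
        sum_squares_bound[of "norm (f x)" "norm (g x)"] by (simp add: power2_sum)
    then show "AE x in lborel. norm ((norm (f x + g x))\<^sup>2) \<le> norm (2 * (norm (f x))\<^sup>2 + 2 * (norm (g x))\<^sup>2)"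
      by (auto intro!: AE_I2 order_trans[OF _ abs_ge_self])
  qed simp
  then show ?thesis by (simp add: L2_iff)
qed

lemma L2_zero [simp]: "(\<lambda>x. 0) \<in> L2"
  by (simp add: L2_iff)

lemma borel_measurable_vec_scale [measurable]: "(*s) (c::complex) \<in> borel_measurable (borel :: (complex^2) measure)"
proof (rule borel_measurable_continuous_onI)
  have "(*s) c = (\<lambda>v::complex^2. \<chi> i. c * v $ i)"
    by (simp add: fun_eq_iff field_eq_iff)
  then show "continuous_on UNIV ((*s) c :: complex^2 \<Rightarrow> complex^2)"
    by (auto intro!: continuous_intros)
qed

lemma norm_vec_scale: "norm ((c::complex) *s (v::complex^2)) = cmod c * norm v"
proof -
  have "(norm (c *s v))\<^sup>2 = (cmod c * norm v)\<^sup>2"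
    by (simp add: power_mult_distrib norm_vec_def L2_set_def sum_nonneg norm_mult sum_distrib_left)
  then show ?thesis by (simp add: power2_eq_iff_nonneg)
qed

lemma L2_vec_scale: "f \<in> L2 \<Longrightarrow> (\<lambda>x. c *s f x) \<in> L2"
proof -
  assume f: "f \<in> L2"
  note [measurable] = L2_measurable[OF f]
  show ?thesis
    using f by (rule L2_dominated[where c = "cmod c"]) (measurable, simp add: norm_vec_scale)
qed

lemma L2_scaleR: "f \<in> L2 \<Longrightarrow> (\<lambda>x. c *\<^sub>R f x) \<in> L2"
proof -
  assume f: "f \<in> L2"
  note [measurable] = L2_measurable[OF f]
  show ?thesis
    by (rule L2_dominated[OF f, where c = "\<bar>c\<bar>"]) simp_all
qed

lemma L2_minus: "f \<in> L2 \<Longrightarrow> (\<lambda>x. - f x) \<in> L2"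
  using L2_scaleR[of f "-1"] by simp

lemma L2_diff: "f \<in> L2 \<Longrightarrow> g \<in> L2 \<Longrightarrow> (\<lambda>x. f x - g x) \<in> L2"
  using L2_add[OF _ L2_minus, of f g] by simp

lemma L2_sum: "(\<And>k. k \<in> A \<Longrightarrow> f k \<in> L2) \<Longrightarrow> (\<lambda>x. \<Sum>k\<in>A. f k x) \<in> L2"
  by (induction A rule: infinite_finite_induct) (simp_all add: L2_add)

lemma L2_inner_integrable:
  assumes "f \<in> L2" "g \<in> L2"
  shows "integrable lborel (\<lambda>x. inner (f x) (g x))"
proof (rule Bochner_Integration.integrable_bound)
  show "integrable lborel (\<lambda>x. (norm (f x))\<^sup>2 + (norm (g x))\<^sup>2)"
    using assms by (simp add: L2_iff)
  have "\<bar>inner (f x) (g x)\<bar> \<le> (norm (f x))\<^sup>2 + (norm (g x))\<^sup>2" for x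
    using Cauchy_Schwarz_ineq2[of "f x" "g x"] sum_squares_bound[of "norm (f x)" "norm (g x)"]
      mult_nonneg_nonneg[OF norm_ge_zero[of "f x"] norm_ge_zero[of "g x"]]
    by linarith
  then show "AE x in lborel. norm (inner (f x) (g x)) \<le> norm ((norm (f x))\<^sup>2 + (norm (g x))\<^sup>2)"
    by simp
qed (use assms[THEN L2_measurable] in measurable)

section \<open>The quotient by almost-everywhere equality\<close>

lemma L2_eq_refl [simp]: "L2_eq f f"
  by (simp add: L2_eq_def)

lemma L2_eq_sym: "L2_eq f g \<Longrightarrow> L2_eq g f"
  by (auto simp: L2_eq_def elim: AE_mp)

lemma L2_eq_trans: "L2_eq f g \<Longrightarrow> L2_eq g h \<Longrightarrow> L2_eq f h"
  unfolding L2_eq_def by (erule (1) eventually_elim2) simp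

\<comment> \<open>The relation is partial because only functions in \<open>L2\<close> have a class;
  square integrability thus becomes part of the type.\<close>
quotient_type lsq = field2 / partial: "\<lambda>f g. f \<in> L2 \<and> g \<in> L2 \<and> L2_eq f g"
proof (rule part_equivpI)
  show "\<exists>f. f \<in> L2 \<and> f \<in> L2 \<and> L2_eq f f" using L2_zero L2_eq_refl by blast
  show "symp (\<lambda>f g. f \<in> L2 \<and> g \<in> L2 \<and> L2_eq f g)"
    by (rule sympI) (blast intro: L2_eq_sym)
  show "transp (\<lambda>f g. f \<in> L2 \<and> g \<in> L2 \<and> L2_eq f g)"
    by (rule transpI) (blast intro: L2_eq_trans)
qed

lemma rep_lsq [simp]: "rep_lsq u \<in> L2" and abs_rep_lsq [simp]: "abs_lsq (rep_lsq u) = u"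
  using Quotient3_rep_reflp[OF Quotient3_lsq, of u] Quotient3_abs_rep[OF Quotient3_lsq] by simp_all

lemma abs_lsq_eq_iff: "f \<in> L2 \<Longrightarrow> g \<in> L2 \<Longrightarrow> abs_lsq f = abs_lsq g \<longleftrightarrow> L2_eq f g"
  using Quotient3_rel[OF Quotient3_lsq, of f g] by simp

lemma rep_abs_lsq: "f \<in> L2 \<Longrightarrow> L2_eq (rep_lsq (abs_lsq f)) f"
  by (simp flip: abs_lsq_eq_iff)

lemma rep_abs_lsq_AE: "f \<in> L2 \<Longrightarrow> AE x in lborel. rep_lsq (abs_lsq f) x = f x"
  using rep_abs_lsq by (simp add: L2_eq_def)

lemma rep_lsq_measurable [measurable]: "rep_lsq u \<in> borel_measurable borel"
  by (rule L2_measurable) simp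

lemma lsq_cases: obtains f where "f \<in> L2" "u = abs_lsq f"
  using that[of "rep_lsq u"] by simp

instantiation lsq :: real_inner
begin

definition "0 = abs_lsq (\<lambda>x. 0)"
definition "u + v = abs_lsq (\<lambda>x. rep_lsq u x + rep_lsq v x)"
definition "u - v = abs_lsq (\<lambda>x. rep_lsq u x - rep_lsq v x)"
definition "- u = abs_lsq (\<lambda>x. - rep_lsq u x)"
definition "c *\<^sub>R u = abs_lsq (\<lambda>x. c *\<^sub>R rep_lsq u x)"
definition "inner u v = (\<integral>x. inner (rep_lsq u x) (rep_lsq v x) \<partial>lborel)"
definition norm_lsq :: "lsq \<Rightarrow> real" where "norm_lsq u = sqrt (inner u u)"
definition sgn_lsq :: "lsq \<Rightarrow> lsq" where "sgn_lsq u = inverse (norm u) *\<^sub>R u"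
definition dist_lsq :: "lsq \<Rightarrow> lsq \<Rightarrow> real" where "dist_lsq u v = norm (u - v)"
definition uniformity_lsq :: "(lsq \<times> lsq) filter" where
  "uniformity_lsq = (INF e\<in>{0<..}. principal {(u, v). dist u v < e})"
definition open_lsq :: "lsq set \<Rightarrow> bool" where
  "open_lsq U \<longleftrightarrow> (\<forall>x\<in>U. \<forall>\<^sub>F (x', y) in uniformity. x' = x \<longrightarrow> y \<in> U)"

text \<open>The operations are defined on chosen representatives. This and the next lemmas carry
  them over to arbitrary ones, so that the vector space laws become pointwise identities.\<close>

lemma abs_lsq_add: "f \<in> L2 \<Longrightarrow> g \<in> L2 \<Longrightarrow> abs_lsq (\<lambda>x. f x + g x) = abs_lsq f + abs_lsq g"
  using rep_abs_lsq_AE[of f] rep_abs_lsq_AE[of g]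
  by (auto simp: plus_lsq_def abs_lsq_eq_iff L2_add L2_eq_def)

lemma abs_lsq_diff: "f \<in> L2 \<Longrightarrow> g \<in> L2 \<Longrightarrow> abs_lsq (\<lambda>x. f x - g x) = abs_lsq f - abs_lsq g"
  using rep_abs_lsq_AE[of f] rep_abs_lsq_AE[of g]
  by (auto simp: minus_lsq_def abs_lsq_eq_iff L2_diff L2_eq_def)

lemma abs_lsq_minus: "f \<in> L2 \<Longrightarrow> abs_lsq (\<lambda>x. - f x) = - abs_lsq f"
  using rep_abs_lsq_AE[of f]
  by (auto simp: uminus_lsq_def abs_lsq_eq_iff L2_minus L2_eq_def)

lemma abs_lsq_scaleR: "f \<in> L2 \<Longrightarrow> abs_lsq (\<lambda>x. c *\<^sub>R f x) = c *\<^sub>R abs_lsq f"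
  using rep_abs_lsq_AE[of f]
  by (auto simp: scaleR_lsq_def abs_lsq_eq_iff L2_scaleR L2_eq_def)

lemma inner_abs_lsq:
  "f \<in> L2 \<Longrightarrow> g \<in> L2 \<Longrightarrow> inner (abs_lsq f) (abs_lsq g) = (\<integral>x. inner (f x) (g x) \<partial>lborel)"
  unfolding inner_lsq_def using rep_abs_lsq_AE[of f] rep_abs_lsq_AE[of g]
  by (intro integral_cong_AE) (auto dest!: L2_measurable)

instance
proof
  fix u v t :: lsq and c d :: real
  obtain f where f [simp]: "f \<in> L2" "u = abs_lsq f" by (rule lsq_cases)
  obtain g where g [simp]: "g \<in> L2" "v = abs_lsq g" by (rule lsq_cases)
  obtain h where h [simp]: "h \<in> L2" "t = abs_lsq h" by (rule lsq_cases)
  note [simp] = L2_add L2_scaleR L2_minus L2_inner_integrable L2_diff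
  show "u + v + t = u + (v + t)" "u + v = v + u" "0 + u = u" "- u + u = 0" "u - v = u + - v"
    "c *\<^sub>R (u + v) = c *\<^sub>R u + c *\<^sub>R v" "(c + d) *\<^sub>R u = c *\<^sub>R u + d *\<^sub>R u"
    "c *\<^sub>R d *\<^sub>R u = (c * d) *\<^sub>R u" "1 *\<^sub>R u = u"
    by (simp_all add: zero_lsq_def abs_lsq_eq_iff algebra_simps
        flip: abs_lsq_add abs_lsq_minus abs_lsq_scaleR abs_lsq_diff)
  show "inner u v = inner v u" by (simp add: inner_abs_lsq inner_commute)
  show "inner (u + v) t = inner u t + inner v t"
    by (simp add: inner_abs_lsq inner_add_left flip: abs_lsq_add)
  show "inner (c *\<^sub>R u) v = c * inner u v"
    by (simp add: inner_abs_lsq flip: abs_lsq_scaleR)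
  show "0 \<le> inner u u" by (simp add: inner_abs_lsq)
  have "inner u u = 0 \<longleftrightarrow> (AE x in lborel. inner (f x) (f x) = 0)"
    by (simp add: inner_abs_lsq integral_nonneg_eq_0_iff_AE del: inner_eq_zero_iff)
  then show "inner u u = 0 \<longleftrightarrow> u = 0"
    by (simp add: zero_lsq_def abs_lsq_eq_iff L2_eq_def)
qed (simp_all add: norm_lsq_def sgn_lsq_def dist_lsq_def uniformity_lsq_def open_lsq_def)

end

section \<open>Norms of classes and completeness\<close>

lemma norm_abs_lsq: "f \<in> L2 \<Longrightarrow> (norm (abs_lsq f))\<^sup>2 = (\<integral>x. (norm (f x))\<^sup>2 \<partial>lborel)"
  by (simp add: power2_norm_eq_inner inner_abs_lsq)

lemma L2_norm_eq: "f \<in> L2 \<Longrightarrow> L2_norm f = norm (abs_lsq f)"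
  by (simp add: L2_norm_def flip: norm_abs_lsq)

lemma nn_integral_norm_abs_lsq:
  "f \<in> L2 \<Longrightarrow> (\<integral>\<^sup>+x. ennreal ((norm (f x))\<^sup>2) \<partial>lborel) = ennreal ((norm (abs_lsq f))\<^sup>2)"
  by (simp add: norm_abs_lsq L2_iff nn_integral_eq_integral)

text \<open>Membership and norm bound come together from the nonnegative integral, the form in which
  Fatou's lemma and translation invariance deliver their estimates.\<close>

lemma L2_if_nn_integral:
  assumes [measurable]: "f \<in> borel_measurable borel"
    and le: "(\<integral>\<^sup>+x. ennreal ((norm (f x))\<^sup>2) \<partial>lborel) \<le> ennreal (c\<^sup>2)" and c: "0 \<le> c"
  shows "f \<in> L2" "norm (abs_lsq f) \<le> c"
proof -
  have "integrable lborel (\<lambda>x. (norm (f x))\<^sup>2)"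
    using le by (intro integrableI_bounded) (auto simp: le_less_trans[OF le])
  then show f: "f \<in> L2" by (simp add: L2_iff)
  have "(norm (abs_lsq f))\<^sup>2 \<le> c\<^sup>2"
    using le by (simp add: nn_integral_norm_abs_lsq[OF f])
  then show "norm (abs_lsq f) \<le> c" using c by (simp add: power2_le_iff_abs_le)
qed

text \<open>Riesz-Fischer for geometrically decreasing steps: such a sequence converges almost
  everywhere, and Fatou's lemma turns the pointwise limit into a norm limit.\<close>

lemma lsq_sequence_limit:
  fixes f :: "nat \<Rightarrow> field2"
  assumes f: "\<And>n. f n \<in> L2" and step: "\<And>n. norm (abs_lsq (f (Suc n)) - abs_lsq (f n)) \<le> (1/2) ^ n"
  shows "\<exists>g\<in>L2. (\<lambda>n. abs_lsq (f n)) \<longlonglongrightarrow> abs_lsq g"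
proof -
  note [measurable] = L2_measurable[OF f]
  define d where "d n x = f (Suc n) x - f n x" for n x
  have d: "d n \<in> L2" "norm (abs_lsq (d n)) \<le> (1/2) ^ n" for n
    using f[of n] f[of "Suc n"] step[of n]
    by (simp_all add: d_def[abs_def] L2_diff abs_lsq_diff)
  note [measurable] = L2_measurable[OF d(1)]
  \<comment> \<open>The weights 2^n leave enough decay in |d n x| for pointwise summability, while
    the integral is at most the sum of 2^n * 4^(-n), which is 2.\<close>
  have "(\<integral>\<^sup>+x. (\<Sum>n. ennreal (2 ^ n * (norm (d n x))\<^sup>2)) \<partial>lborel)
      = (\<Sum>n. ennreal (2 ^ n) * ennreal ((norm (abs_lsq (d n)))\<^sup>2))"
    by (subst nn_integral_suminf) (simp_all add: ennreal_mult nn_integral_cmult nn_integral_norm_abs_lsq[OF d(1)])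
  also have "\<dots> \<le> (\<Sum>n. ennreal ((1/2) ^ n))"
  proof (rule suminf_le)
    fix n
    have "2 ^ n * (norm (abs_lsq (d n)))\<^sup>2 \<le> 2 ^ n * ((1/2) ^ n)\<^sup>2"
      by (intro mult_left_mono power_mono d) auto
    also have "\<dots> = (1/2) ^ n" by (simp add: power2_eq_square power_divide field_simps flip: power_mult_distrib)
    finally show "ennreal (2 ^ n) * ennreal ((norm (abs_lsq (d n)))\<^sup>2) \<le> ennreal ((1/2) ^ n)"
      by (simp flip: ennreal_mult)
  qed auto
  also have "\<dots> = ennreal 2"
    by (subst suminf_ennreal_eq[where x = 2]) (use geometric_sums[of "1/2::real"] in auto)
  finally have "(\<integral>\<^sup>+x. (\<Sum>n. ennreal (2 ^ n * (norm (d n x))\<^sup>2)) \<partial>lborel) \<noteq> \<infinity>"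
    by (metis ennreal_less_top infinity_ennreal_def leD)
  then have "AE x in lborel. (\<Sum>n. ennreal (2 ^ n * (norm (d n x))\<^sup>2)) \<noteq> \<infinity>"
    by (rule nn_integral_noteq_infinite[rotated]) measurable
  then have conv: "AE x in lborel. convergent (\<lambda>n. f n x)"
  proof eventually_elim
    case (elim x)
    define a where "a n = 2 ^ n * (norm (d n x))\<^sup>2" for n
    have sa: "summable a"
      using elim by (intro summable_suminf_not_top) (auto simp: a_def)
    have "summable (\<lambda>n. norm (d n x))"
    proof (rule summable_comparison_test')
      show "summable (\<lambda>n. a n + (1/2) ^ n)"
        by (intro summable_add sa summable_geometric) auto
      fix n :: nat assume "n \<ge> 0"
      define s where "s = norm (d n x)"
      \<comment> \<open>Arithmetic-geometric mean inequality: 2 s is at most 2^n s^2 + (1/2)^n,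
        since the two weights multiply to 1.\<close>
      have "0 \<le> (sqrt (2 ^ n) * s - sqrt ((1/2) ^ n))\<^sup>2" by simp
      also have "\<dots> = 2 ^ n * s\<^sup>2 + (1/2) ^ n - 2 * s * sqrt (2 ^ n * (1/2) ^ n)"
        by (simp add: power2_diff power_mult_distrib real_sqrt_mult)
      also have "sqrt (2 ^ n * (1/2) ^ n) = 1" by (simp flip: power_mult_distrib)
      finally have "s \<le> a n + (1/2) ^ n"
        unfolding a_def s_def using norm_ge_zero[of "d n x"] by linarith
      then show "norm (norm (d n x)) \<le> a n + (1/2) ^ n" by (simp add: s_def)
    qed
    then have "summable (\<lambda>n. d n x)" by (rule summable_norm_cancel)
    then have "convergent (\<lambda>n. \<Sum>k<n. d k x)" by (simp add: summable_iff_convergent)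
    then have "convergent (\<lambda>n. (\<Sum>k<n. d k x) + f 0 x)"
      by (intro convergent_add convergent_const)
    moreover have "(\<Sum>k<n. d k x) + f 0 x = f n x" for n
      by (simp add: d_def sum_lessThan_telescope[of "\<lambda>k. f k x"])
    ultimately show ?case by simp
  qed
  define g where "g x = lim (\<lambda>n. f n x)" for x
  have [measurable]: "g \<in> borel_measurable borel" unfolding g_def by measurable
  have AE_g: "AE x in lborel. (\<lambda>n. f n x) \<longlonglongrightarrow> g x"
    using conv by eventually_elim (simp add: g_def convergent_LIMSEQ_iff)
  have dist: "norm (abs_lsq (f (n + k)) - abs_lsq (f n)) \<le> 2 * (1/2) ^ n" for n k
  proof -
    have "norm (abs_lsq (f (n + k)) - abs_lsq (f n)) \<le> (2 - 2 * (1/2) ^ k) * (1/2) ^ n"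
    proof (induction k)
      case (Suc k)
      have "norm (abs_lsq (f (n + Suc k)) - abs_lsq (f n))
          \<le> norm (abs_lsq (f (Suc (n + k))) - abs_lsq (f (n + k))) + norm (abs_lsq (f (n + k)) - abs_lsq (f n))"
        using norm_triangle_ineq[of "abs_lsq (f (Suc (n + k))) - abs_lsq (f (n + k))" "abs_lsq (f (n + k)) - abs_lsq (f n)"]
        by simp
      also have "\<dots> \<le> (1/2) ^ (n + k) + (2 - 2 * (1/2) ^ k) * (1/2) ^ n"
        by (intro add_mono step Suc.IH)
      finally show ?case by (simp add: power_add algebra_simps)
    qed simp
    also have "\<dots> \<le> 2 * (1/2) ^ n" by (intro mult_right_mono) auto
    finally show ?thesis .
  qed
  have "(\<integral>\<^sup>+x. ennreal ((norm (g x - f n x))\<^sup>2) \<partial>lborel) \<le> ennreal ((2 * (1/2) ^ n)\<^sup>2)" for n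
  proof -
    have "(\<integral>\<^sup>+x. ennreal ((norm (g x - f n x))\<^sup>2) \<partial>lborel)
        = (\<integral>\<^sup>+x. liminf (\<lambda>k. ennreal ((norm (f (n + k) x - f n x))\<^sup>2)) \<partial>lborel)"
    proof (rule nn_integral_cong_AE)
      show "AE x in lborel. ennreal ((norm (g x - f n x))\<^sup>2)
          = liminf (\<lambda>k. ennreal ((norm (f (n + k) x - f n x))\<^sup>2))"
        using AE_g
      proof eventually_elim
        case (elim x)
        have "(\<lambda>k. f (k + n) x) \<longlonglongrightarrow> g x" using elim by (rule LIMSEQ_ignore_initial_segment)
        then have "(\<lambda>k. ennreal ((norm (f (n + k) x - f n x))\<^sup>2)) \<longlonglongrightarrow> ennreal ((norm (g x - f n x))\<^sup>2)"
          unfolding add.commute[of n] by (intro tendsto_intros tendsto_ennrealI) auto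
        then show ?case by (rule lim_imp_Liminf[OF sequentially_bot, symmetric])
      qed
    qed
    also have "\<dots> \<le> liminf (\<lambda>k. \<integral>\<^sup>+x. ennreal ((norm (f (n + k) x - f n x))\<^sup>2) \<partial>lborel)"
      by (rule nn_integral_liminf) measurable
    also have "\<dots> \<le> liminf (\<lambda>k. ennreal ((2 * (1/2) ^ n)\<^sup>2))"
    proof (rule Liminf_mono, rule always_eventually, rule allI)
      fix k
      have "(\<integral>\<^sup>+x. ennreal ((norm (f (n + k) x - f n x))\<^sup>2) \<partial>lborel)
          = ennreal ((norm (abs_lsq (f (n + k)) - abs_lsq (f n)))\<^sup>2)"
        using f by (simp add: nn_integral_norm_abs_lsq L2_diff abs_lsq_diff)
      also have "\<dots> \<le> ennreal ((2 * (1/2) ^ n)\<^sup>2)"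
        by (intro ennreal_leI power_mono dist) simp
      finally show "(\<integral>\<^sup>+x. ennreal ((norm (f (n + k) x - f n x))\<^sup>2) \<partial>lborel) \<le> ennreal ((2 * (1/2) ^ n)\<^sup>2)" .
    qed
    also have "\<dots> = ennreal ((2 * (1/2) ^ n)\<^sup>2)" by (simp add: Liminf_const)
    finally show ?thesis .
  qed
  from L2_if_nn_integral[OF _ this]
  have gf: "(\<lambda>x. g x - f n x) \<in> L2" "norm (abs_lsq (\<lambda>x. g x - f n x)) \<le> 2 * (1/2) ^ n" for n
    by auto
  have g: "g \<in> L2" using L2_add[OF gf(1) f, of 0 0] by simp
  have "(\<lambda>n. abs_lsq (f n)) \<longlonglongrightarrow> abs_lsq g"
  proof (rule LIM_zero_cancel, rule Lim_null_comparison)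
    show "\<forall>\<^sub>F n in sequentially. norm (abs_lsq (f n) - abs_lsq g) \<le> 2 * (1/2) ^ n"
      using gf(2) by (auto simp: abs_lsq_diff f g norm_minus_commute)
    show "(\<lambda>n. 2 * (1/2) ^ n :: real) \<longlonglongrightarrow> 0"
      by (intro tendsto_mult_right_zero LIMSEQ_power_zero) simp
  qed
  with g show ?thesis by blast
qed

instance lsq :: banach
proof
  fix X :: "nat \<Rightarrow> lsq" assume X: "Cauchy X"
  have "\<exists>N. \<forall>m\<ge>N. \<forall>k\<ge>N. dist (X m) (X k) < (1/2) ^ n" for n
    using X by (rule metric_CauchyD) simp
  then obtain N where N: "\<And>n m k. m \<ge> N n \<Longrightarrow> k \<ge> N n \<Longrightarrow> dist (X m) (X k) < (1/2) ^ n"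
    by metis
  \<comment> \<open>A strictly increasing sequence that dominates N, so that consecutive terms along
    it differ by less than (1/2)^n.\<close>
  define s where "s n = (\<Sum>k\<le>n. Suc (N k))" for n
  have "strict_mono s" by (rule strict_mono_Suc_iff[THEN iffD2]) (simp add: s_def)
  have sN: "s n \<ge> N n" for n
    unfolding s_def by (rule order_trans[OF _ member_le_sum[of n]]) auto
  have "norm (X (s (Suc n)) - X (s n)) \<le> (1/2) ^ n" for n
    using N[of n "s (Suc n)" "s n"] sN[of n] \<open>strict_mono s\<close>
    by (simp add: dist_norm less_imp_le order_trans[OF sN] strict_mono_less_eq)
  then obtain g where "(\<lambda>n. X (s n)) \<longlonglongrightarrow> abs_lsq g"
    using lsq_sequence_limit[of "\<lambda>n. rep_lsq (X (s n))"] by auto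
  then have "(X \<circ> s) \<longlonglongrightarrow> abs_lsq g" by (simp add: o_def)
  then show "convergent X"
    using Cauchy_converges_subseq[OF X \<open>strict_mono s\<close>] convergentI by blast
qed

section \<open>The complex structure on classes\<close>

lemma vec_scale_add: "(c::complex) *s (a + b :: complex^2) = c *s a + c *s b"
  by (simp add: field_eq_iff algebra_simps)

instantiation lsq :: complex_hilbert
begin

definition "imul u = abs_lsq (\<lambda>x. \<i> *s rep_lsq u x)"

lemma abs_lsq_imul: "f \<in> L2 \<Longrightarrow> abs_lsq (\<lambda>x. \<i> *s f x) = imul (abs_lsq f)"
  using rep_abs_lsq_AE[of f]
  by (auto simp: imul_lsq_def abs_lsq_eq_iff L2_vec_scale L2_eq_def)

instance
proof
  fix u v :: lsq and c :: real
  obtain f where f [simp]: "f \<in> L2" "u = abs_lsq f" by (rule lsq_cases)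
  obtain g where g [simp]: "g \<in> L2" "v = abs_lsq g" by (rule lsq_cases)
  note [simp] = L2_add L2_scaleR L2_minus L2_vec_scale
  show "imul (u + v) = imul u + imul v"
    by (simp add: vec_scale_add flip: abs_lsq_add abs_lsq_imul)
  have "\<i> *s (c *\<^sub>R a) = c *\<^sub>R (\<i> *s a)" for a :: "complex^2"
    by (simp add: field_eq_iff)
  then show "imul (c *\<^sub>R u) = c *\<^sub>R imul u"
    by (simp flip: abs_lsq_scaleR abs_lsq_imul)
  have "\<i> *s (\<i> *s a) = - a" for a :: "complex^2"
    by (simp add: field_eq_iff)
  then show "imul (imul u) = - u"
    by (simp flip: abs_lsq_minus abs_lsq_imul)
  have "inner (\<i> *s a) (\<i> *s b) = inner a b" for a b :: "complex^2"
    by (simp add: inner_vec_def inner_complex_def algebra_simps)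
  then show "inner (imul u) (imul v) = inner u v"
    by (simp add: inner_abs_lsq flip: abs_lsq_imul)
qed

end

lemma abs_lsq_vec_scale: "f \<in> L2 \<Longrightarrow> abs_lsq (\<lambda>x. c *s f x) = c *\<^sub>C abs_lsq f"
proof -
  assume f: "f \<in> L2"
  have "(\<lambda>x. c *s f x) = (\<lambda>x. Re c *\<^sub>R f x + Im c *\<^sub>R (\<i> *s f x))"
    by (simp add: fun_eq_iff field_eq_iff complex_eq_iff)
  then show ?thesis
    using f by (simp add: scaleC_def abs_lsq_add L2_scaleR L2_vec_scale abs_lsq_scaleR abs_lsq_imul)
qed

lemma abs_lsq_sum: "(\<And>k. k \<in> A \<Longrightarrow> f k \<in> L2) \<Longrightarrow> abs_lsq (\<lambda>x. \<Sum>k\<in>A. f k x) = (\<Sum>k\<in>A. abs_lsq (f k))"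
  by (induction A rule: infinite_finite_induct) (simp_all add: abs_lsq_add L2_sum flip: zero_lsq_def)

lemma herm_eq: "herm a b = Complex (inner a b) (inner a (\<i> *s b))"
  by (simp add: herm_def inner_vec_def complex_eq_iff inner_complex_def sum_2 algebra_simps)

lemma herm_integrable: "f \<in> L2 \<Longrightarrow> g \<in> L2 \<Longrightarrow> integrable lborel (\<lambda>x. herm (f x) (g x))"
  unfolding herm_eq Complex_eq
  by (intro Bochner_Integration.integrable_add integrable_mult_right)
    (simp_all add: L2_inner_integrable L2_vec_scale integrable_of_real)

lemma L2_inner_eq: "f \<in> L2 \<Longrightarrow> g \<in> L2 \<Longrightarrow> L2_inner f g = cinner (abs_lsq f) (abs_lsq g)"
proof -
  assume fg: "f \<in> L2" "g \<in> L2"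
  have "Re (L2_inner f g) = (\<integral>x. Re (herm (f x) (g x)) \<partial>lborel)" "Im (L2_inner f g) = (\<integral>x. Im (herm (f x) (g x)) \<partial>lborel)"
    using herm_integrable[OF fg] by (simp_all add: L2_inner_def)
  then show ?thesis using fg
    by (simp add: herm_eq cinner_def complex_eq_iff inner_abs_lsq L2_vec_scale flip: abs_lsq_imul)
qed

section \<open>Test functions\<close>

lemma Ck_continuous: "Ck k f \<Longrightarrow> continuous_on UNIV f"
  by (cases k) (auto intro!: continuous_at_imp_continuous_on differentiable_imp_continuous_within)

lemma Ck_SucD: "Ck (Suc k) f \<Longrightarrow> Ck k f"
proof (induction k arbitrary: f)
  case 0
  have "continuous_on UNIV f" using 0 by (rule Ck_continuous)
  then show ?case by simp
qed simp

lemma partial_eqI: "(f has_derivative f') (at x) \<Longrightarrow> partial i f x = f' (axis i 1)"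
  unfolding partial_def by (metis frechet_derivative_at)

lemma partial_const: "partial i (\<lambda>x. c) = (\<lambda>x. 0)"
  by (rule ext, rule partial_eqI) simp

lemma Ck_const: "Ck k (\<lambda>x. c)"
  by (induction k arbitrary: c) (auto simp: partial_const)

lemma Ck_add: "Ck k f \<Longrightarrow> Ck k g \<Longrightarrow> Ck k (\<lambda>x. f x + g x)"
proof (induction k arbitrary: f g)
  case (Suc k)
  have "partial i (\<lambda>x. f x + g x) = (\<lambda>x. partial i f x + partial i g x)" for i
  proof (rule ext, rule partial_eqI[THEN trans])
    fix x
    show "((\<lambda>x. f x + g x) has_derivative
        (\<lambda>h. frechet_derivative f (at x) h + frechet_derivative g (at x) h)) (at x)"
      using Suc.prems by (intro has_derivative_add) (simp_all flip: frechet_derivative_works)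
  qed (simp add: partial_def)
  with Suc show ?case by auto
qed (auto intro: continuous_intros)

lemma Ck_mult: "Ck k f \<Longrightarrow> Ck k g \<Longrightarrow> Ck k (\<lambda>x. f x * g x)"
proof (induction k arbitrary: f g)
  case (Suc k)
  have "partial i (\<lambda>x. f x * g x) = (\<lambda>x. f x * partial i g x + partial i f x * g x)" for i
  proof (rule ext, rule partial_eqI[THEN trans])
    fix x
    show "((\<lambda>x. f x * g x) has_derivative
        (\<lambda>h. f x * frechet_derivative g (at x) h + frechet_derivative f (at x) h * g x)) (at x)"
      using Suc.prems by (intro has_derivative_mult) (simp_all flip: frechet_derivative_works)
  qed (simp add: partial_def)
  with Suc Ck_SucD[of k f] Ck_SucD[of k g] show ?case by (auto intro!: Ck_add)
qed (auto intro: continuous_intros)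

lemma Ck_prod: "finite A \<Longrightarrow> (\<And>i. i \<in> A \<Longrightarrow> Ck k (f i)) \<Longrightarrow> Ck k (\<lambda>x. \<Prod>i\<in>A. f i x)"
  by (induction A rule: finite_induct) (auto intro: Ck_mult Ck_const)

text \<open>All derivatives are exhibited as one sequence, so that the induction on the order k can
  run over its members.\<close>

definition smooth_real :: "(real \<Rightarrow> real) \<Rightarrow> bool" where
  "smooth_real h \<longleftrightarrow> (\<exists>D :: nat \<Rightarrow> real \<Rightarrow> real. D 0 = h \<and> (\<forall>n x. (D n has_real_derivative D (Suc n) x) (at x)))"

lemma smooth_real_Ck:
  assumes "smooth_real h"
  shows "Ck k (\<lambda>x. h (x $ i))"
proof -
  obtain D where D: "D 0 = h" "\<And>n x. (D n has_real_derivative D (Suc n) x) (at x)"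
    using assms unfolding smooth_real_def by blast
  have der: "((\<lambda>x. D n (x $ i)) has_derivative (\<lambda>v. v $ i * D (Suc n) (x $ i))) (at x)" for n and x :: "real^2"
  proof -
    have "((\<lambda>x. x $ i) has_derivative (\<lambda>v. v $ i)) (at x)"
      by (intro bounded_linear_imp_has_derivative bounded_linear_vec_nth)
    from has_derivative_compose[OF this D(2)[unfolded has_field_derivative_def]]
    show ?thesis by (simp add: mult.commute)
  qed
  have "Ck k (\<lambda>x. D n (x $ i))" for n
  proof (induction k arbitrary: n)
    case 0
    then show ?case
      using D(2)[of n] by (auto intro!: continuous_at_imp_continuous_on has_derivative_continuous[OF der])
  next
    case (Suc k)
    have "partial j (\<lambda>x. D n (x $ i)) = (\<lambda>x. axis j 1 $ i * D (Suc n) (x $ i))" for j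
      by (rule ext, rule partial_eqI[OF der])
    moreover have "(\<lambda>x. D n (x $ i)) differentiable (at x)" for x
      using der by (rule differentiableI)
    ultimately show ?case using Suc by (auto intro!: Ck_mult Ck_const)
  qed
  from this[of 0] D(1) show ?thesis by simp
qed

lemma smooth_real_affine:
  assumes "smooth_real h"
  shows "smooth_real (\<lambda>t. h (c * t + d))"
proof -
  obtain D where D: "D 0 = h" "\<And>n x. (D n has_real_derivative D (Suc n) x) (at x)"
    using assms unfolding smooth_real_def by blast
  have "((\<lambda>t. c ^ n * D n (c * t + d)) has_real_derivative c ^ Suc n * D (Suc n) (c * t + d)) (at t)" for n t
  proof -
    have "((\<lambda>t. D n (c * t + d)) has_real_derivative D (Suc n) (c * t + d) * c) (at t)"
      by (rule DERIV_chain2[where f = "D n" and g = "\<lambda>t. c * t + d", OF D(2)])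
        (auto intro!: derivative_eq_intros)
    then show ?thesis by (auto intro!: derivative_eq_intros)
  qed
  then show ?thesis
    unfolding smooth_real_def using D(1) by (intro exI[of _ "\<lambda>n t. c ^ n * D n (c * t + d)"]) auto
qed

section \<open>A smooth function flat at 0, and bumps on boxes\<close>

definition flat_exp :: "real \<Rightarrow> real" where
  "flat_exp t = (if t > 0 then exp (- (1 / t)) else 0)"

lemma poly_exp_decay: "((\<lambda>s::real. poly p s * exp (- s)) \<longlongrightarrow> 0) at_top"
proof -
  have "((\<lambda>s. \<Sum>i\<le>degree p. coeff p i * (s ^ i / exp s)) \<longlongrightarrow> (\<Sum>i\<le>degree p. coeff p i * 0)) at_top"
    by (intro tendsto_sum tendsto_mult tendsto_const tendsto_power_div_exp_0)
  then show ?thesis by (simp add: poly_altdef exp_minus divide_inverse sum_distrib_right mult.assoc)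
qed

lemma smooth_real_flat_exp: "smooth_real flat_exp"
proof -
  \<comment> \<open>With s = 1/t, differentiating p(s) exp(-s) in t gives s^2 (p(s) - p'(s))
    exp(-s), which is the recursion.\<close>
  define p where "p = rec_nat [:1::real:] (\<lambda>_ q. [:0, 0, 1:] * (q - pderiv q))"
  define D where "D n t = (if t > 0 then poly (p n) (1 / t) * exp (- (1 / t)) else 0)" for n t
  have p_Suc: "p (Suc n) = [:0, 0, 1:] * (p n - pderiv (p n))" for n by (simp add: p_def)
  have "(D n has_real_derivative D (Suc n) t) (at t)" for n t
  proof -
    consider "t > 0" | "t < 0" | "t = 0" by linarith
    then show ?thesis
    proof cases
      case 1
      have *: "((\<lambda>t. poly (p n) (1 / t) * exp (- (1 / t))) has_real_derivative D (Suc n) t) (at t)"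
        using 1 by (auto intro!: derivative_eq_intros DERIV_chain2[OF poly_DERIV]
            simp: D_def p_Suc field_simps power2_eq_square)
      show ?thesis
        by (rule has_field_derivative_transform_within_open[OF * open_greaterThan, of 0])
          (use 1 in \<open>auto simp: D_def\<close>)
    next
      case 2
      show ?thesis
        by (rule has_field_derivative_transform_within_open[of "\<lambda>_. 0" _ _ "{..<0}"])
          (use 2 in \<open>auto simp: D_def\<close>)
    next
      case 3
      \<comment> \<open>The difference quotient at 0 is s p(s) exp(-s) with s = 1/t;
        \<open>pCons 0\<close> accounts for the extra factor s.\<close>
      have "((\<lambda>t. poly (pCons 0 (p n)) (inverse t) * exp (- inverse t)) \<longlongrightarrow> 0) (at_right 0)"
        by (rule filterlim_compose[OF poly_exp_decay filterlim_inverse_at_top_right])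
      then have r: "((\<lambda>t. D n t / t) \<longlongrightarrow> 0) (at_right 0)"
        by (rule Lim_transform_eventually) (auto simp: eventually_at_right_field D_def divide_inverse intro!: exI[of _ 1])
      have l: "((\<lambda>t. D n t / t) \<longlongrightarrow> 0) (at_left 0)"
        by (rule Lim_transform_eventually[OF tendsto_const])
          (auto simp: eventually_at_left_field D_def intro!: exI[of _ "-1"])
      have "((\<lambda>t. D n t / t) \<longlongrightarrow> 0) (at 0)"
        using l r by (simp add: filterlim_split_at)
      then show ?thesis using 3 by (simp add: has_field_derivative_iff D_def)
    qed
  qed
  moreover have "D 0 = flat_exp" by (auto simp: D_def p_def flat_exp_def fun_eq_iff)
  ultimately show ?thesis unfolding smooth_real_def by blast
qed

text \<open>Smooth and zero outside the box for every n; the factor \<open>Suc n\<close> steepens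
  the profile, so that the bumps converge pointwise to the indicator of the box.\<close>

definition bump :: "real^2 \<Rightarrow> real^2 \<Rightarrow> nat \<Rightarrow> real^2 \<Rightarrow> real" where
  "bump a b n x = (\<Prod>i\<in>UNIV. flat_exp (real (Suc n) * (x $ i - a $ i)) * flat_exp (real (Suc n) * (b $ i - x $ i)))"

lemma flat_exp_bounds: "0 \<le> flat_exp t" "flat_exp t \<le> 1"
  by (auto simp: flat_exp_def)

lemma bump_bounds: "0 \<le> bump a b n x" "bump a b n x \<le> 1"
  unfolding bump_def by (auto intro!: prod_nonneg prod_le_1 mult_le_one simp: flat_exp_bounds)

lemma bump_outside: "x \<notin> box a b \<Longrightarrow> bump a b n x = 0"
proof -
  assume "x \<notin> box a b"
  then obtain i where "x $ i \<le> a $ i \<or> b $ i \<le> x $ i"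
    by (auto simp: mem_box_cart not_less)
  then have "flat_exp (real (Suc n) * (x $ i - a $ i)) * flat_exp (real (Suc n) * (b $ i - x $ i)) = 0"
    by (auto simp: flat_exp_def zero_less_mult_iff)
  then show ?thesis unfolding bump_def by (intro prod_zero) auto
qed

lemma test_function_bump: "test_function (bump a b n)"
proof -
  have "Ck k (bump a b n)" for k
    unfolding bump_def
  proof (intro Ck_prod Ck_mult)
    fix i :: 2
    show "Ck k (\<lambda>x. flat_exp (real (Suc n) * (x $ i - a $ i)))"
      using smooth_real_Ck[OF smooth_real_affine[OF smooth_real_flat_exp, of "real (Suc n)" "- real (Suc n) * a $ i"]]
      by (simp add: algebra_simps)
    show "Ck k (\<lambda>x. flat_exp (real (Suc n) * (b $ i - x $ i)))"
      using smooth_real_Ck[OF smooth_real_affine[OF smooth_real_flat_exp, of "- real (Suc n)" "real (Suc n) * b $ i"]]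
      by (simp add: algebra_simps)
  qed simp
  moreover have "bounded {x. bump a b n x \<noteq> 0}"
    by (rule bounded_subset[OF bounded_box[of a b]]) (use bump_outside in blast)
  ultimately show ?thesis by (simp add: test_function_def compact_closure)
qed

lemma bump_tendsto: "(\<lambda>n. bump a b n x) \<longlonglongrightarrow> indicat_real (box a b) x"
proof (cases "x \<in> box a b")
  case True
  have "(\<lambda>n. flat_exp (real (Suc n) * t)) \<longlonglongrightarrow> 1" if "t > 0" for t
  proof -
    have "(\<lambda>n. exp (- (inverse (real (Suc n)) * inverse t))) \<longlonglongrightarrow> exp (- (0 * inverse t))"
      by (intro tendsto_intros LIMSEQ_inverse_real_of_nat)
    then show ?thesis using that by (simp add: flat_exp_def divide_inverse mult.commute)
  qed
  then have "(\<lambda>n. bump a b n x) \<longlonglongrightarrow> (\<Prod>i\<in>(UNIV::2 set). 1 * 1)"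
    unfolding bump_def using True by (intro tendsto_prod tendsto_mult) (auto simp: mem_box_cart)
  with True show ?thesis by simp
qed (simp add: bump_outside)

section \<open>Bounds, integrability and density of test functions\<close>

lemma test_functionD:
  assumes "test_function \<phi>"
  shows "continuous_on UNIV \<phi>" "\<phi> differentiable (at x)" "test_function (partial i \<phi>)"
    "\<phi> \<in> borel_measurable borel"
proof -
  have Ck: "Ck k \<phi>" for k
    using assms by (simp add: test_function_def)
  have cpt: "compact (closure {x. \<phi> x \<noteq> 0})"
    using assms by (simp add: test_function_def)
  show c: "continuous_on UNIV \<phi>" using Ck[of 0] by simp
  then show "\<phi> \<in> borel_measurable borel" by (rule borel_measurable_continuous_onI)
  show "\<phi> differentiable (at x)" using Ck[of 1] by simp
  have "partial i \<phi> x = 0" if "x \<notin> closure {x. \<phi> x \<noteq> 0}" for x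
  proof (rule partial_eqI[THEN trans])
    show "(\<phi> has_derivative (\<lambda>_. 0)) (at x)"
      by (rule has_derivative_transform_within_open[of "\<lambda>_. 0" _ _ _ "- closure {x. \<phi> x \<noteq> 0}"])
        (use that closure_subset[of "{x. \<phi> x \<noteq> 0}"] in auto)
  qed simp
  then have "closure {x. partial i \<phi> x \<noteq> 0} \<subseteq> closure {x. \<phi> x \<noteq> 0}"
    by (intro closure_minimal) auto
  then have "compact (closure {x. partial i \<phi> x \<noteq> 0})"
    using cpt bounded_subset closed_closure unfolding compact_eq_bounded_closed by blast
  moreover have "Ck k (partial i \<phi>)" for k using Ck[of "Suc k"] by simp
  ultimately show "test_function (partial i \<phi>)" by (simp add: test_function_def)
qed

lemma test_function_bounded:
  assumes "test_function \<phi>"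
  obtains M r where "M \<ge> 0" "r \<ge> 0" "\<And>x. \<bar>\<phi> x\<bar> \<le> M * indicat_real (cball 0 r) x"
proof -
  let ?K = "closure {x. \<phi> x \<noteq> 0}"
  have K: "compact ?K" using assms by (simp add: test_function_def)
  then obtain r where r: "\<And>x. x \<in> ?K \<Longrightarrow> norm x \<le> r"
    using compact_imp_bounded bounded_iff by metis
  have "bounded (\<phi> ` ?K)"
    by (intro compact_imp_bounded compact_continuous_image K continuous_on_subset[OF test_functionD(1)[OF assms]]) auto
  then obtain M where M: "\<And>x. x \<in> ?K \<Longrightarrow> \<bar>\<phi> x\<bar> \<le> M"
    by (auto simp: bounded_iff)
  have *: "x \<in> ?K" if "\<phi> x \<noteq> 0" for x
    using that by (intro subsetD[OF closure_subset]) simp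
  have "\<bar>\<phi> x\<bar> \<le> max M 0 * indicat_real (cball 0 (max r 0)) x" for x
    using r[OF *] M[OF *] by (cases "\<phi> x = 0") (auto simp: indicator_def le_max_iff_disj)
  then show ?thesis by (intro that[of "max M 0" "max r 0"]) auto
qed

lemma L2_bounded_support:
  fixes f :: field2
  assumes [measurable]: "f \<in> borel_measurable borel" and "\<And>x. norm (f x) \<le> M * indicat_real (cball 0 r) x"
  shows "f \<in> L2"
proof -
  have "integrable lborel (\<lambda>x. (norm (f x))\<^sup>2)"
  proof (rule Bochner_Integration.integrable_bound)
    show "integrable lborel (\<lambda>x. M\<^sup>2 * indicat_real (cball 0 r) x :: real)"
      by (intro integrable_mult_right integrable_real_indicator) (use emeasure_bounded_finite[OF bounded_cball] in auto)
    show "AE x in lborel. norm ((norm (f x))\<^sup>2) \<le> norm (M\<^sup>2 * indicat_real (cball 0 r) x)"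
    proof (rule AE_I2)
      fix x
      have "(norm (f x))\<^sup>2 \<le> (M * indicat_real (cball 0 r) x)\<^sup>2"
        by (rule power_mono[OF assms(2)]) simp
      then show "norm ((norm (f x))\<^sup>2) \<le> norm (M\<^sup>2 * indicat_real (cball 0 r) x)"
        by (auto simp: indicator_def split: if_splits)
    qed
  qed simp
  then show ?thesis by (simp add: L2_iff)
qed

lemma test_function_L2:
  assumes "test_function \<phi>" shows "(\<lambda>x. \<phi> x *\<^sub>R e) \<in> L2"
proof -
  obtain M r where M: "M \<ge> 0" "\<And>x. \<bar>\<phi> x\<bar> \<le> M * indicat_real (cball 0 r) x"
    using test_function_bounded[OF assms] by metis
  show ?thesis
  proof (rule L2_bounded_support[where M = "M * norm e" and r = r])
    show "norm (\<phi> x *\<^sub>R e) \<le> M * norm e * indicat_real (cball 0 r) x" for x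
      using mult_right_mono[OF M(2)[of x] norm_ge_zero[of e]] by (simp add: mult_ac)
  qed (use test_functionD(4)[OF assms] in measurable)
qed

definition test_field :: "(real^2 \<Rightarrow> real) \<Rightarrow> complex^2 \<Rightarrow> lsq" where
  "test_field \<phi> e = abs_lsq (\<lambda>x. \<phi> x *\<^sub>R e)"

lemma inner_test_field:
  "f \<in> L2 \<Longrightarrow> test_function \<phi> \<Longrightarrow> inner (abs_lsq f) (test_field \<phi> e) = (\<integral>x. \<phi> x * inner (f x) e \<partial>lborel)"
  by (simp add: test_field_def inner_abs_lsq test_function_L2)

text \<open>Boxes form an intersection-stable generator, so the measures with the positive and the
  negative part of h as densities agree once they agree on boxes.\<close>

lemma AE_zero_if_box_integrals_zero:
  fixes h :: "real^2 \<Rightarrow> real"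
  assumes [measurable]: "h \<in> borel_measurable borel"
    and int: "\<And>a b. integrable lborel (\<lambda>x. indicat_real (box a b) x * h x)"
    and zero: "\<And>a b. (\<integral>x. indicat_real (box a b) x * h x \<partial>lborel) = 0"
  shows "AE x in lborel. h x = 0"
proof -
  define B where "B N = box (- (\<chi> i. real N)) ((\<chi> i. real N) :: real^2)" for N
  have cover: "\<exists>N. x \<in> B N" for x :: "real^2"
  proof -
    obtain N where "norm x < real N" using reals_Archimedean2 by blast
    then have "\<bar>x $ i\<bar> < real N" for i using component_le_norm_cart[of x i] by linarith
    then have "x \<in> B N" unfolding B_def mem_box_cart by (auto simp: abs_less_iff minus_less_iff)
    then show ?thesis ..
  qed
  have "AE x in lborel. x \<in> B N \<longrightarrow> h x = 0" for N
  proof -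
    \<comment> \<open>Cutting off to a bounded box makes the function integrable on the whole plane,
      hence the two measures finite on the covering boxes.\<close>
    define k where "k x = indicat_real (B N) x * h x" for x
    have [measurable]: "k \<in> borel_measurable borel" unfolding k_def B_def by measurable
    have kbox: "integrable lborel (\<lambda>x. indicat_real (box a b) x * k x)"
      "(\<integral>x. indicat_real (box a b) x * k x \<partial>lborel) = 0" for a b
    proof -
      obtain c d where "box a b \<inter> B N = box c d" unfolding B_def box_Int_box by blast
      then have "(\<lambda>x. indicat_real (box a b) x * k x) = (\<lambda>x. indicat_real (box c d) x * h x)"
        by (simp add: k_def fun_eq_iff flip: mult.assoc indicator_inter_arith)
      then show "integrable lborel (\<lambda>x. indicat_real (box a b) x * k x)"
        "(\<integral>x. indicat_real (box a b) x * k x \<partial>lborel) = 0"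
        using int zero by simp_all
    qed
    have k: "integrable lborel k" using int by (simp add: k_def[abs_def] B_def)
    \<comment> \<open>\<open>ennreal\<close> sends negative values to 0, so these densities are the
      positive and the negative part of k.\<close>
    let ?P = "density lborel (\<lambda>x. ennreal (k x))" and ?M = "density lborel (\<lambda>x. ennreal (- k x))"
    have eq: "emeasure ?P (box a b) = emeasure ?M (box a b)" for a b
    proof -
      let ?f = "\<lambda>x. indicat_real (box a b) x * k x"
      have p: "integrable lborel (\<lambda>x. max 0 (?f x))"
        by (rule integrable_max[OF integrable_zero kbox(1)])
      have m: "integrable lborel (\<lambda>x. max 0 (- ?f x))"
        by (rule integrable_max[OF integrable_zero integrable_minus[OF kbox(1)]])
      have "(\<integral>x. max 0 (?f x) \<partial>lborel) - (\<integral>x. max 0 (- ?f x) \<partial>lborel) = (\<integral>x. ?f x \<partial>lborel)"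
        by (subst Bochner_Integration.integral_diff[OF p m, symmetric])
          (auto intro!: Bochner_Integration.integral_cong)
      then have "(\<integral>x. max 0 (?f x) \<partial>lborel) = (\<integral>x. max 0 (- ?f x) \<partial>lborel)"
        using kbox(2) by simp
      moreover have "emeasure ?P (box a b) = ennreal (\<integral>x. max 0 (?f x) \<partial>lborel)"
        by (subst emeasure_density, simp, simp, subst nn_integral_eq_integral[OF p, symmetric])
          (auto intro!: nn_integral_cong simp: indicator_def max_def ennreal_neg)
      moreover have "emeasure ?M (box a b) = ennreal (\<integral>x. max 0 (- ?f x) \<partial>lborel)"
        by (subst emeasure_density, simp, simp, subst nn_integral_eq_integral[OF m, symmetric])
          (auto intro!: nn_integral_cong simp: indicator_def max_def ennreal_neg)
      ultimately show ?thesis by simp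
    qed
    have "?P = ?M"
    proof (rule measure_eqI_generator_eq)
      show "Int_stable (range (\<lambda>(a, b). box a b :: (real^2) set))"
        unfolding Int_stable_def by (auto simp: box_Int_box)
      show "emeasure ?P X = emeasure ?M X" if "X \<in> range (\<lambda>(a, b). box a b)" for X
        using that eq by auto
      show "sets ?P = sigma_sets UNIV (range (\<lambda>(a, b). box a b))"
        "sets ?M = sigma_sets UNIV (range (\<lambda>(a, b). box a b))"
        by (simp_all add: borel_eq_box)
      show "range B \<subseteq> range (\<lambda>(a, b). box a b)" by (auto simp: B_def)
      show "(\<Union>i. B i) = UNIV" using cover by auto
      have "(\<integral>\<^sup>+x. ennreal (k x) \<partial>lborel) < \<infinity>"
        by (rule le_less_trans[OF nn_integral_mono, of _ _ "\<lambda>x. ennreal (norm (k x))"])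
          (use k in \<open>auto simp: integrable_iff_bounded intro: ennreal_leI\<close>)
      then show "emeasure ?P (B i) \<noteq> \<infinity>" for i
        using emeasure_space[of ?P "B i"] by (auto simp: emeasure_density top_unique)
    qed auto
    then have "AE x in lborel. ennreal (k x) = ennreal (- k x)"
      by (intro sigma_finite_measure.density_unique[OF sigma_finite_lborel]) auto
    then show ?thesis
    proof eventually_elim
      case (elim x)
      have "k x = 0"
      proof (cases "k x \<ge> 0")
        case True
        then have "ennreal (k x) = 0" using elim by (simp add: ennreal_neg)
        with True show ?thesis by (simp add: ennreal_eq_0_iff)
      next
        case False
        then have "ennreal (- k x) = 0" using elim by (simp add: ennreal_neg)
        with False show ?thesis by (simp add: ennreal_eq_0_iff)
      qed
      then show ?case by (auto simp: k_def)
    qed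
  qed
  then have "AE x in lborel. \<forall>N. x \<in> B N \<longrightarrow> h x = 0" by (intro AE_all_countable[THEN iffD2] allI)
  then show ?thesis by eventually_elim (use cover in blast)
qed

text \<open>Bumps converge boundedly to indicators of boxes, so orthogonality passes to the box
  integrals of each real component.\<close>

lemma lsq_zero_if_orthogonal_to_test_fields:
  assumes "\<And>\<phi> e. test_function \<phi> \<Longrightarrow> inner u (test_field \<phi> e) = 0"
  shows "u = 0"
proof -
  obtain f where f: "f \<in> L2" "u = abs_lsq f" by (rule lsq_cases)
  note [measurable] = L2_measurable[OF f(1)]
  have "AE x in lborel. inner (f x) e = 0" for e
  proof (rule AE_zero_if_box_integrals_zero)
    fix a b :: "real^2"
    have box: "(\<lambda>x. indicat_real (box a b) x *\<^sub>R e) \<in> L2"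
    proof -
      obtain r where "box a b \<subseteq> cball 0 r"
        using bounded_subset_ballD[OF bounded_box, of a b 0] ball_subset_cball by blast
      then show ?thesis
        by (intro L2_bounded_support[where r = r and M = "norm e"]) (auto simp: indicator_def)
    qed
    have int: "integrable lborel (\<lambda>x. indicat_real (box a b) x * inner (f x) e)"
      using L2_inner_integrable[OF f(1) box] by simp
    then show "integrable lborel (\<lambda>x. indicat_real (box a b) x * inner (f x) e)" .
    have "(\<lambda>n. \<integral>x. bump a b n x * inner (f x) e \<partial>lborel) \<longlonglongrightarrow> (\<integral>x. indicat_real (box a b) x * inner (f x) e \<partial>lborel)"
    proof (rule integral_dominated_convergence[OF _ _ integrable_abs[OF int]])
      show "AE x in lborel. (\<lambda>n. bump a b n x * inner (f x) e) \<longlonglongrightarrow> indicat_real (box a b) x * inner (f x) e"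
        by (intro AE_I2 tendsto_intros bump_tendsto)
      show "AE x in lborel. norm (bump a b n x * inner (f x) e) \<le> \<bar>indicat_real (box a b) x * inner (f x) e\<bar>" for n
      proof (rule AE_I2)
        fix x
        show "norm (bump a b n x * inner (f x) e) \<le> \<bar>indicat_real (box a b) x * inner (f x) e\<bar>"
          using bump_bounds[of a b n x] bump_outside[of x a b n]
          by (cases "x \<in> box a b") (auto simp: abs_mult intro!: mult_left_le_one_le)
      qed
    qed (use test_functionD(4)[OF test_function_bump] in measurable)
    then show "(\<integral>x. indicat_real (box a b) x * inner (f x) e \<partial>lborel) = 0"
      using assms[OF test_function_bump] by (simp add: f inner_test_field test_function_bump LIMSEQ_const_iff)
  qed simp
  then have "AE x in lborel. \<forall>e\<in>Basis. inner (f x) e = 0"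
    by (subst AE_ball_countable) (auto simp: countable_finite)
  then have "AE x in lborel. f x = 0"
    by eventually_elim (simp add: euclidean_all_zero_iff)
  then show ?thesis using f by (simp add: zero_lsq_def abs_lsq_eq_iff L2_eq_def)
qed

lemma subspace_closure:
  fixes S :: "'a::real_normed_vector set"
  assumes "subspace S" shows "subspace (closure S)"
proof (rule subspaceI)
  show "0 \<in> closure S" using subspace_0[OF assms] closure_subset by blast
  fix x y and c :: real assume "x \<in> closure S" "y \<in> closure S"
  then obtain X Y where "\<forall>n. X n \<in> S" "X \<longlonglongrightarrow> x" and "\<forall>n. Y n \<in> S" "Y \<longlonglongrightarrow> y"
    unfolding closure_sequential by blast
  then have "\<forall>n. X n + Y n \<in> S" "(\<lambda>n. X n + Y n) \<longlonglongrightarrow> x + y"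
    "\<forall>n. c *\<^sub>R X n \<in> S" "(\<lambda>n. c *\<^sub>R X n) \<longlonglongrightarrow> c *\<^sub>R x"
    by (auto intro: subspace_add[OF assms] subspace_scale[OF assms] tendsto_intros)
  then show "x + y \<in> closure S" "c *\<^sub>R x \<in> closure S"
    unfolding closure_sequential by metis+
qed

text \<open>The orthogonal complement of the closed span is trivial, so projecting onto the closed
  span leaves every x fixed.\<close>

lemma test_fields_dense: "closure (span {test_field \<phi> e | \<phi> e. test_function \<phi>}) = UNIV"
proof -
  let ?S = "span {test_field \<phi> e | \<phi> e. test_function \<phi>}"
  have "x \<in> closure ?S" for x
  proof -
    obtain p where p: "p \<in> closure ?S" "\<And>v. v \<in> closure ?S \<Longrightarrow> inner (x - p) v = 0"
      using closed_subspace_projection[of "closure ?S" x] subspace_closure[OF subspace_span] by auto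
    have "x - p = 0"
      by (rule lsq_zero_if_orthogonal_to_test_fields, rule p(2))
        (use closure_subset[of ?S] in \<open>auto intro!: span_base\<close>)
    with p(1) show ?thesis by simp
  qed
  then show ?thesis by blast
qed

section \<open>Pointwise operators\<close>

definition pointwise :: "(real^2 \<Rightarrow> complex^2 \<Rightarrow> complex^2) \<Rightarrow> lsq \<Rightarrow> lsq" where
  "pointwise F u = abs_lsq (\<lambda>x. F x (rep_lsq u x))"

text \<open>Fibrewise complex-linear maps with a uniform bound, covering J, scalar multipliers and
  the potential matrix alike. Measurability is required after composition with a field, which avoids
  a measurable structure on matrices.\<close>

locale bounded_field_map =
  fixes F :: "real^2 \<Rightarrow> complex^2 \<Rightarrow> complex^2" and C :: real
  assumes F_measurable: "\<And>f. f \<in> borel_measurable borel \<Longrightarrow> (\<lambda>x. F x (f x)) \<in> borel_measurable borel"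
    and F_add: "\<And>x a b. F x (a + b) = F x a + F x b"
    and F_scale: "\<And>x c a. F x (c *s a) = c *s F x a"
    and F_bound: "\<And>x a. norm (F x a) \<le> C * norm a"
begin

lemma F_L2: "f \<in> L2 \<Longrightarrow> (\<lambda>x. F x (f x)) \<in> L2"
  by (rule L2_dominated[where f = f and c = C]) (auto simp: F_measurable L2_measurable F_bound)

lemma pointwise_abs: "f \<in> L2 \<Longrightarrow> pointwise F (abs_lsq f) = abs_lsq (\<lambda>x. F x (f x))"
  unfolding pointwise_def using rep_abs_lsq_AE[of f]
  by (auto simp: abs_lsq_eq_iff F_L2 L2_eq_def)

lemma C_nonneg: "0 \<le> C"
  using order_trans[OF norm_ge_zero F_bound[of 0 "axis 1 1"]] by simp

lemma norm_pointwise: "norm (pointwise F u) \<le> C * norm u"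
proof -
  obtain f where f: "f \<in> L2" "u = abs_lsq f" by (rule lsq_cases)
  have "(norm (pointwise F u))\<^sup>2 = (\<integral>x. (norm (F x (f x)))\<^sup>2 \<partial>lborel)"
    by (simp add: f pointwise_abs norm_abs_lsq F_L2)
  also have "\<dots> \<le> (\<integral>x. C\<^sup>2 * (norm (f x))\<^sup>2 \<partial>lborel)"
  proof (rule integral_mono)
    show "integrable lborel (\<lambda>x. (norm (F x (f x)))\<^sup>2)" "integrable lborel (\<lambda>x. C\<^sup>2 * (norm (f x))\<^sup>2)"
      using F_L2[OF f(1)] f(1) by (simp_all add: L2_iff)
    show "(norm (F x (f x)))\<^sup>2 \<le> C\<^sup>2 * (norm (f x))\<^sup>2" for x
      unfolding power_mult_distrib[symmetric] by (intro power_mono F_bound) simp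
  qed
  also have "\<dots> = (C * norm u)\<^sup>2"
    by (simp add: f norm_abs_lsq power_mult_distrib)
  finally show ?thesis
    using C_nonneg by (simp add: power2_le_iff_abs_le)
qed

lemma pointwise_bounded_clinear: "bounded_clinear (pointwise F)"
proof -
  have add: "pointwise F (u + v) = pointwise F u + pointwise F v" for u v
  proof -
    obtain f where f: "f \<in> L2" "u = abs_lsq f" by (rule lsq_cases)
    obtain g where g: "g \<in> L2" "v = abs_lsq g" by (rule lsq_cases)
    show ?thesis
      by (simp add: f g pointwise_abs F_L2 L2_add F_add flip: abs_lsq_add)
  qed
  have sc: "pointwise F (c *\<^sub>C u) = c *\<^sub>C pointwise F u" for c u
  proof -
    obtain f where f: "f \<in> L2" "u = abs_lsq f" by (rule lsq_cases)
    show ?thesis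
      by (simp add: f pointwise_abs F_L2 L2_vec_scale F_scale flip: abs_lsq_vec_scale)
  qed
  have "bounded_linear (pointwise F)"
    using norm_pointwise sc[of "of_real _"] unfolding scaleC_of_real
    by (intro bounded_linear_intro[where K = C] add) (auto simp: mult.commute)
  then show ?thesis by (simp add: bounded_clinear_def imul_eq_scaleC sc)
qed

end

section \<open>Scalar multipliers and the matrix J\<close>

lemma scaleR_field_map:
  assumes "m \<in> borel_measurable borel" "\<And>x. \<bar>m x\<bar> \<le> C"
  shows "bounded_field_map (\<lambda>x v. m x *\<^sub>R v) C"
  by unfold_locales
    (use assms in \<open>auto simp: scaleR_add_right field_eq_iff intro!: mult_right_mono\<close>)

lemma J_mult: "J *v v = vector [- (v $ 2), v $ 1]"
  by (simp add: J_def matrix_vector_mult_def field_eq_iff forall_2 sum_2)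

lemma J_J: "J *v (J *v v) = - v"
  by (simp add: J_mult field_eq_iff forall_2)

lemma norm_J: "norm (J *v v) = norm v"
  by (simp add: J_mult norm_vec_def L2_set_def sum_2 add.commute)

lemma inner_J: "inner (J *v u) v = - inner u (J *v v)"
  by (simp add: J_mult inner_vec_def sum_2)

lemma J_add: "J *v (u + v) = J *v u + J *v v" and J_scale: "J *v (c *s v) = c *s (J *v v)"
  and J_scaleR: "J *v (r *\<^sub>R v) = r *\<^sub>R (J *v v)"
  by (simp_all add: J_mult field_eq_iff forall_2 algebra_simps)

lemma borel_measurable_J [measurable]: "(*v) J \<in> borel_measurable borel"
proof (rule borel_measurable_continuous_onI, rule linear_continuous_on)
  show "bounded_linear ((*v) J)"
    by (rule bounded_linear_intro[where K = 1]) (simp_all add: J_add J_scaleR norm_J)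
qed

interpretation J: bounded_field_map "\<lambda>x v. J *v v" 1
  by unfold_locales (use norm_J in \<open>simp_all add: J_add J_scale\<close>)

abbreviation "Jop \<equiv> pointwise (\<lambda>x v. J *v v)"

lemma Jop_Jop: "Jop (Jop u) = - u"
proof -
  obtain f where f: "f \<in> L2" "u = abs_lsq f" by (rule lsq_cases)
  show ?thesis by (simp add: f J.pointwise_abs J.F_L2 J_J abs_lsq_minus)
qed

text \<open>J is real and antisymmetric, hence skew for the real inner product. This lets J act on
  jets and later excludes large real eigenvalues.\<close>

lemma inner_Jop: "inner (Jop u) v = - inner u (Jop v)"
proof -
  obtain f where f: "f \<in> L2" "u = abs_lsq f" by (rule lsq_cases)
  obtain g where g: "g \<in> L2" "v = abs_lsq g" by (rule lsq_cases)
  show ?thesis by (simp add: f g J.pointwise_abs J.F_L2 inner_abs_lsq inner_J)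
qed

section \<open>The form domain as a closed subspace\<close>

lemma test_field_minus: "test_function \<phi> \<Longrightarrow> test_field \<phi> (- e) = - test_field \<phi> e"
  by (simp add: test_field_def abs_lsq_minus test_function_L2)

lemma imul_test_field: "test_function \<phi> \<Longrightarrow> imul (test_field \<phi> e) = test_field \<phi> (\<i> *s e)"
proof -
  have "\<i> *s (\<phi> x *\<^sub>R e) = \<phi> x *\<^sub>R (\<i> *s e)" for x by (simp add: field_eq_iff)
  then show "test_function \<phi> \<Longrightarrow> ?thesis"
    by (simp add: test_field_def test_function_L2 flip: abs_lsq_imul)
qed

lemma Jop_test_field: "test_function \<phi> \<Longrightarrow> Jop (test_field \<phi> e) = test_field \<phi> (J *v e)"
  by (simp add: test_field_def J.pointwise_abs test_function_L2 J_scaleR)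

text \<open>Testing with scalar functions times constant vectors expresses the relation by
  continuous functionals, so it is stable under limits in both arguments.\<close>

definition weak_deriv :: "2 \<Rightarrow> lsq \<Rightarrow> lsq \<Rightarrow> bool" where
  "weak_deriv i u g \<longleftrightarrow> (\<forall>\<phi> e. test_function \<phi> \<longrightarrow>
     inner u (test_field (partial i \<phi>) e) = - inner g (test_field \<phi> e))"

lemma test_function_scaleR_integrable:
  assumes "test_function \<phi>" "f \<in> L2"
  shows "integrable lborel (\<lambda>x. \<phi> x *\<^sub>R f x)"
proof (rule Bochner_Integration.integrable_bound)
  note [measurable] = test_functionD(4)[OF assms(1)] L2_measurable[OF assms(2)]
  show "integrable lborel (\<lambda>x. (\<phi> x)\<^sup>2 + (norm (f x))\<^sup>2)"
    using test_function_L2[OF assms(1), of "axis 1 1"] assms(2)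
    by (auto simp: L2_iff)
  have "\<bar>\<phi> x\<bar> * norm (f x) \<le> (\<phi> x)\<^sup>2 + (norm (f x))\<^sup>2" for x
  proof -
    have "2 * (\<bar>\<phi> x\<bar> * norm (f x)) \<le> (\<phi> x)\<^sup>2 + (norm (f x))\<^sup>2"
      using sum_squares_bound[of "\<bar>\<phi> x\<bar>" "norm (f x)"] by (simp add: mult.assoc)
    moreover have "0 \<le> \<bar>\<phi> x\<bar> * norm (f x)" by simp
    ultimately show ?thesis by linarith
  qed
  then show "AE x in lborel. norm (\<phi> x *\<^sub>R f x) \<le> norm ((\<phi> x)\<^sup>2 + (norm (f x))\<^sup>2)"
    by simp
qed (use test_functionD(4)[OF assms(1)] L2_measurable[OF assms(2)] in measurable)

text \<open>An identity between vector-valued integrals holds exactly when its inner products with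
  all constant vectors do.\<close>

lemma has_weak_partial_iff:
  assumes f: "f \<in> L2" and g: "g \<in> L2"
  shows "has_weak_partial i f g \<longleftrightarrow> weak_deriv i (abs_lsq f) (abs_lsq g)"
proof -
  have "(\<integral>x. partial i \<phi> x *\<^sub>R f x \<partial>lborel) = - (\<integral>x. \<phi> x *\<^sub>R g x \<partial>lborel) \<longleftrightarrow>
      (\<forall>e. inner (abs_lsq f) (test_field (partial i \<phi>) e) = - inner (abs_lsq g) (test_field \<phi> e))"
    if \<phi>: "test_function \<phi>" for \<phi>
  proof -
    have *: "inner (abs_lsq h) (test_field \<psi> e) = inner (\<integral>x. \<psi> x *\<^sub>R h x \<partial>lborel) e"
      if "test_function \<psi>" "h \<in> L2" for \<psi> h e
      using integral_inner_left[OF test_function_scaleR_integrable[OF that], of e]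
      by (simp add: inner_test_field that)
    show ?thesis
      unfolding *[OF test_functionD(3)[OF \<phi>] f] *[OF \<phi> g] inner_minus_left[symmetric]
      by (simp only: vector_eq_rdot)
  qed
  then show ?thesis using g by (auto simp: has_weak_partial_def weak_deriv_def)
qed

lemma weak_deriv_unique: "weak_deriv i u g \<Longrightarrow> weak_deriv i u g' \<Longrightarrow> g = g'"
  using lsq_zero_if_orthogonal_to_test_fields[of "g - g'"]
  by (simp add: weak_deriv_def inner_diff_left)

text \<open>\<open>radial u c\<close> means \<open>c = |x| u\<close>; dividing by \<open>1 + |x|\<close> makes both multipliers bounded, so that the
  relation is visibly closed.\<close>

definition radial :: "lsq \<Rightarrow> lsq \<Rightarrow> bool" where
  "radial u c \<longleftrightarrow> pointwise (\<lambda>x v. (norm x / (1 + norm x)) *\<^sub>R v) u = pointwise (\<lambda>x v. (1 / (1 + norm x)) *\<^sub>R v) c"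

lemma one_plus_norm_pos: "0 < 1 + norm x"
  by (simp add: add_pos_nonneg)

interpretation radial_num: bounded_field_map "\<lambda>x v. (norm x / (1 + norm x)) *\<^sub>R v" 1
  by (rule scaleR_field_map) (simp_all add: abs_of_pos[OF one_plus_norm_pos] divide_le_eq_1 one_plus_norm_pos)

interpretation radial_den: bounded_field_map "\<lambda>x v. (1 / (1 + norm x)) *\<^sub>R v" 1
  by (rule scaleR_field_map) (simp_all add: abs_of_pos[OF one_plus_norm_pos] divide_le_eq_1 one_plus_norm_pos)

lemma radial_iff:
  assumes f: "f \<in> L2" and g: "g \<in> L2"
  shows "radial (abs_lsq f) (abs_lsq g) \<longleftrightarrow> (AE x in lborel. g x = norm x *\<^sub>R f x)"
proof -
  have "(norm x / (1 + norm x)) *\<^sub>R f x = (1 / (1 + norm x)) *\<^sub>R g x \<longleftrightarrow> g x = norm x *\<^sub>R f x" for x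
  proof -
    have "(norm x / (1 + norm x)) *\<^sub>R f x = (1 / (1 + norm x)) *\<^sub>R norm x *\<^sub>R f x" by simp
    moreover have "1 / (1 + norm x) \<noteq> 0" using one_plus_norm_pos[of x] by simp
    ultimately show ?thesis by (metis scaleR_cancel_left)
  qed
  then show ?thesis
    using f g by (simp add: radial_def radial_num.pointwise_abs radial_den.pointwise_abs abs_lsq_eq_iff radial_num.F_L2 radial_den.F_L2 L2_eq_def)
qed

lemma radial_unique: "radial u c \<Longrightarrow> radial u c' \<Longrightarrow> c = c'"
proof -
  obtain f where f: "f \<in> L2" "u = abs_lsq f" by (rule lsq_cases)
  obtain g where g: "g \<in> L2" "c = abs_lsq g" by (rule lsq_cases)
  obtain h where h: "h \<in> L2" "c' = abs_lsq h" by (rule lsq_cases)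
  show "radial u c \<Longrightarrow> radial u c' \<Longrightarrow> c = c'"
    unfolding f(2) g(2) h(2) radial_iff[OF f(1) g(1)] radial_iff[OF f(1) h(1)] abs_lsq_eq_iff[OF g(1) h(1)] L2_eq_def
    by (erule (1) eventually_elim2) simp
qed

section \<open>The graph of the gradient and of multiplication by |x|\<close>

type_synonym jet = "lsq \<times> lsq \<times> lsq \<times> lsq"

text \<open>The squared norm inherited from the product is 2 q(u, u) + |u|^2, so closedness of this
  subspace plays the part of closedness of the form.\<close>

definition jets :: "jet set" where
  "jets = {p. weak_deriv 1 (fst p) (fst (snd p)) \<and> weak_deriv 2 (fst p) (fst (snd (snd p)))
     \<and> radial (fst p) (snd (snd (snd p)))}"

text \<open>Every defining condition equates two continuous functions of the jet.\<close>

lemma closed_jets: "closed jets"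
proof -
  have 1: "closed {p :: jet. weak_deriv i (fst p) (s p)}" if "continuous_on UNIV s" for i s
    unfolding weak_deriv_def using that
    by (intro closed_Collect_all closed_Collect_imp closed_Collect_eq continuous_intros) auto
  have 2: "closed {p :: jet. radial (fst p) (snd (snd (snd p)))}"
    unfolding radial_def
    by (intro closed_Collect_eq bounded_linear.continuous_on[OF bounded_clinearD(6)[OF radial_num.pointwise_bounded_clinear]]
       bounded_linear.continuous_on[OF bounded_clinearD(6)[OF radial_den.pointwise_bounded_clinear]] continuous_intros)
  show ?thesis
    unfolding jets_def by (intro closed_Collect_conj 1 2 continuous_intros)
qed

lemma subspace_jets: "subspace jets"
  unfolding jets_def
  using bounded_clinearD(1,3)[OF radial_num.pointwise_bounded_clinear] bounded_clinearD(1,3)[OF radial_den.pointwise_bounded_clinear]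
    bounded_clinearD(4)[OF radial_num.pointwise_bounded_clinear, of "of_real _"] bounded_clinearD(4)[OF radial_den.pointwise_bounded_clinear, of "of_real _"]
  by (auto simp: subspace_def weak_deriv_def radial_def inner_add_left algebra_simps scaleC_of_real)

lemma imul_jets: "(u, a, b, c) \<in> jets \<Longrightarrow> (imul u, imul a, imul b, imul c) \<in> jets"
proof -
  assume W: "(u, a, b, c) \<in> jets"
  have "inner (imul v) (test_field \<phi> e) = inner v (test_field \<phi> (- (\<i> *s e)))" if "test_function \<phi>" for v \<phi> e
    using that by (simp add: inner_imul_left imul_test_field test_field_minus)
  then show ?thesis
    using W test_functionD(3) bounded_clinearD(7)[OF radial_num.pointwise_bounded_clinear] bounded_clinearD(7)[OF radial_den.pointwise_bounded_clinear]
    by (simp add: jets_def weak_deriv_def radial_def)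
qed

text \<open>A constant matrix commutes with derivatives and with multiplication by |x|. The purpose
  is to make Jop u an admissible test vector in the equation for u.\<close>

lemma Jop_jets: "(u, a, b, c) \<in> jets \<Longrightarrow> (Jop u, Jop a, Jop b, Jop c) \<in> jets"
proof -
  assume W: "(u, a, b, c) \<in> jets"
  have "inner (Jop v) (test_field \<phi> e) = inner v (test_field \<phi> (- (J *v e)))" if "test_function \<phi>" for v \<phi> e
    using that by (simp add: inner_Jop Jop_test_field test_field_minus)
  moreover have "pointwise (\<lambda>x v. m x *\<^sub>R v) (Jop v) = Jop (pointwise (\<lambda>x v. m x *\<^sub>R v) v)"
    if "bounded_field_map (\<lambda>x v. m x *\<^sub>R v) 1" for m v
  proof -
    interpret bounded_field_map "\<lambda>x v. m x *\<^sub>R v" 1 by (rule that)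
    obtain f where f: "f \<in> L2" "v = abs_lsq f" by (rule lsq_cases)
    show ?thesis
      using F_L2[OF f(1)] J.F_L2[OF f(1)] by (simp add: f pointwise_abs J.pointwise_abs J_scaleR)
  qed
  ultimately show ?thesis
    using W test_functionD(3) radial_num.bounded_field_map_axioms radial_den.bounded_field_map_axioms
    by (simp add: jets_def weak_deriv_def radial_def)
qed

section \<open>The inverse of 2 L_c + 1\<close>

text \<open>The weak form of (2 L_c + 1) u = f. Only real parts are compared; imaginary parts follow
  by testing with \<open>imul q\<close>, since \<open>jets\<close> is stable under
  \<open>imul\<close>.\<close>

definition weak_solution :: "lsq \<Rightarrow> jet \<Rightarrow> bool" where
  "weak_solution f p \<longleftrightarrow> p \<in> jets \<and> (\<forall>q\<in>jets. inner p q = inner f (fst q))"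

text \<open>The vector (f, 0, 0, 0) pairs with a jet q as f pairs with its first component, so its
  projection onto \<open>jets\<close> solves the equation.\<close>

lemma weak_solution_ex: "\<exists>p. weak_solution f p"
proof -
  obtain p where p: "p \<in> jets" "\<And>q. q \<in> jets \<Longrightarrow> inner ((f, 0, 0, 0) - p) q = 0"
    using closed_subspace_projection[OF closed_jets subspace_jets, of "(f, 0, 0, 0)"] by blast
  have "inner p q = inner f (fst q)" if "q \<in> jets" for q
    using p(2)[OF that] by (cases q) (simp add: inner_diff_left)
  with p(1) show ?thesis unfolding weak_solution_def by blast
qed

lemma weak_solution_unique:
  assumes "weak_solution f p" "weak_solution f q" shows "p = q"
proof -
  have "p - q \<in> jets" using assms subspace_jets by (auto simp: weak_solution_def intro: subspace_diff)
  then have "inner (p - q) (p - q) = 0"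
    using assms by (simp add: weak_solution_def inner_diff_left)
  then show ?thesis by simp
qed

lemma jet_unique:
  assumes "p \<in> jets" "q \<in> jets" "fst p = fst q" shows "p = q"
  using assms weak_deriv_unique radial_unique by (auto simp: jets_def prod_eq_iff)

definition solution_jet :: "lsq \<Rightarrow> jet" where
  "solution_jet f = (THE p. weak_solution f p)"

definition osc_inverse :: "lsq \<Rightarrow> lsq" where
  "osc_inverse f = fst (solution_jet f)"

lemma solution_jet: "weak_solution f (solution_jet f)"
  unfolding solution_jet_def by (rule theI') (use weak_solution_ex weak_solution_unique in blast)

lemma solution_jet_eq: "weak_solution f p \<Longrightarrow> solution_jet f = p"
  using solution_jet weak_solution_unique by blast

lemma norm_fst_prod_le: "norm (fst p) \<le> norm p" and norm_snd_prod_le: "norm (snd p) \<le> norm p"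
  using norm_fst_le[of "fst p" "snd p"] norm_snd_le[of "snd p" "fst p"] by simp_all

text \<open>The equation is tested with its own solution. The bound covers the whole jet, and the
  approximation estimate relies on its gradient and weight components.\<close>

lemma norm_solution_jet: "norm (solution_jet f) \<le> norm f"
proof -
  have "(norm (solution_jet f))\<^sup>2 = inner f (fst (solution_jet f))"
    using solution_jet[of f] by (auto simp: weak_solution_def power2_norm_eq_inner)
  also have "\<dots> \<le> norm f * norm (fst (solution_jet f))" by (rule norm_cauchy_schwarz)
  also have "\<dots> \<le> norm f * norm (solution_jet f)" by (intro mult_left_mono norm_fst_prod_le) simp
  finally have "norm (solution_jet f) * norm (solution_jet f) \<le> norm f * norm (solution_jet f)" by (simp add: power2_eq_square)
  then show ?thesis by (cases "solution_jet f = 0") auto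
qed

lemma osc_inverse_bounded_clinear: "bounded_clinear osc_inverse"
proof -
  have sol: "p \<in> jets" "\<And>q. q \<in> jets \<Longrightarrow> inner p q = inner f (fst q)" if "p = solution_jet f" for p f
    using solution_jet[of f] that by (auto simp: weak_solution_def)
  have add: "solution_jet (f + g) = solution_jet f + solution_jet g" for f g
    by (rule solution_jet_eq) (auto simp: weak_solution_def sol inner_add_left intro!: subspace_add[OF subspace_jets])
  have sc: "solution_jet (r *\<^sub>R f) = r *\<^sub>R solution_jet f" for r f
    by (rule solution_jet_eq) (auto simp: weak_solution_def sol intro!: subspace_scale[OF subspace_jets])
  have "bounded_linear osc_inverse"
    unfolding osc_inverse_def
    by (rule bounded_linear_intro[where K = 1]) (auto simp: add sc intro: order_trans[OF norm_fst_prod_le norm_solution_jet])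
  moreover have "osc_inverse (imul f) = imul (osc_inverse f)" for f
  proof -
    obtain u a b c where p: "solution_jet f = (u, a, b, c)" using prod_cases4 by blast
    \<comment> \<open>\<open>imul\<close> is skew, so it can be moved onto the test jet, which stays
      in \<open>jets\<close>.\<close>
    have "weak_solution (imul f) (imul u, imul a, imul b, imul c)"
      unfolding weak_solution_def
    proof (intro conjI ballI)
      show "(imul u, imul a, imul b, imul c) \<in> jets"
        using sol(1)[OF refl, of f] p imul_jets by auto
      fix q assume q: "q \<in> jets"
      obtain v a' b' c' where q': "q = (v, a', b', c')" using prod_cases4 by blast
      show "inner (imul u, imul a, imul b, imul c) q = inner (imul f) (fst q)"
        using sol(2)[OF refl, of "(imul v, imul a', imul b', imul c')" f] imul_jets[OF q[unfolded q']]
        by (simp add: q' p inner_imul_left)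
    qed
    from solution_jet_eq[OF this] show ?thesis by (simp add: osc_inverse_def p)
  qed
  ultimately show ?thesis by (simp add: bounded_clinear_def)
qed

section \<open>Translations\<close>

lemma nn_integral_translate:
  fixes h :: "real^2 \<Rightarrow> ennreal"
  assumes [measurable]: "h \<in> borel_measurable borel"
  shows "(\<integral>\<^sup>+x. h (x + c) \<partial>lborel) = (\<integral>\<^sup>+x. h x \<partial>lborel)"
proof -
  have "(\<integral>\<^sup>+x. h x \<partial>lborel) = (\<integral>\<^sup>+x. h x \<partial>distr lborel borel ((+) c))"
    by (simp add: lborel_distr_plus)
  also have "\<dots> = (\<integral>\<^sup>+x. h (c + x) \<partial>lborel)"
    by (rule nn_integral_distr) auto
  finally show ?thesis by (simp add: add.commute)
qed

definition shift :: "real^2 \<Rightarrow> lsq \<Rightarrow> lsq" where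
  "shift c u = abs_lsq (\<lambda>x. rep_lsq u (x + c))"

lemma shift_L2: "f \<in> L2 \<Longrightarrow> (\<lambda>x. f (x + c)) \<in> L2"
  and norm_abs_shift: "f \<in> L2 \<Longrightarrow> norm (abs_lsq (\<lambda>x. f (x + c))) \<le> norm (abs_lsq f)"
proof -
  assume f: "f \<in> L2"
  note [measurable] = L2_measurable[OF f]
  have "(\<integral>\<^sup>+x. ennreal ((norm (f (x + c)))\<^sup>2) \<partial>lborel) = (\<integral>\<^sup>+x. ennreal ((norm (f x))\<^sup>2) \<partial>lborel)"
    by (rule nn_integral_translate) measurable
  also have "\<dots> = ennreal ((norm (abs_lsq f))\<^sup>2)" using f by (rule nn_integral_norm_abs_lsq)
  finally show "(\<lambda>x. f (x + c)) \<in> L2" "norm (abs_lsq (\<lambda>x. f (x + c))) \<le> norm (abs_lsq f)"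
    using L2_if_nn_integral[of "\<lambda>x. f (x + c)" "norm (abs_lsq f)"] by auto
qed

text \<open>The difference of two representatives has norm 0, and translation does not increase
  norms.\<close>

lemma shift_abs: "f \<in> L2 \<Longrightarrow> shift c (abs_lsq f) = abs_lsq (\<lambda>x. f (x + c))"
proof -
  assume f: "f \<in> L2"
  let ?g = "rep_lsq (abs_lsq f)"
  have "norm (abs_lsq (\<lambda>x. ?g (x + c) - f (x + c))) \<le> norm (abs_lsq (\<lambda>x. ?g x - f x))"
    using norm_abs_shift[of "\<lambda>x. ?g x - f x" c] f by (simp add: L2_diff)
  also have "\<dots> = 0" using f by (simp add: abs_lsq_diff)
  finally show ?thesis using f by (simp add: shift_def abs_lsq_diff shift_L2)
qed

lemma norm_shift: "norm (shift c u) \<le> norm u"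
  using norm_abs_shift[of "rep_lsq u" c] by (simp add: shift_def)

lemma shift_diff: "shift c (u - v) = shift c u - shift c v"
proof -
  obtain f where f: "f \<in> L2" "u = abs_lsq f" by (rule lsq_cases)
  obtain g where g: "g \<in> L2" "v = abs_lsq g" by (rule lsq_cases)
  show ?thesis by (simp add: f g shift_abs L2_diff shift_L2 flip: abs_lsq_diff)
qed

lemma shift_add: "shift c (u + v) = shift c u + shift c v"
  and shift_scaleR: "shift c (r *\<^sub>R u) = r *\<^sub>R shift c u"
proof -
  obtain f where f: "f \<in> L2" "u = abs_lsq f" by (rule lsq_cases)
  obtain g where g: "g \<in> L2" "v = abs_lsq g" by (rule lsq_cases)
  show "shift c (u + v) = shift c u + shift c v"
    by (simp add: f g shift_abs L2_add shift_L2 flip: abs_lsq_add)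
  show "shift c (r *\<^sub>R u) = r *\<^sub>R shift c u"
    by (simp add: f shift_abs L2_scaleR shift_L2 flip: abs_lsq_scaleR)
qed

lemma shift_shift: "shift c (shift d u) = shift (c + d) u"
proof -
  obtain f where f: "f \<in> L2" "u = abs_lsq f" by (rule lsq_cases)
  show ?thesis by (simp add: f shift_abs shift_L2 add_ac)
qed

lemma shift_0 [simp]: "shift 0 u = u"
  by (simp add: shift_def)

lemma inner_shift: "inner (shift c u) v = inner u (shift (- c) v)"
proof -
  obtain f where f: "f \<in> L2" "u = abs_lsq f" by (rule lsq_cases)
  obtain g where g: "g \<in> L2" "v = abs_lsq g" by (rule lsq_cases)
  note [measurable] = L2_measurable[OF f(1)] L2_measurable[OF g(1)]
  have "(\<integral>x. inner (f x) (g (x - c)) \<partial>lborel) = (\<integral>x. inner (f x) (g (x - c)) \<partial>distr lborel borel ((+) c))"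
    by (simp add: lborel_distr_plus)
  also have "\<dots> = (\<integral>x. inner (f (x + c)) (g x) \<partial>lborel)"
    by (subst integral_distr) (auto simp: add.commute)
  finally show ?thesis
    using shift_L2[OF f(1), of c] shift_L2[OF g(1), of "- c"]
    by (simp add: f g shift_abs inner_abs_lsq)
qed

section \<open>Translations of test functions\<close>

lemma partial_translate:
  assumes "\<And>x. f differentiable (at x)"
  shows "partial i (\<lambda>x. f (x + c)) = (\<lambda>x. partial i f (x + c))"
    and "(\<lambda>x. f (x + c)) differentiable (at x)"
proof -
  have *: "((\<lambda>x. f (x + c)) has_derivative frechet_derivative f (at (x + c))) (at x)" for x
  proof -
    have "((\<lambda>x. x + c) has_derivative (\<lambda>v. v)) (at x)" by (auto intro!: derivative_eq_intros)
    from has_derivative_compose[OF this frechet_derivative_works[THEN iffD1, OF assms]]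
    show ?thesis by simp
  qed
  show "partial i (\<lambda>x. f (x + c)) = (\<lambda>x. partial i f (x + c))"
    by (rule ext, rule partial_eqI[OF *, THEN trans]) (simp add: partial_def)
  show "(\<lambda>x. f (x + c)) differentiable (at x)"
    using * by (rule differentiableI)
qed

lemma Ck_translate: "Ck k f \<Longrightarrow> Ck k (\<lambda>x. f (x + c))"
proof (induction k arbitrary: f)
  case 0
  then have "continuous_on UNIV f" by simp
  then have "continuous_on UNIV (\<lambda>x. f (x + c))"
    by (rule continuous_on_compose2) (auto intro!: continuous_intros)
  then show ?case by simp
next
  case (Suc k)
  then have "f differentiable (at x)" for x by simp
  note tr = partial_translate[OF this]
  have "Ck k (partial i f)" for i using Suc.prems by simp
  then have "Ck k (\<lambda>x. partial i f (x + c))" for i by (rule Suc.IH)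
  then show ?case unfolding Ck.simps tr(1) using tr(2) by blast
qed

lemma test_function_translate:
  assumes "test_function \<phi>" shows "test_function (\<lambda>x. \<phi> (x + c))"
proof -
  obtain M r where M: "\<And>x. \<bar>\<phi> x\<bar> \<le> M * indicat_real (cball 0 r) x"
    using test_function_bounded[OF assms] by metis
  have "{x. \<phi> (x + c) \<noteq> 0} \<subseteq> (\<lambda>y. y - c) ` cball 0 r"
  proof
    fix x assume "x \<in> {x. \<phi> (x + c) \<noteq> 0}"
    then have "x + c \<in> cball 0 r" using M[of "x + c"] by (cases "x + c \<in> cball 0 r") auto
    then have "(x + c) - c \<in> (\<lambda>y. y - c) ` cball 0 r" by (rule imageI)
    then show "x \<in> (\<lambda>y. y - c) ` cball 0 r" by simp
  qed
  then have "bounded {x. \<phi> (x + c) \<noteq> 0}"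
    using bounded_subset[OF bounded_translation_minus[OF bounded_cball]] by blast
  then show ?thesis
    using assms by (auto simp: test_function_def compact_closure intro: Ck_translate)
qed

lemma shift_test_field:
  "test_function \<phi> \<Longrightarrow> shift c (test_field \<phi> e) = test_field (\<lambda>x. \<phi> (x + c)) e"
  by (simp add: test_field_def shift_abs test_function_L2)

abbreviation unit_vec2 :: "2 \<Rightarrow> real^2" where
  "unit_vec2 i \<equiv> axis i 1"

section \<open>Difference quotients along the coordinate axes\<close>

lemma test_function_line_derivative:
  assumes "test_function \<phi>"
  shows "((\<lambda>s. \<phi> (x + s *\<^sub>R unit_vec2 i)) has_real_derivative partial i \<phi> (x + s *\<^sub>R unit_vec2 i)) (at s within S)"
proof -
  have "((\<lambda>s. x + s *\<^sub>R unit_vec2 i) has_derivative (\<lambda>t. t *\<^sub>R unit_vec2 i)) (at s within S)"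
    by (auto intro!: derivative_eq_intros)
  from has_derivative_compose[OF this frechet_derivative_works[THEN iffD1, OF test_functionD(2)[OF assms]]]
  show ?thesis
    using linear_frechet_derivative[OF test_functionD(2)[OF assms]]
    by (simp add: has_field_derivative_def partial_def linear_scale mult_commute_abs)
qed

text \<open>A mean value estimate, meant as the dominating function for difference
  quotients.\<close>

lemma test_function_quotient_bound:
  assumes \<phi>: "test_function \<phi>"
  obtains M r where "\<And>x s. \<bar>s\<bar> \<le> 1 \<Longrightarrow> \<bar>\<phi> (x + s *\<^sub>R unit_vec2 i) - \<phi> x\<bar> \<le> \<bar>s\<bar> * (M * indicat_real (cball 0 r) x)"
proof -
  obtain M r where M: "M \<ge> 0" "r \<ge> 0" "\<And>x. \<bar>partial i \<phi> x\<bar> \<le> M * indicat_real (cball 0 r) x"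
    using test_function_bounded[OF test_functionD(3)[OF \<phi>]] by metis
  note der = test_function_line_derivative[OF \<phi>]
  \<comment> \<open>The radius grows by 1 because the segment from x to x + s e_i has length at most
    1.\<close>
  have "\<bar>\<phi> (x + s *\<^sub>R unit_vec2 i) - \<phi> x\<bar> \<le> \<bar>s\<bar> * (M * indicat_real (cball 0 (r + 1)) x)" if "\<bar>s\<bar> \<le> 1" for x s
  proof -
    have "norm (\<phi> (x + s *\<^sub>R unit_vec2 i) - \<phi> (x + 0 *\<^sub>R unit_vec2 i)) \<le> M * indicat_real (cball 0 (r + 1)) x * norm (s - 0)"
    proof (rule field_differentiable_bound[where S = "{-1..1}" and f' = "\<lambda>s. partial i \<phi> (x + s *\<^sub>R unit_vec2 i)"])
      fix t :: real assume t: "t \<in> {-1..1}"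
      have "norm x \<le> r + 1" if "norm (x + t *\<^sub>R unit_vec2 i) \<le> r"
      proof -
        have "norm x \<le> norm (x + t *\<^sub>R unit_vec2 i) + norm (t *\<^sub>R unit_vec2 i)"
          using norm_triangle_ineq4[of "x + t *\<^sub>R unit_vec2 i" "t *\<^sub>R unit_vec2 i"] by simp
        moreover have "\<bar>t\<bar> \<le> 1" using t by auto
        ultimately show ?thesis using that by (simp add: norm_axis_1)
      qed
      then have "indicat_real (cball 0 r) (x + t *\<^sub>R unit_vec2 i) \<le> indicat_real (cball 0 (r + 1)) x"
        by (auto simp: indicator_def)
      then have "M * indicat_real (cball 0 r) (x + t *\<^sub>R unit_vec2 i) \<le> M * indicat_real (cball 0 (r + 1)) x"
        using M(1) by (rule mult_left_mono)
      then show "norm (partial i \<phi> (x + t *\<^sub>R unit_vec2 i)) \<le> M * indicat_real (cball 0 (r + 1)) x"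
        using M(3)[of "x + t *\<^sub>R unit_vec2 i"] by simp
    qed (use der that in auto)
    then show ?thesis by (simp add: mult.commute)
  qed
  then show ?thesis by (rule that)
qed

text \<open>The translation acts on the test field, where the difference quotients converge under an
  integrable bound; the weak derivative then trades the derivative of the test function for
  -g.\<close>

lemma inner_test_field_shift_derivative:
  assumes \<phi>: "test_function \<phi>" and wd: "weak_deriv i u g"
  shows "((\<lambda>t. inner u (shift (t *\<^sub>R unit_vec2 i) (test_field \<phi> e))) has_real_derivative
      - inner g (shift (t *\<^sub>R unit_vec2 i) (test_field \<phi> e))) (at t)"
proof -
  \<comment> \<open>Absorbing t into the test function reduces the claim to the derivative at
    0.\<close>
  define \<psi> where "\<psi> x = \<phi> (x + t *\<^sub>R unit_vec2 i)" for x
  have \<psi>: "test_function \<psi>" unfolding \<psi>_def by (rule test_function_translate[OF \<phi>])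
  obtain f where f: "f \<in> L2" "u = abs_lsq f" by (rule lsq_cases)
  note [measurable] = L2_measurable[OF f(1)] test_functionD(4)[OF \<psi>] test_functionD(4)[OF test_functionD(3)[OF \<psi>]]
  obtain M r where M: "\<And>x s. \<bar>s\<bar> \<le> 1 \<Longrightarrow> \<bar>\<psi> (x + s *\<^sub>R unit_vec2 i) - \<psi> x\<bar> \<le> \<bar>s\<bar> * (M * indicat_real (cball 0 r) x)"
    using test_function_quotient_bound[OF \<psi>] by blast
  define I where "I s = inner u (test_field (\<lambda>x. \<psi> (x + s *\<^sub>R unit_vec2 i)) e)" for s
  have lim: "((\<lambda>s. (I s - I 0) / s) \<longlongrightarrow> inner u (test_field (partial i \<psi>) e)) (at 0)"
    unfolding tendsto_at_iff_sequentially o_def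
  proof (intro allI impI)
    fix X :: "nat \<Rightarrow> real" assume X: "\<forall>n. X n \<in> UNIV - {0}" "X \<longlonglongrightarrow> 0"
    \<comment> \<open>The dominating function covers only steps of size at most 1, so an initial
      segment of X is discarded.\<close>
    then obtain N where N: "\<And>n. n \<ge> N \<Longrightarrow> \<bar>X n\<bar> \<le> 1"
    proof -
      have "\<forall>\<^sub>F n in sequentially. \<bar>X n\<bar> < 1"
        using order_tendstoD(2)[OF tendsto_rabs[OF X(2)], of 1] by simp
      then show ?thesis
        unfolding eventually_sequentially using that by (meson less_imp_le)
    qed
    define q where "q n x = (\<psi> (x + X (n + N) *\<^sub>R unit_vec2 i) - \<psi> x) / X (n + N)" for n x
    have int: "integrable lborel (\<lambda>x. M * indicat_real (cball 0 r) x * \<bar>inner (f x) e\<bar>)"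
    proof -
      have "(\<lambda>x. indicat_real (cball 0 r) x *\<^sub>R e) \<in> L2"
        by (rule L2_bounded_support[where M = "norm e" and r = r]) (auto simp: indicator_def)
      then have "integrable lborel (\<lambda>x. M * \<bar>inner (f x) (indicat_real (cball 0 r) x *\<^sub>R e)\<bar>)"
        by (intro integrable_mult_right integrable_abs L2_inner_integrable f)
      then show ?thesis by (simp add: abs_mult mult_ac)
    qed
    have "(\<lambda>n. \<integral>x. q n x * inner (f x) e \<partial>lborel) \<longlonglongrightarrow> (\<integral>x. partial i \<psi> x * inner (f x) e \<partial>lborel)"
    proof (rule integral_dominated_convergence[OF _ _ int])
      show "AE x in lborel. (\<lambda>n. q n x * inner (f x) e) \<longlonglongrightarrow> partial i \<psi> x * inner (f x) e"
      proof (rule AE_I2, rule tendsto_mult_right)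
        fix x
        have "((\<lambda>s. \<psi> (x + s *\<^sub>R unit_vec2 i)) has_real_derivative partial i \<psi> x) (at 0)"
          using test_function_line_derivative[OF \<psi>, of x i 0] by simp
        then have "((\<lambda>s. (\<psi> (x + s *\<^sub>R unit_vec2 i) - \<psi> x) / s) \<longlongrightarrow> partial i \<psi> x) (at 0)"
          by (simp add: has_field_derivative_iff)
        then have "(\<lambda>n. (\<psi> (x + X n *\<^sub>R unit_vec2 i) - \<psi> x) / X n) \<longlonglongrightarrow> partial i \<psi> x"
          unfolding tendsto_at_iff_sequentially o_def using X by blast
        then show "(\<lambda>n. q n x) \<longlonglongrightarrow> partial i \<psi> x"
          unfolding q_def by (rule LIMSEQ_ignore_initial_segment)
      qed
      show "AE x in lborel. norm (q n x * inner (f x) e) \<le> M * indicat_real (cball 0 r) x * \<bar>inner (f x) e\<bar>" for n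
      proof (rule AE_I2)
        fix x
        have "\<bar>q n x\<bar> \<le> M * indicat_real (cball 0 r) x"
          using M[of "X (n + N)" x] N[of "n + N"] X(1) by (auto simp: q_def divide_le_eq mult.commute)
        then show "norm (q n x * inner (f x) e) \<le> M * indicat_real (cball 0 r) x * \<bar>inner (f x) e\<bar>"
          by (simp add: abs_mult mult_right_mono)
      qed
    qed (auto simp: q_def)
    moreover have "(\<integral>x. q n x * inner (f x) e \<partial>lborel) = (I (X (n + N)) - I 0) / X (n + N)" for n
    proof -
      have int: "integrable lborel (\<lambda>x. \<psi> (x + c) * inner (f x) e)" for c
        using L2_inner_integrable[OF f(1) test_function_L2[OF test_function_translate[OF \<psi>, of c], of e]] by simp
      have "I (X (n + N)) - I 0 = (\<integral>x. \<psi> (x + X (n + N) *\<^sub>R unit_vec2 i) * inner (f x) e - \<psi> (x + 0) * inner (f x) e \<partial>lborel)"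
        using int[of 0] int[of "X (n + N) *\<^sub>R unit_vec2 i"]
        by (simp add: I_def f(2) inner_test_field f(1) test_function_translate \<psi> Bochner_Integration.integral_diff)
      then show ?thesis
        by (simp add: q_def left_diff_distrib diff_divide_distrib flip: integral_divide_zero)
    qed
    ultimately have "(\<lambda>n. (I (X (n + N)) - I 0) / X (n + N)) \<longlonglongrightarrow> (\<integral>x. partial i \<psi> x * inner (f x) e \<partial>lborel)"
      by simp
    then show "(\<lambda>n. (I (X n) - I 0) / X n) \<longlonglongrightarrow> inner u (test_field (partial i \<psi>) e)"
      using LIMSEQ_offset[of "\<lambda>n. (I (X n) - I 0) / X n" N]
      by (simp add: f inner_test_field test_functionD(3)[OF \<psi>])
  qed
  have I: "inner u (shift ((t + s) *\<^sub>R unit_vec2 i) (test_field \<phi> e)) = I s" for s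
    by (simp add: I_def \<psi>_def shift_test_field \<phi> algebra_simps scaleR_add_left)
  have "shift (t *\<^sub>R unit_vec2 i) (test_field \<phi> e) = test_field \<psi> e"
    by (simp add: shift_test_field[OF \<phi>] \<psi>_def[abs_def])
  moreover have "inner u (test_field (partial i \<psi>) e) = - inner g (test_field \<psi> e)"
    using wd \<psi> by (simp add: weak_deriv_def)
  ultimately show ?thesis
    unfolding DERIV_def I using lim I[of 0] by simp
qed

text \<open>For v in the span of the test fields, t |-> (u, shift v) has a derivative bounded by |g|
  |v|, and the mean value inequality applies. Density then allows v to approach the difference shift
  u - u itself.\<close>

lemma norm_shift_diff_le:
  assumes "weak_deriv i u g"
  shows "norm (shift (h *\<^sub>R unit_vec2 i) u - u) \<le> \<bar>h\<bar> * norm g"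
proof -
  let ?S = "span {test_field \<phi> e | \<phi> e. test_function \<phi>}"
  have der: "((\<lambda>t. inner u (shift (t *\<^sub>R unit_vec2 i) v)) has_real_derivative
      - inner g (shift (t *\<^sub>R unit_vec2 i) v)) (at t)" if "v \<in> ?S" for v t
    using that
  proof (induction rule: span_induct_alt)
    case base
    have "shift c 0 = 0" for c using shift_scaleR[of c 0 0] by simp
    then show ?case by simp
  next
    case (step c x y)
    then obtain \<phi> e where x: "x = test_field \<phi> e" "test_function \<phi>" by blast
    show ?case
      using inner_test_field_shift_derivative[OF x(2) assms, of e t] step.IH
      by (auto simp: x(1) shift_add shift_scaleR inner_add_right intro!: derivative_eq_intros)
  qed
  have bound: "\<bar>inner (shift (h *\<^sub>R unit_vec2 i) u - u) v\<bar> \<le> \<bar>h\<bar> * norm g * norm v" if "v \<in> ?S" for v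
  proof -
    \<comment> \<open>The sign of h changes because the adjoint of a translation is the opposite
      translation.\<close>
    have "norm (inner u (shift ((- h) *\<^sub>R unit_vec2 i) v) - inner u (shift (0 *\<^sub>R unit_vec2 i) v))
        \<le> (norm g * norm v) * norm (- h - 0)"
    proof (rule field_differentiable_bound[where S = UNIV and f' = "\<lambda>t. - inner g (shift (t *\<^sub>R unit_vec2 i) v)"])
      show "norm (- inner g (shift (t *\<^sub>R unit_vec2 i) v)) \<le> norm g * norm v" for t
        using order_trans[OF Cauchy_Schwarz_ineq2 mult_left_mono[OF norm_shift norm_ge_zero]] by simp
    qed (use der[OF that] in auto)
    then show ?thesis
      by (simp add: inner_diff_left inner_shift mult_ac)
  qed
  let ?d = "shift (h *\<^sub>R unit_vec2 i) u - u"
  have "?d \<in> closure ?S" using test_fields_dense by blast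
  then obtain V where V: "\<And>n. V n \<in> ?S" "V \<longlonglongrightarrow> ?d" unfolding closure_sequential by blast
  have "\<bar>inner ?d ?d\<bar> \<le> \<bar>h\<bar> * norm g * norm ?d"
  proof (rule LIMSEQ_le)
    show "(\<lambda>n. \<bar>inner ?d (V n)\<bar>) \<longlonglongrightarrow> \<bar>inner ?d ?d\<bar>" "(\<lambda>n. \<bar>h\<bar> * norm g * norm (V n)) \<longlonglongrightarrow> \<bar>h\<bar> * norm g * norm ?d"
      by (intro tendsto_intros V(2))+
  qed (use bound[OF V(1)] in blast)
  then have "norm ?d * norm ?d \<le> \<bar>h\<bar> * norm g * norm ?d"
    by (simp add: power2_eq_square flip: power2_norm_eq_inner)
  then show ?thesis by (cases "?d = 0") auto
qed

lemma norm_jet_le: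
  fixes p :: jet
  assumes "p = (u, a, b, c)"
  shows "norm u \<le> norm p" "norm a \<le> norm p" "norm b \<le> norm p" "norm c \<le> norm p"
  using norm_fst_prod_le[of p] norm_snd_prod_le[of p] norm_fst_prod_le[of "snd p"] norm_snd_prod_le[of "snd p"]
    norm_fst_prod_le[of "snd (snd p)"] norm_snd_prod_le[of "snd (snd p)"]
  unfolding assms by simp_all

lemma norm_shift_jet:
  assumes "p \<in> jets"
  shows "norm (shift v (fst p) - fst p) \<le> (\<bar>v $ 1\<bar> + \<bar>v $ 2\<bar>) * norm p"
proof -
  obtain u a b c where p: "p = (u, a, b, c)" using prod_cases4 by blast
  have wd: "weak_deriv 1 u a" "weak_deriv 2 u b" using assms by (simp_all add: jets_def p)
  have v: "v = (v $ 2) *\<^sub>R unit_vec2 2 + (v $ 1) *\<^sub>R unit_vec2 1"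
    by (simp add: field_eq_iff forall_2 axis_def)
  let ?s1 = "shift ((v $ 1) *\<^sub>R unit_vec2 1)" and ?s2 = "shift ((v $ 2) *\<^sub>R unit_vec2 2)"
  \<comment> \<open>The displacement is split into two steps along the axes, each governed by one
    weak derivative.\<close>
  have "shift v u = ?s2 (?s1 u)"
    by (subst v) (simp add: shift_shift)
  then have "norm (shift v u - u) = norm (?s2 (?s1 u - u) + (?s2 u - u))"
    by (simp add: shift_diff)
  also have "\<dots> \<le> norm (?s1 u - u) + norm (?s2 u - u)"
    by (rule order_trans[OF norm_triangle_ineq add_right_mono[OF norm_shift]])
  also have "\<dots> \<le> \<bar>v $ 1\<bar> * norm a + \<bar>v $ 2\<bar> * norm b"
    by (intro add_mono norm_shift_diff_le wd)
  also have "\<dots> \<le> \<bar>v $ 1\<bar> * norm p + \<bar>v $ 2\<bar> * norm p"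
    by (intro add_mono mult_left_mono norm_jet_le[OF p]) auto
  finally show ?thesis by (simp add: p algebra_simps)
qed

section \<open>Finite-rank approximation by cell averages\<close>

lemma herm_axis: "herm u (r *\<^sub>R axis i 1) = r *\<^sub>R (u $ i)"
proof -
  have "cnj ((r *\<^sub>R axis i 1 :: complex^2) $ j) = (if j = i then of_real r else 0)" for j
    by (simp add: axis_def complex_eq_iff)
  then have "herm u (r *\<^sub>R axis i 1) = (\<Sum>j\<in>UNIV. u $ j * (if j = i then of_real r else 0))"
    unfolding herm_def by (simp only:)
  then show ?thesis
    by (simp add: scaleR_conv_of_real[where 'a = complex] if_distrib mult.commute cong: if_cong)
qed

locale cell_grid =
  fixes \<delta> :: real and N :: nat
  assumes \<delta>: "\<delta> > 0" and N: "N > 0"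
begin

text \<open>Half-open, so that every point of the plane lies in exactly one cell.\<close>

definition cell :: "int \<times> int \<Rightarrow> (real^2) set" where
  "cell p = {x. of_int (fst p) * \<delta> \<le> x $ 1 \<and> x $ 1 < (of_int (fst p) + 1) * \<delta>
    \<and> of_int (snd p) * \<delta> \<le> x $ 2 \<and> x $ 2 < (of_int (snd p) + 1) * \<delta>}"

definition grid :: "(int \<times> int) set" where
  "grid = {- int N..<int N} \<times> {- int N..<int N}"

lemma finite_grid: "finite grid"
  by (simp add: grid_def)

lemma mem_cell_iff: "x \<in> cell p \<longleftrightarrow> p = (\<lfloor>x $ 1 / \<delta>\<rfloor>, \<lfloor>x $ 2 / \<delta>\<rfloor>)"
proof -
  have "k = \<lfloor>t / \<delta>\<rfloor> \<longleftrightarrow> of_int k * \<delta> \<le> t \<and> t < (of_int k + 1) * \<delta>" for k t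
    using \<delta> by (auto simp: eq_commute[of k] floor_eq_iff pos_le_divide_eq pos_divide_less_eq)
  then show ?thesis by (cases p) (auto simp: cell_def)
qed

lemma cell_measurable [measurable]: "cell p \<in> sets borel"
  unfolding cell_def by measurable

text \<open>The cell lies between an open and a closed box of equal measure.\<close>

lemma emeasure_cell: "emeasure lborel (cell p) = ennreal (\<delta>\<^sup>2)"
proof -
  define a :: "real^2" where "a = (\<chi> i. if i = 1 then of_int (fst p) * \<delta> else of_int (snd p) * \<delta>)"
  define b :: "real^2" where "b = (\<chi> i. a $ i + \<delta>)"
  have sub: "box a b \<subseteq> cell p" "cell p \<subseteq> cbox a b"
    by (auto simp: a_def b_def cell_def mem_box_cart forall_2 algebra_simps)
  have "emeasure lborel (cbox a b) = emeasure lborel (box a b)"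
    by (simp add: emeasure_lborel_box_eq emeasure_lborel_cbox_eq)
  then have "emeasure lborel (cell p) = emeasure lborel (cbox a b)"
    using emeasure_mono[OF sub(1), of lborel] emeasure_mono[OF sub(2), of lborel] by (intro antisym) auto
  also have "\<dots> = ennreal (measure lborel (cbox a b))"
    using emeasure_lborel_cbox_finite[of a b] by (intro emeasure_eq_ennreal_measure) auto
  also have "measure lborel (cbox a b) = (\<Prod>i\<in>UNIV. b $ i - a $ i)"
    using \<delta> by (intro content_cbox_cart) (simp add: interval_ne_empty_cart b_def)
  also have "\<dots> = \<delta>\<^sup>2" by (simp add: b_def)
  finally show ?thesis .
qed

lemma integrable_cell: "integrable lborel (indicat_real (cell p))"
  and measure_cell: "measure lborel (cell p) = \<delta>\<^sup>2"
  using emeasure_cell[of p] by (auto simp: measure_def)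

section \<open>Cell averages and their error\<close>

definition cell_average :: "field2 \<Rightarrow> int \<times> int \<Rightarrow> complex^2" where
  "cell_average f p = (1 / \<delta>\<^sup>2) *\<^sub>R (\<integral>x. indicat_real (cell p) x *\<^sub>R f x \<partial>lborel)"

definition averaged :: "field2 \<Rightarrow> field2" where
  "averaged f x = (\<Sum>p\<in>grid. indicat_real (cell p) x *\<^sub>R cell_average f p)"

lemma integrable_on_cell:
  assumes "f \<in> L2"
  shows "integrable lborel (\<lambda>x. indicat_real (cell p) x *\<^sub>R f x)"
    and "integrable lborel (\<lambda>x. indicat_real (cell p) x * (norm (f x))\<^sup>2)"
proof -
  note [measurable] = L2_measurable[OF assms]
  show "integrable lborel (\<lambda>x. indicat_real (cell p) x *\<^sub>R f x)"
  proof (rule Bochner_Integration.integrable_bound)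
    show "integrable lborel (\<lambda>x. indicat_real (cell p) x + (norm (f x))\<^sup>2)"
      using assms by (intro Bochner_Integration.integrable_add integrable_cell) (simp add: L2_iff)
    have "t \<le> 1 + t\<^sup>2" for t :: real
      using sum_squares_bound[of 1 t] by (simp add: power2_eq_square) (smt (verit) zero_le_square)
    then show "AE x in lborel. norm (indicat_real (cell p) x *\<^sub>R f x) \<le> norm (indicat_real (cell p) x + (norm (f x))\<^sup>2)"
      by (auto simp: indicator_def)
  qed simp
  show "integrable lborel (\<lambda>x. indicat_real (cell p) x * (norm (f x))\<^sup>2)"
    using integrable_mult_indicator[of "cell p" lborel "\<lambda>x. (norm (f x))\<^sup>2"] assms by (simp add: L2_iff)
qed

lemma averaged_L2: "averaged f \<in> L2"
  unfolding averaged_def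
proof (rule L2_sum)
  fix p
  have "integrable lborel (\<lambda>x. indicat_real (cell p) x * (norm (cell_average f p))\<^sup>2)"
    by (intro integrable_mult_left integrable_cell)
  moreover have "(norm (indicat_real (cell p) x *\<^sub>R cell_average f p))\<^sup>2
      = indicat_real (cell p) x * (norm (cell_average f p))\<^sup>2" for x
    by (simp add: indicator_def)
  ultimately show "(\<lambda>x. indicat_real (cell p) x *\<^sub>R cell_average f p) \<in> L2"
    by (simp add: L2_iff)
qed

text \<open>The mean over a cell minimises the quadratic deviation, which gives Jensen's inequality without Cauchy-Schwarz.\<close>

lemma cell_average_deviation:
  assumes f: "f \<in> L2"
  shows "ennreal (\<delta>\<^sup>2 * (norm (v - cell_average f p))\<^sup>2) \<le> (\<integral>\<^sup>+y. ennreal (indicat_real (cell p) y * (norm (f y - v))\<^sup>2) \<partial>lborel)"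
proof -
  let ?c = "indicat_real (cell p)" and ?a = "cell_average f p"
  note int = integrable_on_cell[OF f, of p]
  have int3: "integrable lborel (\<lambda>y. ?c y * inner (f y) t)" for t
    using integrable_inner_left[OF int(1), of t] by simp
  have "(\<lambda>y. ?c y * (norm (f y - v))\<^sup>2)
      = (\<lambda>y. ?c y * (norm (f y))\<^sup>2 - 2 * (?c y * inner (f y) v) + (norm v)\<^sup>2 * ?c y)"
    by (simp add: fun_eq_iff power2_norm_eq_inner inner_diff_left inner_diff_right inner_commute algebra_simps)
  then have intk: "integrable lborel (\<lambda>y. ?c y * (norm (f y - v))\<^sup>2)"
    using int(2) int3 integrable_cell by simp
  have a: "(\<integral>y. ?c y * inner (f y) t \<partial>lborel) = \<delta>\<^sup>2 * inner ?a t" for t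
    using integral_inner_left[OF int(1), of t] \<delta> by (simp add: cell_average_def)
  have "(\<integral>y. s * ?c y - 2 * (?c y * inner (f y) d) \<partial>lborel) = s * \<delta>\<^sup>2 - 2 * (\<delta>\<^sup>2 * inner ?a d)" for s d
    using int3[of d] integrable_cell[of p] by (simp add: measure_cell a)
  \<comment> \<open>With a the cell average, the integrand lies below that of the right-hand side
    because on the cell the difference is |a - f y|^2. Its integral is \<delta>^2 |v - a|^2, the
    inner products cancelling since a is the mean.\<close>
  then have "\<delta>\<^sup>2 * (norm (v - ?a))\<^sup>2 = (\<integral>y. ((norm (v - ?a))\<^sup>2 + 2 * inner ?a (v - ?a)) * ?c y - 2 * (?c y * inner (f y) (v - ?a)) \<partial>lborel)"
    by (simp only:) (simp add: algebra_simps)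
  also have "\<dots> \<le> (\<integral>y. ?c y * (norm (f y - v))\<^sup>2 \<partial>lborel)"
  proof (rule integral_mono)
    fix y
    have "0 \<le> (norm (?a - f y))\<^sup>2" by simp
    also have "(norm (?a - f y))\<^sup>2 = (norm (f y - v))\<^sup>2 - ((norm (v - ?a))\<^sup>2 + 2 * inner ?a (v - ?a) - 2 * inner (f y) (v - ?a))"
      by (simp add: power2_norm_eq_inner inner_diff_left inner_diff_right inner_commute algebra_simps)
    finally show "((norm (v - ?a))\<^sup>2 + 2 * inner ?a (v - ?a)) * ?c y - 2 * (?c y * inner (f y) (v - ?a)) \<le> ?c y * (norm (f y - v))\<^sup>2"
      by (cases "y \<in> cell p") auto
  qed (use intk int3 integrable_cell in auto)
  finally have "ennreal (\<delta>\<^sup>2 * (norm (v - ?a))\<^sup>2) \<le> ennreal (\<integral>y. ?c y * (norm (f y - v))\<^sup>2 \<partial>lborel)"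
    by (rule ennreal_leI)
  also have "\<dots> = (\<integral>\<^sup>+y. ennreal (?c y * (norm (f y - v))\<^sup>2) \<partial>lborel)"
    by (rule nn_integral_eq_integral[OF intk, symmetric]) simp
  finally show ?thesis .
qed

lemma averaged_inside: "p \<in> grid \<Longrightarrow> x \<in> cell p \<Longrightarrow> averaged f x = cell_average f p"
proof -
  assume p: "p \<in> grid" and x: "x \<in> cell p"
  have "averaged f x = (\<Sum>q\<in>grid. if q = p then cell_average f p else 0)"
    unfolding averaged_def using x by (intro sum.cong) (auto simp: indicator_def mem_cell_iff)
  then show ?thesis using p finite_grid by simp
qed

lemma averaged_outside:
  assumes "\<And>p. p \<in> grid \<Longrightarrow> x \<notin> cell p"
  shows "averaged f x = 0" and "real N * \<delta> \<le> norm x"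
proof -
  show "averaged f x = 0" unfolding averaged_def using assms by (simp add: indicator_def)
  have "(\<lfloor>x $ 1 / \<delta>\<rfloor>, \<lfloor>x $ 2 / \<delta>\<rfloor>) \<notin> grid" using assms mem_cell_iff by blast
  then obtain i where "\<lfloor>x $ i / \<delta>\<rfloor> < - int N \<or> int N \<le> \<lfloor>x $ i / \<delta>\<rfloor>"
    by (fastforce simp: grid_def not_less not_le)
  then have "x $ i / \<delta> < - real N \<or> real N \<le> x $ i / \<delta>"
    by (auto simp: floor_less_iff le_floor_iff)
  then have "real N * \<delta> \<le> \<bar>x $ i\<bar>"
    using \<delta> by (auto simp: pos_divide_less_eq pos_le_divide_eq)
  also have "\<dots> \<le> norm x" by (rule component_le_norm_cart)
  finally show "real N * \<delta> \<le> norm x" .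
qed

text \<open>Contains all differences of two points of one cell and does not depend on the cell,
  which allows the order of integration to be exchanged in
  \<open>averaged_jet_error\<close>.\<close>

definition square :: "(real^2) set" where
  "square = {h. \<bar>h $ 1\<bar> \<le> \<delta> \<and> \<bar>h $ 2\<bar> \<le> \<delta>}"

lemma square_measurable [measurable]: "square \<in> sets borel"
  unfolding square_def by measurable

lemma emeasure_square: "emeasure lborel square = ennreal (4 * \<delta>\<^sup>2)"
proof -
  define b :: "real^2" where "b = (\<chi> i. \<delta>)"
  have "square = cbox (- b) b"
    by (auto simp: square_def b_def mem_box_cart forall_2)
  moreover have "emeasure lborel (cbox (- b) b) = ennreal (measure lborel (cbox (- b) b))"
    using emeasure_lborel_cbox_finite[of "- b" b] by (intro emeasure_eq_ennreal_measure) auto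
  moreover have "measure lborel (cbox (- b) b) = (\<Prod>i\<in>UNIV. b $ i - (- b) $ i)"
    using \<delta> by (intro content_cbox_cart) (simp add: interval_ne_empty_cart b_def)
  moreover have "(\<Prod>i\<in>UNIV. b $ i - (- b) $ i) = 4 * \<delta>\<^sup>2" by (simp add: b_def power2_eq_square)
  ultimately show ?thesis by simp
qed

text \<open>In a cell of the grid the first term bounds the deviation from the mean. Off the grid
  the averaged field is 0 and |x| is at least N \<delta>, which gives the second term.\<close>

lemma averaged_pointwise:
  assumes f: "f \<in> L2"
  shows "ennreal ((norm (f x - averaged f x))\<^sup>2) \<le>
    ennreal (1 / \<delta>\<^sup>2) * (\<integral>\<^sup>+h. indicator square h * ennreal ((norm (f (x + h) - f x))\<^sup>2) \<partial>lborel)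
    + ennreal (1 / (real N * \<delta>)\<^sup>2) * ennreal ((norm (norm x *\<^sub>R f x))\<^sup>2)"
proof (cases "\<exists>p\<in>grid. x \<in> cell p")
  case True
  then obtain p where p: "p \<in> grid" "x \<in> cell p" by blast
  note [measurable] = L2_measurable[OF f]
  have "ennreal ((norm (f x - averaged f x))\<^sup>2) = ennreal (1 / \<delta>\<^sup>2) * ennreal (\<delta>\<^sup>2 * (norm (f x - cell_average f p))\<^sup>2)"
    using \<delta> by (simp add: averaged_inside[OF p] flip: ennreal_mult)
  also have "\<dots> \<le> ennreal (1 / \<delta>\<^sup>2) * (\<integral>\<^sup>+y. ennreal (indicat_real (cell p) y * (norm (f y - f x))\<^sup>2) \<partial>lborel)"
    by (intro mult_left_mono cell_average_deviation f) simp
  also have "(\<integral>\<^sup>+y. ennreal (indicat_real (cell p) y * (norm (f y - f x))\<^sup>2) \<partial>lborel)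
      = (\<integral>\<^sup>+h. ennreal (indicat_real (cell p) (h + x) * (norm (f (h + x) - f x))\<^sup>2) \<partial>lborel)"
    by (rule nn_integral_translate[symmetric]) measurable
  also have "\<dots> \<le> (\<integral>\<^sup>+h. indicator square h * ennreal ((norm (f (x + h) - f x))\<^sup>2) \<partial>lborel)"
  proof (rule nn_integral_mono)
    fix h
    have "h \<in> square" if "h + x \<in> cell p"
      using that p(2) by (auto simp: cell_def square_def abs_le_iff algebra_simps)
    then show "ennreal (indicat_real (cell p) (h + x) * (norm (f (h + x) - f x))\<^sup>2)
        \<le> indicator square h * ennreal ((norm (f (x + h) - f x))\<^sup>2)"
      by (auto simp: indicator_def add.commute)
  qed
  finally show ?thesis
    by (meson add_increasing2 le_add_same_cancel1 mult_left_mono order_trans zero_le)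
next
  case False
  then have *: "averaged f x = 0" "real N * \<delta> \<le> norm x" using averaged_outside by blast+
  have R: "0 < real N * \<delta>" using \<delta> N by simp
  have "(real N * \<delta>)\<^sup>2 * (norm (f x))\<^sup>2 \<le> (norm x)\<^sup>2 * (norm (f x))\<^sup>2"
    using R *(2) by (intro mult_right_mono power_mono) auto
  then have "(norm (f x))\<^sup>2 \<le> 1 / (real N * \<delta>)\<^sup>2 * (norm (norm x *\<^sub>R f x))\<^sup>2"
  proof -
    have "(norm (f x))\<^sup>2 \<le> ((norm x)\<^sup>2 * (norm (f x))\<^sup>2) / (real N * \<delta>)\<^sup>2"
      using R \<open>(real N * \<delta>)\<^sup>2 * (norm (f x))\<^sup>2 \<le> (norm x)\<^sup>2 * (norm (f x))\<^sup>2\<close>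
      by (subst pos_le_divide_eq) (use N in \<open>auto simp: mult.commute\<close>)
    then show ?thesis by (simp add: power_mult_distrib)
  qed
  then have "ennreal ((norm (f x - averaged f x))\<^sup>2) \<le> ennreal (1 / (real N * \<delta>)\<^sup>2 * (norm (norm x *\<^sub>R f x))\<^sup>2)"
    by (intro ennreal_leI) (simp add: *)
  also have "\<dots> = ennreal (1 / (real N * \<delta>)\<^sup>2) * ennreal ((norm (norm x *\<^sub>R f x))\<^sup>2)"
    by (rule ennreal_mult) auto
  finally show ?thesis by (rule add_increasing[OF zero_le])
qed

text \<open>After exchanging the integrals the first term involves translates: for h in
  \<open>square\<close> the change of u is at most 2 \<delta> times the jet norm, the square has
  area 4 \<delta>^2, and division by \<delta>^2 leaves 16 \<delta>^2. The second term is controlled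
  by the weight component of the jet.\<close>

lemma averaged_jet_error:
  assumes p: "p \<in> jets" and f: "f \<in> L2" "abs_lsq f = fst p"
  shows "(norm (abs_lsq (\<lambda>x. f x - averaged f x)))\<^sup>2 \<le> (16 * \<delta>\<^sup>2 + 1 / (real N * \<delta>)\<^sup>2) * (norm p)\<^sup>2"
proof -
  note [measurable] = L2_measurable[OF f(1)]
  obtain u a b c where uabc: "p = (u, a, b, c)" using prod_cases4 by blast
  have "(\<integral>\<^sup>+x. ennreal ((norm (f (x + h) - f x))\<^sup>2) \<partial>lborel) \<le> ennreal ((2 * \<delta> * norm p)\<^sup>2)" if "h \<in> square" for h
  proof -
    have "(\<integral>\<^sup>+x. ennreal ((norm (f (x + h) - f x))\<^sup>2) \<partial>lborel) = ennreal ((norm (shift h (fst p) - fst p))\<^sup>2)"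
      using f by (simp add: nn_integral_norm_abs_lsq L2_diff shift_L2 abs_lsq_diff shift_abs flip: f(2))
    also have "\<dots> \<le> ennreal ((2 * \<delta> * norm p)\<^sup>2)"
    proof (intro ennreal_leI power_mono norm_ge_zero)
      have "(\<bar>h $ 1\<bar> + \<bar>h $ 2\<bar>) * norm p \<le> 2 * \<delta> * norm p"
        using that by (intro mult_right_mono) (auto simp: square_def)
      then show "norm (shift h (fst p) - fst p) \<le> 2 * \<delta> * norm p"
        using norm_shift_jet[OF p, of h] by linarith
    qed
    finally show ?thesis .
  qed
  then have "(\<integral>\<^sup>+h. (\<integral>\<^sup>+x. indicator square h * ennreal ((norm (f (x + h) - f x))\<^sup>2) \<partial>lborel) \<partial>lborel)
      \<le> (\<integral>\<^sup>+h. ennreal ((2 * \<delta> * norm p)\<^sup>2) * indicator square h \<partial>lborel)"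
    by (intro nn_integral_mono) (auto simp: indicator_def)
  also have "\<dots> = ennreal ((2 * \<delta> * norm p)\<^sup>2) * ennreal (4 * \<delta>\<^sup>2)"
    by (simp add: nn_integral_cmult_indicator emeasure_square)
  also have "\<dots> = ennreal (16 * \<delta> ^ 4 * (norm p)\<^sup>2)"
  proof -
    have eq: "(2 * \<delta> * norm p)\<^sup>2 * (4 * \<delta>\<^sup>2) = 16 * \<delta> ^ 4 * (norm p)\<^sup>2"
      by (simp add: power2_eq_square power4_eq_xxxx mult_ac)
    show ?thesis unfolding eq[symmetric] by (rule ennreal_mult[symmetric]) simp_all
  qed
  finally have 1: "(\<integral>\<^sup>+x. (\<integral>\<^sup>+h. indicator square h * ennreal ((norm (f (x + h) - f x))\<^sup>2) \<partial>lborel) \<partial>lborel)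
      \<le> ennreal (16 * \<delta> ^ 4 * (norm p)\<^sup>2)"
    by (subst lborel_pair.Fubini') measurable
  have "radial (abs_lsq f) (abs_lsq (rep_lsq c))" using p by (simp add: jets_def uabc f)
  then have "AE x in lborel. rep_lsq c x = norm x *\<^sub>R f x"
    using f(1) by (simp add: radial_iff del: abs_rep_lsq)
  then have "(\<integral>\<^sup>+x. ennreal ((norm (norm x *\<^sub>R f x))\<^sup>2) \<partial>lborel) = (\<integral>\<^sup>+x. ennreal ((norm (rep_lsq c x))\<^sup>2) \<partial>lborel)"
    by (intro nn_integral_cong_AE) (auto elim!: eventually_mono)
  also have "\<dots> = ennreal ((norm c)\<^sup>2)" by (simp add: nn_integral_norm_abs_lsq)
  also have "\<dots> \<le> ennreal ((norm p)\<^sup>2)"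
    by (intro ennreal_leI power_mono norm_jet_le[OF uabc]) auto
  finally have 2: "(\<integral>\<^sup>+x. ennreal ((norm (norm x *\<^sub>R f x))\<^sup>2) \<partial>lborel) \<le> ennreal ((norm p)\<^sup>2)" .
  have "ennreal ((norm (abs_lsq (\<lambda>x. f x - averaged f x)))\<^sup>2) = (\<integral>\<^sup>+x. ennreal ((norm (f x - averaged f x))\<^sup>2) \<partial>lborel)"
    by (simp add: nn_integral_norm_abs_lsq L2_diff f averaged_L2)
  also have "\<dots> \<le> (\<integral>\<^sup>+x. ennreal (1 / \<delta>\<^sup>2) * (\<integral>\<^sup>+h. indicator square h * ennreal ((norm (f (x + h) - f x))\<^sup>2) \<partial>lborel)
    + ennreal (1 / (real N * \<delta>)\<^sup>2) * ennreal ((norm (norm x *\<^sub>R f x))\<^sup>2) \<partial>lborel)"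
    by (intro nn_integral_mono averaged_pointwise f)
  also have "\<dots> = ennreal (1 / \<delta>\<^sup>2) * (\<integral>\<^sup>+x. (\<integral>\<^sup>+h. indicator square h * ennreal ((norm (f (x + h) - f x))\<^sup>2) \<partial>lborel) \<partial>lborel)
    + ennreal (1 / (real N * \<delta>)\<^sup>2) * (\<integral>\<^sup>+x. ennreal ((norm (norm x *\<^sub>R f x))\<^sup>2) \<partial>lborel)"
    by (subst nn_integral_add, measurable, measurable, subst nn_integral_cmult, measurable, subst nn_integral_cmult, measurable)
  also have "\<dots> \<le> ennreal (1 / \<delta>\<^sup>2) * ennreal (16 * \<delta> ^ 4 * (norm p)\<^sup>2) + ennreal (1 / (real N * \<delta>)\<^sup>2) * ennreal ((norm p)\<^sup>2)"
    by (intro add_mono mult_left_mono 1 2) auto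
  also have "\<dots> = ennreal ((16 * \<delta>\<^sup>2 + 1 / (real N * \<delta>)\<^sup>2) * (norm p)\<^sup>2)"
  proof -
    have "1 / \<delta>\<^sup>2 * (16 * \<delta> ^ 4 * (norm p)\<^sup>2) = 16 * \<delta>\<^sup>2 * (norm p)\<^sup>2"
      using \<delta> by (simp add: power2_eq_square power4_eq_xxxx)
    then show ?thesis
      by (simp add: distrib_right flip: ennreal_mult ennreal_plus)
  qed
  finally show ?thesis by (simp add: add_nonneg_nonneg)
qed

text \<open>Each component of a cell average is the product of f with a scaled indicator times a
  unit vector; cells and components form a finite index set, numbered afterwards by
  naturals.\<close>

lemma averaged_finite_rank:
  "\<exists>(n::nat) a b. \<forall>f\<in>L2. abs_lsq (averaged f) = (\<Sum>k<n. cinner (abs_lsq f) (a k) *\<^sub>C b k)"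
proof -
  define e where "e i = (axis i 1 :: complex^2)" for i :: 2
  define X where "X = (\<lambda>(p, i) (x::real^2). indicat_real (cell p) x *\<^sub>R e i)"
  define A where "A q = abs_lsq (\<lambda>x. (1 / \<delta>\<^sup>2) *\<^sub>R X q x)" for q
  define B where "B q = abs_lsq (X q)" for q
  have X: "X q \<in> L2" for q
  proof -
    obtain p i where q: "q = (p, i)" by (cases q)
    have "(norm (X q x))\<^sup>2 = indicat_real (cell p) x" for x
      by (simp add: q X_def e_def norm_axis_1 indicator_def)
    moreover have "X q \<in> borel_measurable borel" by (simp add: q X_def)
    ultimately show ?thesis using integrable_cell by (simp add: L2_iff)
  qed
  have coeff: "cinner (abs_lsq f) (A (p, i)) = cell_average f p $ i" if f: "f \<in> L2" for f p i
  proof -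
    have "cinner (abs_lsq f) (A (p, i)) = (\<integral>x. herm (f x) ((1 / \<delta>\<^sup>2) *\<^sub>R X (p, i) x) \<partial>lborel)"
      unfolding A_def using f X by (simp add: L2_scaleR L2_inner_def flip: L2_inner_eq)
    also have "\<dots> = (\<integral>x. (1 / \<delta>\<^sup>2) *\<^sub>R ((indicat_real (cell p) x *\<^sub>R f x) $ i) \<partial>lborel)"
      by (rule Bochner_Integration.integral_cong)
        (simp_all add: X_def e_def herm_axis)
    also have "\<dots> = (1 / \<delta>\<^sup>2) *\<^sub>R ((\<integral>x. indicat_real (cell p) x *\<^sub>R f x \<partial>lborel) $ i)"
      using integral_bounded_linear[OF bounded_linear_vec_nth[of i] integrable_on_cell(1)[OF f, of p]]
      by (simp only: integral_scaleR_right)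
    finally show ?thesis by (simp add: cell_average_def)
  qed
  let ?I = "grid \<times> (UNIV :: 2 set)"
  have "finite ?I" using finite_grid by simp
  then obtain \<sigma> where \<sigma>: "bij_betw \<sigma> {0..<card ?I} ?I" using ex_bij_betw_nat_finite by blast
  have "abs_lsq (averaged f) = (\<Sum>q\<in>?I. cinner (abs_lsq f) (A q) *\<^sub>C B q)" if f: "f \<in> L2" for f
  proof -
    have v: "v = (\<Sum>i\<in>UNIV. (v $ i) *s e i)" for v :: "complex^2"
      by (simp add: field_eq_iff forall_2 sum_2 e_def axis_def)
    have "averaged f x = (\<Sum>q\<in>?I. (case q of (p, i) \<Rightarrow> cell_average f p $ i) *s X q x)" for x
    proof -
      have "indicat_real (cell p) x *\<^sub>R cell_average f p = (\<Sum>i\<in>UNIV. (cell_average f p $ i) *s X (p, i) x)" for p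
        by (subst v[of "cell_average f p"]) (simp add: X_def indicator_def)
      then show ?thesis
        by (simp add: averaged_def sum.cartesian_product case_prod_beta)
    qed
    then have "averaged f = (\<lambda>x. \<Sum>q\<in>?I. (case q of (p, i) \<Rightarrow> cell_average f p $ i) *s X q x)" by blast
    then have "abs_lsq (averaged f) = (\<Sum>q\<in>?I. (case q of (p, i) \<Rightarrow> cell_average f p $ i) *\<^sub>C B q)"
      using X by (simp add: abs_lsq_sum L2_vec_scale abs_lsq_vec_scale B_def)
    also have "\<dots> = (\<Sum>q\<in>?I. cinner (abs_lsq f) (A q) *\<^sub>C B q)"
      by (intro sum.cong) (auto simp: coeff f)
    finally show ?thesis .
  qed
  then have "\<forall>f\<in>L2. abs_lsq (averaged f) = (\<Sum>k<card ?I. cinner (abs_lsq f) (A (\<sigma> k)) *\<^sub>C B (\<sigma> k))"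
    using sum.reindex_bij_betw[OF \<sigma>, of "\<lambda>q. cinner _ (A q) *\<^sub>C B q"] by (simp add: atLeast0LessThan)
  then show ?thesis
    by (intro exI[of _ "card ?I"] exI[of _ "\<lambda>k. A (\<sigma> k)"] exI[of _ "\<lambda>k. B (\<sigma> k)"])
qed

end

lemma osc_inverse_approximable:
  assumes "\<epsilon> > 0"
  shows "\<exists>(n::nat) a b. \<forall>u. norm (osc_inverse u - (\<Sum>k<n. cinner (osc_inverse u) (a k) *\<^sub>C b k)) \<le> \<epsilon> * norm u"
proof -
  \<comment> \<open>Then 16 \<delta>^2 = \<epsilon>^2 / 4, and N is taken so large that 1 / (N
    \<delta>)^2 is at most \<epsilon>^2 / 4 as well.\<close>
  define \<delta> where "\<delta> = \<epsilon> / 8"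
  have \<delta>: "\<delta> > 0" using assms by (simp add: \<delta>_def)
  obtain N :: nat where large: "2 / (\<epsilon> * \<delta>) < real N" using reals_Archimedean2 by blast
  have N0: "N > 0"
    using large mult_pos_pos[OF assms \<delta>] by (intro Nat.gr0I) (simp add: not_less zero_le_divide_iff)
  interpret cell_grid \<delta> N by unfold_locales (use \<delta> N0 in auto)
  have "2 / \<epsilon> < real N * \<delta>"
    using large \<delta> assms by (simp add: pos_divide_less_eq mult_pos_pos mult_ac)
  then have "1 / (real N * \<delta>) \<le> \<epsilon> / 2"
    using \<delta> N0 assms by (simp add: divide_simps mult_ac)
  then have "(1 / (real N * \<delta>))\<^sup>2 \<le> (\<epsilon> / 2)\<^sup>2"
    using \<delta> by (intro power_mono) auto
  then have le: "16 * \<delta>\<^sup>2 + 1 / (real N * \<delta>)\<^sup>2 \<le> \<epsilon>\<^sup>2"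
  proof -
    have "16 * \<delta>\<^sup>2 = \<epsilon>\<^sup>2 / 4" "(\<epsilon> / 2)\<^sup>2 = \<epsilon>\<^sup>2 / 4"
      by (simp_all add: \<delta>_def power2_eq_square)
    moreover have "1 / (real N * \<delta>)\<^sup>2 = (1 / (real N * \<delta>))\<^sup>2"
      by (simp only: power_one_over)
    ultimately show ?thesis
      using \<open>(1 / (real N * \<delta>))\<^sup>2 \<le> (\<epsilon> / 2)\<^sup>2\<close> zero_le_power2[of \<epsilon>] by linarith
  qed
  obtain n :: nat and a b where ab: "\<And>f. f \<in> L2 \<Longrightarrow> abs_lsq (averaged f) = (\<Sum>k<n. cinner (abs_lsq f) (a k) *\<^sub>C b k)"
    using averaged_finite_rank by blast
  have "norm (osc_inverse u - (\<Sum>k<n. cinner (osc_inverse u) (a k) *\<^sub>C b k)) \<le> \<epsilon> * norm u" for u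
  proof -
    let ?f = "rep_lsq (osc_inverse u)"
    have jet: "solution_jet u \<in> jets" using solution_jet[of u] by (simp add: weak_solution_def)
    have "(norm (osc_inverse u - (\<Sum>k<n. cinner (osc_inverse u) (a k) *\<^sub>C b k)))\<^sup>2 = (norm (abs_lsq (\<lambda>x. ?f x - averaged ?f x)))\<^sup>2"
      using ab[of ?f] by (simp add: abs_lsq_diff averaged_L2)
    also have "\<dots> \<le> (16 * \<delta>\<^sup>2 + 1 / (real N * \<delta>)\<^sup>2) * (norm (solution_jet u))\<^sup>2"
      by (rule averaged_jet_error[OF jet]) (simp_all add: osc_inverse_def)
    also have "\<dots> \<le> \<epsilon>\<^sup>2 * (norm u)\<^sup>2"
      by (intro mult_mono le power_mono norm_solution_jet) auto
    finally have "(norm (osc_inverse u - (\<Sum>k<n. cinner (osc_inverse u) (a k) *\<^sub>C b k)))\<^sup>2 \<le> (\<epsilon> * norm u)\<^sup>2"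
      by (simp add: power_mult_distrib)
    then show ?thesis using assms by (simp add: power2_le_iff_abs_le)
  qed
  then show ?thesis by blast
qed

section \<open>The harmonic oscillator\<close>

text \<open>Built from chosen weak derivatives; by \<open>jet_unique\<close> their classes do not
  depend on the choice.\<close>

definition jet_of :: "field2 \<Rightarrow> jet" where
  "jet_of u = (abs_lsq u, abs_lsq (weak_partial 1 u), abs_lsq (weak_partial 2 u), abs_lsq (\<lambda>x. norm x *\<^sub>R u x))"

lemma form_domainD:
  assumes "u \<in> form_domain"
  shows "u \<in> L2" "weak_partial i u \<in> L2" "(\<lambda>x. norm x *\<^sub>R u x) \<in> L2" "jet_of u \<in> jets"
proof -
  show u: "u \<in> L2" and r: "(\<lambda>x. norm x *\<^sub>R u x) \<in> L2"
    using assms by (auto simp: form_domain_def H1_def)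
  have wp: "has_weak_partial i u (weak_partial i u)" for i
    using assms someI_ex[of "has_weak_partial i u"]
    unfolding weak_partial_def form_domain_def H1_def by blast
  then show w: "weak_partial i u \<in> L2" for i by (simp add: has_weak_partial_def)
  have "weak_deriv i (abs_lsq u) (abs_lsq (weak_partial i u))" for i
    using has_weak_partial_iff[OF u w] wp by blast
  then show "jet_of u \<in> jets"
    by (simp add: jets_def jet_of_def radial_iff[OF u r])
qed

text \<open>Together with \<open>form_domainD\<close> this identifies the form domain with the
  representatives of first components of jets.\<close>

lemma form_domain_if_jet:
  assumes u: "u \<in> L2" and p: "p \<in> jets" "fst p = abs_lsq u"
  shows "u \<in> form_domain" "jet_of u = p"
proof -
  obtain a b c where abc: "p = (abs_lsq u, a, b, c)" using p(2) by (cases p) auto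
  have "has_weak_partial 1 u (rep_lsq a)" "has_weak_partial 2 u (rep_lsq b)"
    using p(1) by (simp_all add: has_weak_partial_iff[OF u] jets_def abc)
  then have "\<exists>g. has_weak_partial i u g" for i using exhaust_2[of i] by auto
  moreover have "(\<lambda>x. norm x *\<^sub>R u x) \<in> L2"
  proof -
    note [measurable] = L2_measurable[OF u]
    have "radial (abs_lsq u) (abs_lsq (rep_lsq c))" using p(1) by (simp add: jets_def abc)
    then have "AE x in lborel. rep_lsq c x = norm x *\<^sub>R u x"
      using u by (simp add: radial_iff del: abs_rep_lsq)
    then have "integrable lborel (\<lambda>x. (norm (norm x *\<^sub>R u x))\<^sup>2) \<longleftrightarrow> integrable lborel (\<lambda>x. (norm (rep_lsq c x))\<^sup>2)"
      by (intro integrable_cong_AE) (auto elim!: eventually_mono)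
    moreover have "integrable lborel (\<lambda>x. (norm (rep_lsq c x))\<^sup>2)"
      using rep_lsq[of c] unfolding L2_iff by blast
    ultimately show ?thesis by (simp add: L2_iff)
  qed
  ultimately show fd: "u \<in> form_domain" using u by (simp add: form_domain_def H1_def)
  show "jet_of u = p"
    by (rule jet_unique[OF form_domainD(4)[OF fd] p(1)]) (simp add: jet_of_def p(2))
qed

lemma q_form_jet:
  assumes u: "u \<in> form_domain" and v: "v \<in> form_domain"
    and p: "jet_of u = (u', a, b, c)" and q: "jet_of v = (v', a', b', c')"
  shows "q_form u v = (cinner a a' + cinner b b' + cinner c c') / 2"
proof -
  have herm: "herm (norm x *\<^sub>R s) (norm x *\<^sub>R t) = of_real ((norm x)\<^sup>2) * herm s t" for x :: "real^2" and s t
    by (simp add: herm_def sum_distrib_left scaleR_conv_of_real[where 'a = complex] power2_eq_square mult_ac)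
  note L = form_domainD[OF u] form_domainD[OF v]
  have "q_form u v = (\<integral>x. (herm (weak_partial 1 u x) (weak_partial 1 v x) + herm (weak_partial 2 u x) (weak_partial 2 v x)
      + herm (norm x *\<^sub>R u x) (norm x *\<^sub>R v x)) / 2 \<partial>lborel)"
    unfolding q_form_def by (intro Bochner_Integration.integral_cong) (auto simp: sum_2 herm add_divide_distrib)
  also have "\<dots> = (L2_inner (weak_partial 1 u) (weak_partial 1 v) + L2_inner (weak_partial 2 u) (weak_partial 2 v)
      + L2_inner (\<lambda>x. norm x *\<^sub>R u x) (\<lambda>x. norm x *\<^sub>R v x)) / 2"
    using L by (simp add: L2_inner_def herm_integrable)
  finally show ?thesis
    using L p q by (simp add: L2_inner_eq jet_of_def)
qed

text \<open>The real part of 2 q(u, v) + (u, v) is the inner product of the jets of u and v. Hence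
  q(u, v) = (f, v) for all v says that the jet of u is the weak solution for 2 f + u.\<close>

lemma L_c_iff:
  "(u, f) \<in> L_c \<longleftrightarrow> u \<in> L2 \<and> f \<in> L2 \<and> abs_lsq u = osc_inverse (2 *\<^sub>R abs_lsq f + abs_lsq u)"
proof
  assume A: "(u, f) \<in> L_c"
  then have u: "u \<in> form_domain" and f: "f \<in> L2" and q: "\<And>v. v \<in> form_domain \<Longrightarrow> q_form u v = L2_inner f v"
    by (auto simp: L_c_def)
  have "weak_solution (2 *\<^sub>R abs_lsq f + abs_lsq u) (jet_of u)"
    unfolding weak_solution_def
  proof (intro conjI ballI form_domainD(4)[OF u])
    fix j assume j: "j \<in> jets"
    obtain v a' b' c' where abc': "j = (v, a', b', c')" using prod_cases4 by blast
    have v: "rep_lsq v \<in> form_domain" "jet_of (rep_lsq v) = j"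
      using form_domain_if_jet[OF rep_lsq j] by (auto simp: abc')
    obtain a b c where abc: "jet_of u = (abs_lsq u, a, b, c)" by (simp add: jet_of_def)
    have "(cinner a a' + cinner b b' + cinner c c') / 2 = cinner (abs_lsq f) v"
      using q[OF v(1)] q_form_jet[OF u v(1) abc] v(2) f by (simp add: abc' L2_inner_eq)
    then have "Re ((cinner a a' + cinner b b' + cinner c c') / 2) = Re (cinner (abs_lsq f) v)" by (rule arg_cong)
    then show "inner (jet_of u) j = inner (2 *\<^sub>R abs_lsq f + abs_lsq u) (fst j)"
      by (simp add: abc abc' inner_add_left)
  qed
  then have "osc_inverse (2 *\<^sub>R abs_lsq f + abs_lsq u) = abs_lsq u"
    unfolding osc_inverse_def by (simp add: solution_jet_eq) (simp add: jet_of_def)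
  then show "u \<in> L2 \<and> f \<in> L2 \<and> abs_lsq u = osc_inverse (2 *\<^sub>R abs_lsq f + abs_lsq u)"
    using form_domainD(1)[OF u] f by simp
next
  assume A: "u \<in> L2 \<and> f \<in> L2 \<and> abs_lsq u = osc_inverse (2 *\<^sub>R abs_lsq f + abs_lsq u)"
  define F where "F = 2 *\<^sub>R abs_lsq f + abs_lsq u"
  have S: "solution_jet F \<in> jets" "\<And>q. q \<in> jets \<Longrightarrow> inner (solution_jet F) q = inner F (fst q)"
    using solution_jet[of F] by (auto simp: weak_solution_def)
  have u: "u \<in> form_domain" "jet_of u = solution_jet F"
    using form_domain_if_jet[OF _ S(1), of u] A by (auto simp: osc_inverse_def F_def)
  obtain a b c where abc: "jet_of u = (abs_lsq u, a, b, c)" by (simp add: jet_of_def)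
  have "q_form u v = L2_inner f v" if v: "v \<in> form_domain" for v
  proof -
    obtain a' b' c' where abc': "jet_of v = (abs_lsq v, a', b', c')" by (simp add: jet_of_def)
    have jv: "(abs_lsq v, a', b', c') \<in> jets" using form_domainD(4)[OF v] abc' by simp
    have SF: "solution_jet F = (abs_lsq u, a, b, c)" using u(2) abc by simp
    have "inner a a' + inner b b' + inner c c' = 2 * inner (abs_lsq f) (abs_lsq v)"
      using S(2)[OF jv] unfolding SF by (simp add: F_def inner_add_left)
    \<comment> \<open>Testing with i v supplies the imaginary part of the complex identity.\<close>
    moreover have "inner a (imul a') + inner b (imul b') + inner c (imul c') = 2 * inner (abs_lsq f) (imul (abs_lsq v))"
      using S(2)[OF imul_jets[OF jv]] unfolding SF by (simp add: F_def inner_add_left)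
    ultimately have "(cinner a a' + cinner b b' + cinner c c') / 2 = cinner (abs_lsq f) (abs_lsq v)"
      by (simp add: cinner_def complex_eq_iff)
    then show ?thesis
      using q_form_jet[OF u(1) v abc abc'] A form_domainD(1)[OF v] by (simp add: L2_inner_eq)
  qed
  then show "(u, f) \<in> L_c" using u A by (simp add: L_c_def)
qed

section \<open>The linearized operator\<close>

text \<open>The bound near 0 and the decay at infinity leave a compact interval, on which w is
  continuous.\<close>

lemma vortex_profile_bounded:
  assumes "vortex_profile m \<mu> w"
  shows "\<exists>C. \<forall>r\<ge>0. \<bar>w r\<bar> \<le> C" and "continuous_on {0<..} w"
proof -
  have "isCont w r" if "r > 0" for r
    using assms that by (auto simp: vortex_profile_def intro: field_differentiable_imp_continuous_at)
  then show cont: "continuous_on {0<..} w"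
    by (intro continuous_at_imp_continuous_on) auto
  obtain K where "\<forall>\<^sub>F r in at_right 0. norm (w r) \<le> K"
    using assms by (auto simp: vortex_profile_def elim: BfunE)
  then obtain d where d: "d > 0" "\<And>r. 0 < r \<Longrightarrow> r < d \<Longrightarrow> \<bar>w r\<bar> \<le> K"
    by (auto simp: eventually_at_right_field)
  have "(w \<longlongrightarrow> 0) at_top" using assms by (simp add: vortex_profile_def)
  then have "((\<lambda>r. \<bar>w r\<bar>) \<longlongrightarrow> 0) at_top" by (rule tendsto_rabs_zero)
  then have "\<forall>\<^sub>F r in at_top. \<bar>w r\<bar> < 1" by (rule order_tendstoD) simp
  then obtain M where M: "\<And>r. M \<le> r \<Longrightarrow> \<bar>w r\<bar> < 1" by (auto simp: eventually_at_top_linorder)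
  have "compact (w ` {d..M})"
    by (rule compact_continuous_image[OF continuous_on_subset[OF cont]]) (use d in auto)
  then obtain B where B: "\<And>r. d \<le> r \<Longrightarrow> r \<le> M \<Longrightarrow> \<bar>w r\<bar> \<le> B"
    using compact_imp_bounded by (fastforce simp: bounded_iff)
  \<comment> \<open>A profile lives on r > 0, but the value w 0 is taken at the origin of the plane,
    hence its own term in the bound.\<close>
  have "\<bar>w r\<bar> \<le> max (max K B) (max 1 \<bar>w 0\<bar>)" if "r \<ge> 0" for r
    using d(2)[of r] B[of r] M[of r] that
    by (cases "r = 0"; cases "r < d"; cases "r \<le> M") (auto simp: le_max_iff_disj)
  then show "\<exists>C. \<forall>r\<ge>0. \<bar>w r\<bar> \<le> C" by blast
qed

text \<open>The branch cut of \<open>Arg\<close> disappears for integer multiples of the angle,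
  which makes measurability of the rotation visible. The value 1 at the origin comes from
  \<open>Arg 0 = 0\<close>.\<close>

lemma cis_polar_angle:
  "cis (real n * polar_angle x) = (if x = 0 then 1 else sgn (Complex (x $ 1) (x $ 2)) ^ n)"
proof (cases "x = 0")
  case True
  then show ?thesis by (simp add: polar_angle_def Arg_zero flip: complex_of_real_def zero_complex.code)
next
  case False
  then have "Complex (x $ 1) (x $ 2) \<noteq> 0"
    by (auto simp: complex_eq_iff field_eq_iff forall_2)
  then have "cis (polar_angle x) = sgn (Complex (x $ 1) (x $ 2))"
    unfolding polar_angle_def by (simp add: cis_Arg)
  moreover have "cis (real n * polar_angle x) = cis (polar_angle x) ^ n"
    by (rule Complex.DeMoivre[symmetric])
  ultimately show ?thesis using False by simp
qed

section \<open>Measurability and boundedness of the potential matrix\<close>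

lemma R_mult: "R *v v = vector [v $ 1, - (v $ 2)]"
  by (simp add: R_def matrix_vector_mult_def field_eq_iff forall_2 sum_2)

lemma w_matrix_mult:
  "w_matrix m \<mu> w x *v v = (2 * \<bar>w (norm x)\<bar>\<^sup>2 - \<mu>) *\<^sub>R v
    + \<bar>w (norm x)\<bar>\<^sup>2 *\<^sub>R (Re (cis (real (2 * m) * polar_angle x)) *\<^sub>R (R *v v)
      + Im (cis (real (2 * m) * polar_angle x)) *\<^sub>R (J *v (R *v v)))"
proof -
  have sc: "(k *\<^sub>R A) *v u = k *\<^sub>R (A *v u)" for k and A :: "complex^2^2" and u
    by (simp add: matrix_vector_mult_def field_eq_iff scaleR_sum_right)
  have assoc: "(A ** B) *v u = A *v (B *v u)" for A B :: "complex^2^2" and u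
    by (rule matrix_vector_mul_assoc[symmetric])
  show ?thesis
    unfolding w_matrix_def matrix_exp_J matrix_vector_mult_add_rdistrib matrix_vector_mult_diff_rdistrib
      sc assoc matrix_vector_mul_lid
    by (simp add: scaleR_diff_left)
qed

lemma borel_measurable_R [measurable]: "(*v) R \<in> borel_measurable borel"
proof (rule borel_measurable_continuous_onI, rule linear_continuous_on)
  show "bounded_linear ((*v) R)"
    by (rule bounded_linear_intro[where K = 1])
      (simp_all add: R_mult field_eq_iff forall_2 norm_vec_def L2_set_def sum_2)
qed

lemma norm_R: "norm (R *v v) = norm v"
  by (simp add: R_mult norm_vec_def L2_set_def sum_2)

lemma w_matrix_field_map:
  assumes "vortex_profile m \<mu> w"
  shows "\<exists>C. bounded_field_map (\<lambda>x v. w_matrix m \<mu> w x *v v) C"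
proof -
  obtain C where C: "\<And>r. r \<ge> 0 \<Longrightarrow> \<bar>w r\<bar> \<le> C" using vortex_profile_bounded(1)[OF assms] by blast
  \<comment> \<open>Continuity of w is available on the positive reals, so the origin is treated
    separately.\<close>
  have "(\<lambda>r. indicator {0<..} r *\<^sub>R w r) \<in> borel_measurable borel"
    by (intro borel_measurable_continuous_on_indicator vortex_profile_bounded(2)[OF assms]) auto
  then have "(\<lambda>x::real^2. if x = 0 then w 0 else indicator {0<..} (norm x) *\<^sub>R w (norm x)) \<in> borel_measurable borel"
    by measurable
  moreover have "(\<lambda>x::real^2. if x = 0 then w 0 else indicator {0<..} (norm x) *\<^sub>R w (norm x)) = (\<lambda>x. w (norm x))"
    by (auto simp: fun_eq_iff indicator_def)
  ultimately have wm [measurable]: "(\<lambda>x::real^2. w (norm x)) \<in> borel_measurable borel" by simp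
  have "(\<lambda>x::real^2. Complex (x $ 1) (x $ 2)) \<in> borel_measurable borel"
    unfolding Complex_eq by measurable
  then have cm [measurable]: "(\<lambda>x. cis (real (2 * m) * polar_angle x)) \<in> borel_measurable borel"
    unfolding cis_polar_angle sgn_div_norm by measurable
  \<comment> \<open>The scalar part contributes 2 C^2 + |\<mu>|; bounding cosine and sine by 1 each
    gives another 2 C^2 for the rotated reflection.\<close>
  have "bounded_field_map (\<lambda>x v. w_matrix m \<mu> w x *v v) (4 * C\<^sup>2 + \<bar>\<mu>\<bar>)"
  proof
    fix f :: field2 assume [measurable]: "f \<in> borel_measurable borel"
    have [measurable]: "(\<lambda>x. R *v f x) \<in> borel_measurable borel" "(\<lambda>x. J *v (R *v f x)) \<in> borel_measurable borel"
      by measurable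
    show "(\<lambda>x. w_matrix m \<mu> w x *v f x) \<in> borel_measurable borel"
      unfolding w_matrix_mult by measurable
  next
    show "w_matrix m \<mu> w x *v (a + b) = w_matrix m \<mu> w x *v a + w_matrix m \<mu> w x *v b" for x a b
      by (rule matrix_vector_right_distrib)
    show "w_matrix m \<mu> w x *v (c *s a) = c *s (w_matrix m \<mu> w x *v a)" for x c a
      by (simp add: vector_scalar_commute)
    fix x :: "real^2" and a :: "complex^2"
    define s t where "s = Re (cis (real (2 * m) * polar_angle x))" and "t = Im (cis (real (2 * m) * polar_angle x))"
    have st: "\<bar>s\<bar> \<le> 1" "\<bar>t\<bar> \<le> 1" by (simp_all add: s_def t_def)
    define W where "W = \<bar>w (norm x)\<bar>\<^sup>2"
    have W: "0 \<le> W" by (simp add: W_def)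
    have W': "W \<le> C\<^sup>2" unfolding W_def by (rule power_mono[OF C]) simp_all
    have "norm (s *\<^sub>R (R *v a) + t *\<^sub>R (J *v (R *v a))) \<le> \<bar>s\<bar> * norm a + \<bar>t\<bar> * norm a"
      by (rule order_trans[OF norm_triangle_ineq]) (simp add: norm_R norm_J)
    also have "\<dots> \<le> 1 * norm a + 1 * norm a"
      by (intro add_mono mult_right_mono st) auto
    finally have 1: "norm (s *\<^sub>R (R *v a) + t *\<^sub>R (J *v (R *v a))) \<le> 2 * norm a" by simp
    have "w_matrix m \<mu> w x *v a = (2 * W - \<mu>) *\<^sub>R a + W *\<^sub>R (s *\<^sub>R (R *v a) + t *\<^sub>R (J *v (R *v a)))"
      by (simp only: w_matrix_mult W_def s_def t_def)
    then have "norm (w_matrix m \<mu> w x *v a) \<le> \<bar>2 * W - \<mu>\<bar> * norm a + W * (2 * norm a)"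
      using norm_triangle_ineq[of "(2 * W - \<mu>) *\<^sub>R a" "W *\<^sub>R (s *\<^sub>R (R *v a) + t *\<^sub>R (J *v (R *v a)))"]
        mult_left_mono[OF 1 W] W by simp
    also have "\<dots> \<le> (2 * C\<^sup>2 + \<bar>\<mu>\<bar>) * norm a + C\<^sup>2 * (2 * norm a)"
      using W W' by (intro add_mono mult_right_mono) auto
    finally show "norm (w_matrix m \<mu> w x *v a) \<le> (4 * C\<^sup>2 + \<bar>\<mu>\<bar>) * norm a"
      by (simp add: algebra_simps)
  qed
  then show ?thesis by blast
qed

section \<open>The pencil of the linearized operator\<close>

locale linearization =
  fixes m :: nat and \<mu> :: real and w :: "real \<Rightarrow> real" and C :: real
  assumes w_map: "bounded_field_map (\<lambda>x v. w_matrix m \<mu> w x *v v) C"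
begin

sublocale W: bounded_field_map "\<lambda>x v. w_matrix m \<mu> w x *v v" C
  by (rule w_map)

abbreviation "A \<equiv> linearized_operator m \<mu> w"

definition Wop :: "lsq \<Rightarrow> lsq" where
  "Wop = pointwise (\<lambda>x v. w_matrix m \<mu> w x *v v)"

definition Bop :: "lsq \<Rightarrow> lsq" where
  "Bop u = u - 2 *\<^sub>C Wop u"

definition Gop :: "lsq \<Rightarrow> lsq" where
  "Gop u = 2 *\<^sub>C Jop u"

lemma Wop_bounded_clinear: "bounded_clinear Wop"
  unfolding Wop_def by (rule W.pointwise_bounded_clinear)

lemma Gop_bounded_clinear: "bounded_clinear Gop"
  unfolding Gop_def by (intro bounded_clinear_compose[OF bounded_clinear_scaleC] J.pointwise_bounded_clinear)

sublocale approximable_pencil osc_inverse Bop Gop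
proof
  show "bounded_clinear Bop"
    unfolding Bop_def
    by (intro bounded_clinear_diff bounded_clinear_ident bounded_clinear_compose[OF bounded_clinear_scaleC] Wop_bounded_clinear)
qed (use osc_inverse_bounded_clinear Gop_bounded_clinear osc_inverse_approximable in auto)

definition source :: "field2 \<Rightarrow> lsq" where
  "source f = osc_inverse (Gop (abs_lsq f))"

lemma source_zero: "source (\<lambda>x. 0) = 0"
  by (simp add: source_def bounded_clinearD(3)[OF osc_inverse_bounded_clinear] bounded_clinearD(3)[OF Gop_bounded_clinear]
      flip: zero_lsq_def)

lemma source_bound: "\<exists>C\<ge>0. \<forall>f\<in>L2. norm (source f) \<le> C * L2_norm f"
proof -
  obtain C where "C \<ge> 0" "\<And>v. norm (osc_inverse (Gop v)) \<le> norm v * C"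
    using bounded_linear.nonneg_bounded[OF bounded_clinearD(6)[OF bounded_clinear_compose[OF osc_inverse_bounded_clinear Gop_bounded_clinear]]]
    by blast
  then show ?thesis by (auto simp: source_def L2_norm_eq mult.commute)
qed

text \<open>Multiplying \<open>(A - z) u = f\<close> by \<open>J\<close> gives \<open>(2 L\<^sub>c + 1) u = u - 2 L\<^sub>w u + 2 z J u + 2 J f\<close>,
  and \<open>osc_inverse\<close> inverts \<open>2 L\<^sub>c + 1\<close>.\<close>

lemma solves_shifted_iff:
  assumes f: "f \<in> L2"
  shows "solves_shifted A z f u \<longleftrightarrow> u \<in> L2 \<and> abs_lsq u = K z (abs_lsq u) + source f"
proof -
  note TD = bounded_clinearD[OF osc_inverse_bounded_clinear]
  note JD = bounded_clinearD[OF J.pointwise_bounded_clinear]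
  have rhs: "K z v + source f = osc_inverse (2 *\<^sub>R (Jop (abs_lsq f) - Wop v + z *\<^sub>C Jop v) + v)" for v
  proof -
    have "2 *\<^sub>R x = 2 *\<^sub>C x" for x :: lsq using scaleC_of_real[of 2 x] by simp
    then have "Bop v + z *\<^sub>C Gop v + Gop (abs_lsq f) = 2 *\<^sub>R (Jop (abs_lsq f) - Wop v + z *\<^sub>C Jop v) + v"
      by (simp add: Bop_def Gop_def scaleC_add_right scaleC_diff_right mult.commute)
    then show ?thesis by (simp add: K_def source_def flip: TD(1))
  qed
  have op: "abs_lsq (\<lambda>x. - (J *v (h x + L_w m \<mu> w u x))) = - Jop (abs_lsq h + Wop (abs_lsq u))"
    "(\<lambda>x. - (J *v (h x + L_w m \<mu> w u x))) \<in> L2"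
    if "h \<in> L2" "u \<in> L2" for h
    using that by (simp_all add: L_w_def Wop_def W.pointwise_abs W.F_L2 L2_add J.F_L2 J.pointwise_abs abs_lsq_minus L2_minus
        flip: abs_lsq_add)
  show ?thesis
  proof
    assume "solves_shifted A z f u"
    then obtain g h where gf: "L2_eq (\<lambda>x. g x - z *s u x) f" and g: "g \<in> L2" and h: "(u, h) \<in> L_c"
      and gh: "L2_eq g (\<lambda>x. - (J *v (h x + L_w m \<mu> w u x)))"
      by (auto simp: solves_shifted_def linearized_operator_def)
    have u: "u \<in> L2" and hL: "h \<in> L2" and sol: "abs_lsq u = osc_inverse (2 *\<^sub>R abs_lsq h + abs_lsq u)"
      using h by (auto simp: L_c_iff)
    have "abs_lsq g = - Jop (abs_lsq h + Wop (abs_lsq u))"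
      using gh g op[OF hL u] by (simp add: flip: abs_lsq_eq_iff)
    moreover have "abs_lsq f = abs_lsq g - z *\<^sub>C abs_lsq u"
      using gf f g u abs_lsq_eq_iff[of "\<lambda>x. g x - z *s u x" f]
      by (simp add: L2_diff L2_vec_scale abs_lsq_diff abs_lsq_vec_scale)
    ultimately have "Jop (abs_lsq f) = abs_lsq h + Wop (abs_lsq u) - z *\<^sub>C Jop (abs_lsq u)"
      using JD(2)[of 0 "Jop (abs_lsq h + Wop (abs_lsq u))"] by (simp add: JD(2,3,4) Jop_Jop)
    then have "Jop (abs_lsq f) - Wop (abs_lsq u) + z *\<^sub>C Jop (abs_lsq u) = abs_lsq h" by simp
    with sol u show "u \<in> L2 \<and> abs_lsq u = K z (abs_lsq u) + source f"
      by (simp only: rhs)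
  next
    assume u: "u \<in> L2 \<and> abs_lsq u = K z (abs_lsq u) + source f"
    \<comment> \<open>The value that L_c u must have: the equation multiplied by J and solved for
      this term.\<close>
    define h where "h = rep_lsq (Jop (abs_lsq f) - Wop (abs_lsq u) + z *\<^sub>C Jop (abs_lsq u))"
    define g where "g = (\<lambda>x. - (J *v (h x + L_w m \<mu> w u x)))"
    have h: "h \<in> L2" "abs_lsq h = Jop (abs_lsq f) - Wop (abs_lsq u) + z *\<^sub>C Jop (abs_lsq u)"
      by (simp_all add: h_def)
    have "(u, h) \<in> L_c" using u h by (simp add: L_c_iff flip: rhs)
    moreover have g: "g \<in> L2" using op(2)[OF h(1)] u by (simp add: g_def)
    ultimately have "(u, g) \<in> A" by (auto simp: linearized_operator_def g_def)
    moreover have "abs_lsq (\<lambda>x. g x - z *s u x) = abs_lsq f"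
    proof -
      have "abs_lsq g = - Jop (Jop (abs_lsq f + z *\<^sub>C abs_lsq u))"
        using op(1)[OF h(1)] u by (simp add: g_def h(2) JD(1,4))
      then show ?thesis using u g by (simp add: abs_lsq_diff L2_vec_scale abs_lsq_vec_scale Jop_Jop)
    qed
    then have "L2_eq (\<lambda>x. g x - z *s u x) f"
      using u f g by (simp add: abs_lsq_eq_iff L2_diff L2_vec_scale)
    ultimately show "solves_shifted A z f u" by (auto simp: solves_shifted_def)
  qed
qed

section \<open>Resolvent, spectrum and Riesz projections\<close>

lemma resolvent_solves:
  assumes "z \<notin> singular" "f \<in> L2"
  shows "solves_shifted A z f (resolvent A z f)"
proof -
  obtain v where "v = K z v + source f" using regular_point_solution(1)[OF assms(1)] by blast
  then have "solves_shifted A z f (rep_lsq v)" using assms(2) by (simp add: solves_shifted_iff)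
  then show ?thesis unfolding resolvent_def by (rule someI[of "solves_shifted A z f"])
qed

lemma singular_eigenvalue:
  assumes "z \<in> singular" shows "eigenvalue A z"
proof -
  obtain v where v: "v \<noteq> 0" "v = K z v" using assms by (auto simp: singular_def)
  have "solves_shifted A z (\<lambda>x. 0) (rep_lsq v)" using v(2) by (simp add: solves_shifted_iff source_zero)
  moreover have "\<not> L2_eq (rep_lsq v) (\<lambda>x. 0)"
    using v(1) abs_lsq_eq_iff[of "rep_lsq v" "\<lambda>x. 0"] by (simp add: zero_lsq_def)
  ultimately show ?thesis unfolding eigenvalue_def by blast
qed

text \<open>At regular points existence, uniqueness and the bound come from the Fredholm analysis.
  At singular points uniqueness fails, because 0 and an eigenfunction both solve the homogeneous
  equation.\<close>

lemma spectrum_eq: "spectrum A = singular"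
proof -
  have "z \<in> resolvent_set A" if z: "z \<notin> singular" for z
  proof -
    obtain C where C: "\<And>g u. u = K z u + g \<Longrightarrow> norm u \<le> C * norm g"
      using regular_point_solution(2)[OF z] by blast
    obtain C' where C': "C' \<ge> 0" "\<And>f. f \<in> L2 \<Longrightarrow> norm (source f) \<le> C' * L2_norm f"
      using source_bound by blast
    have "L2_norm (resolvent A z f) \<le> max C 0 * C' * L2_norm f" if f: "f \<in> L2" for f
    proof -
      have r: "resolvent A z f \<in> L2" "abs_lsq (resolvent A z f) = K z (abs_lsq (resolvent A z f)) + source f"
        using resolvent_solves[OF z f] solves_shifted_iff[OF f] by auto
      have "L2_norm (resolvent A z f) \<le> C * norm (source f)"
        using C[OF r(2)] by (simp add: L2_norm_eq r(1))
      also have "\<dots> \<le> max C 0 * (C' * L2_norm f)"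
        using C'(2)[OF f] by (intro mult_mono) auto
      finally show ?thesis by (simp add: mult.assoc)
    qed
    moreover have "L2_eq u v" if "f \<in> L2" "solves_shifted A z f u" "solves_shifted A z f v" for f u v
      using that solution_unique[OF z] abs_lsq_eq_iff[of u v] by (auto simp: solves_shifted_iff)
    ultimately show ?thesis
      unfolding resolvent_set_def using resolvent_solves[OF z] by blast
  qed
  moreover have "z \<notin> resolvent_set A" if z: "z \<in> singular" for z
  proof
    assume "z \<in> resolvent_set A"
    then have uniq: "L2_eq u v" if "solves_shifted A z (\<lambda>x. 0) u" "solves_shifted A z (\<lambda>x. 0) v" for u v
      using that L2_zero unfolding resolvent_set_def by blast
    obtain u where u: "solves_shifted A z (\<lambda>x. 0) u" "\<not> L2_eq u (\<lambda>x. 0)"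
      using singular_eigenvalue[OF z] by (auto simp: eigenvalue_def)
    have "solves_shifted A z (\<lambda>x. 0) (\<lambda>x. 0)"
      by (simp add: solves_shifted_iff source_zero bounded_clinearD(3)[OF K_bounded_clinear] flip: zero_lsq_def)
    with u uniq show False by blast
  qed
  ultimately show ?thesis unfolding spectrum_def by blast
qed

text \<open>\<open>- J L\<^sub>c\<close> is skew-adjoint, so a real number beyond the bound of \<open>L\<^sub>w\<close> is no eigenvalue.\<close>

lemma regular_point: "of_real (C + 1) \<notin> singular"
proof
  assume "of_real (C + 1) \<in> singular"
  then obtain u where u: "u \<noteq> 0" "u = K (of_real (C + 1)) u" by (auto simp: singular_def)
  define F where "F = Bop u + of_real (C + 1) *\<^sub>C Gop u"
  have F: "F = u - 2 *\<^sub>R Wop u + (2 * (C + 1)) *\<^sub>R Jop u"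
    using scaleC_of_real[of 2 "Wop u"] scaleC_of_real[of "2 * (C + 1)" "Jop u"]
    by (simp add: F_def Bop_def Gop_def mult.commute)
  obtain u' a b c where p: "solution_jet F = (u', a, b, c)" using prod_cases4 by blast
  have "u = osc_inverse F" using u(2) unfolding K_def F_def .
  then have "u' = u" by (simp add: osc_inverse_def p)
  have S: "(u, a, b, c) \<in> jets" "\<And>q. q \<in> jets \<Longrightarrow> inner (u, a, b, c) q = inner F (fst q)"
    using solution_jet[of F] by (auto simp: weak_solution_def p \<open>u' = u\<close>)
  have JJ: "inner x (Jop x) = 0" for x
    using inner_Jop[of x x] by (simp add: inner_commute)
  \<comment> \<open>The test vector is J applied to the jet of u. Each component is orthogonal to
    its image under J, so the oscillator contributes nothing.\<close>
  have "inner F (Jop u) = 0"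
    using S(2)[OF Jop_jets[OF S(1)]] by (simp add: JJ)
  moreover have "inner (Jop u) (Jop u) = inner u u"
    by (simp add: inner_Jop Jop_Jop)
  \<comment> \<open>What remains balances the spectral parameter C + 1 against the potential, whose
    norm is at most C.\<close>
  ultimately have "(C + 1) * (norm u)\<^sup>2 = inner (Wop u) (Jop u)"
    by (simp add: F inner_add_left inner_diff_left JJ power2_norm_eq_inner algebra_simps)
  also have "\<dots> \<le> norm (Wop u) * norm (Jop u)" by (rule norm_cauchy_schwarz)
  also have "\<dots> \<le> (C * norm u) * norm u"
    using W.norm_pointwise[of u] J.norm_pointwise[of u] W.C_nonneg by (intro mult_mono) (auto simp: Wop_def)
  finally have "(norm u)\<^sup>2 \<le> 0" by (simp add: power2_eq_square algebra_simps)
  with u(1) show False by simp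
qed

text \<open>The vectors e from the residue lemma do not depend on f, so their span contains the
  range of the Riesz projection; its scalar prefactor goes into the coefficients.\<close>

lemma spectrum_subset_discrete: "spectrum A \<subseteq> discrete_spectrum A"
proof
  fix z0 assume "z0 \<in> spectrum A"
  then have z0: "z0 \<in> singular" by (simp add: spectrum_eq)
  obtain \<epsilon> and I :: "(nat \<times> nat) set" and e where \<epsilon>: "\<epsilon> > 0" "cball z0 \<epsilon> \<inter> singular = {z0}" and I: "finite I"
    and res: "\<forall>g. \<exists>c. \<forall>r. (\<forall>\<zeta>\<in>sphere z0 \<epsilon>. r \<zeta> = K \<zeta> (r \<zeta>) + g) \<longrightarrow>
      (\<forall>h. contour_integral (circlepath z0 \<epsilon>) (\<lambda>\<zeta>. cinner (r \<zeta>) h) = cinner (\<Sum>i\<in>I. c i *\<^sub>C e i) h)"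
    using singular_point_residue[OF z0 regular_point] by (elim exE conjE) (rule that; assumption)
  have "ball z0 \<epsilon> \<inter> singular = ball z0 \<epsilon> \<inter> (cball z0 \<epsilon> \<inter> singular)"
    using ball_subset_cball[of z0 \<epsilon>] by blast
  also have "\<dots> = {z0}" unfolding \<epsilon>(2) using \<epsilon>(1) by simp
  finally have "ball z0 \<epsilon> \<inter> singular = {z0}" .
  then have "z0 isolated_in spectrum A"
    unfolding isolated_in_def spectrum_eq using z0 open_ball by blast
  moreover have "finite_algebraic_multiplicity A z0"
  proof -
    obtain \<sigma> where \<sigma>: "bij_betw \<sigma> {0..<card I} I" using ex_bij_betw_nat_finite[OF I] by blast
    define b where "b k = rep_lsq (e (\<sigma> k))" for k
    have "\<exists>c. riesz_projection A z0 \<epsilon> f (\<lambda>x. \<Sum>k<card I. c k *s b k x)" if f: "f \<in> L2" for f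
    proof -
      obtain c where c: "\<forall>r. (\<forall>\<zeta>\<in>sphere z0 \<epsilon>. r \<zeta> = K \<zeta> (r \<zeta>) + source f) \<longrightarrow>
          (\<forall>h. contour_integral (circlepath z0 \<epsilon>) (\<lambda>\<zeta>. cinner (r \<zeta>) h) = cinner (\<Sum>i\<in>I. c i *\<^sub>C e i) h)"
        using spec[OF res, of "source f"] by (elim exE) (rule that)
      define s where "s = - (1 / (2 * of_real pi * \<i>))"
      define p where "p x = (\<Sum>k<card I. (s * c (\<sigma> k)) *s b k x)" for x
      have bL: "b k \<in> L2" for k by (simp add: b_def)
      have p: "p \<in> L2" unfolding p_def by (intro L2_sum L2_vec_scale bL)
      have "abs_lsq p = (\<Sum>k<card I. (s * c (\<sigma> k)) *\<^sub>C e (\<sigma> k))"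
        unfolding p_def by (simp add: abs_lsq_sum L2_vec_scale bL abs_lsq_vec_scale) (simp add: b_def)
      also have "\<dots> = (\<Sum>i\<in>I. (s * c i) *\<^sub>C e i)"
        using sum.reindex_bij_betw[OF \<sigma>, of "\<lambda>i. (s * c i) *\<^sub>C e i"] by (simp add: atLeast0LessThan)
      finally have abs_p: "abs_lsq p = s *\<^sub>C (\<Sum>i\<in>I. c i *\<^sub>C e i)" by (simp add: scaleC_sum_right)
      \<comment> \<open>The resolvent solves the equation all along the circle, since z0 is the only
        singular point of the closed disc.\<close>
      have R: "resolvent A \<zeta> f \<in> L2" "abs_lsq (resolvent A \<zeta> f) = K \<zeta> (abs_lsq (resolvent A \<zeta> f)) + source f"
        if "\<zeta> \<in> sphere z0 \<epsilon>" for \<zeta>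
      proof -
        have "\<zeta> \<notin> singular" using \<epsilon> that by fastforce
        from resolvent_solves[OF this f] show "resolvent A \<zeta> f \<in> L2"
          "abs_lsq (resolvent A \<zeta> f) = K \<zeta> (abs_lsq (resolvent A \<zeta> f)) + source f"
          using solves_shifted_iff[OF f] by auto
      qed
      have "L2_inner p g = s * contour_integral (circlepath z0 \<epsilon>) (\<lambda>\<zeta>. L2_inner (resolvent A \<zeta> f) g)"
        if g: "g \<in> L2" for g
      proof -
        have "contour_integral (circlepath z0 \<epsilon>) (\<lambda>\<zeta>. L2_inner (resolvent A \<zeta> f) g)
            = contour_integral (circlepath z0 \<epsilon>) (\<lambda>\<zeta>. cinner (abs_lsq (resolvent A \<zeta> f)) (abs_lsq g))"
          using R(1) g \<epsilon>(1) by (intro contour_integral_cong) (auto simp: L2_inner_eq)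
        also have "\<dots> = cinner (\<Sum>i\<in>I. c i *\<^sub>C e i) (abs_lsq g)"
          by (rule c[rule_format, of "\<lambda>\<zeta>. abs_lsq (resolvent A \<zeta> f)"]) (rule R(2))
        finally show ?thesis using p g by (simp add: L2_inner_eq abs_p)
      qed
      then have "riesz_projection A z0 \<epsilon> f p"
        using p by (simp add: riesz_projection_def s_def)
      then show ?thesis unfolding p_def by (intro exI[of _ "\<lambda>k. s * c (\<sigma> k)"])
    qed
    then show ?thesis
      unfolding finite_algebraic_multiplicity_def spectrum_eq using \<epsilon>
      by (intro exI[of _ \<epsilon>] conjI exI[of _ "card I"] exI[of _ b]) (auto simp: b_def)
  qed
  ultimately show "z0 \<in> discrete_spectrum A"
    using singular_eigenvalue[OF z0] by (simp add: discrete_spectrum_def)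
qed

end

theorem proposition2:
  fixes m :: nat and \<mu> :: real and w :: "real \<Rightarrow> real"
  assumes "m \<ge> 1"
    and "vortex_profile m \<mu> w"
  shows "spectrum (linearized_operator m \<mu> w) = discrete_spectrum (linearized_operator m \<mu> w)
       \<and> essential_spectrum (linearized_operator m \<mu> w) = {}"
proof -
  obtain C where "bounded_field_map (\<lambda>x v. w_matrix m \<mu> w x *v v) C"
    using w_matrix_field_map[OF assms(2)] by blast
  then interpret linearization m \<mu> w C by (rule linearization.intro)
  have "discrete_spectrum A \<subseteq> spectrum A"
    by (auto simp: discrete_spectrum_def isolated_in_def)
  with spectrum_subset_discrete show ?thesis
    by (auto simp: essential_spectrum_def)
qed

end
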